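(* Let $F$ be the topological support of $\mu$. Then the Dirichlet form $\check{\mathcal E}$, considered in $L^2(F,\mu)$, is regular.
   Context: Let $X$ be a locally compact separable metric space, $m$ a positive Radon measure on $X$ with full support $X$, and $\mu$ a positive Radon measure on $X$. Put $\mathcal H:=L^2(X,m)$, $\mathcal H_{\mathrm{aux}}:=L^2(X,\mu)$ (real spaces). Let $\mathcal E$ be a regular Dirichlet form in $L^2(X,m)$ with domain $\mathcal D$, and assume that $\mu$ does not charge any set of zero capacity (capacity with respect to $\mathcal E$). All elements of $\mathcal D$ are taken to be quasi-continuous (every element has a quasi-continuous representative, unique quasi-everywhere and hence $\mu$-a.e.). Let $J\colon\operatorname{dom}J:=\mathcal D\cap L^2(X,\mu)\to L^2(X,\mu)$, $Ju:=u$. Write $\mathcal E_\lambda[u]:=\mathcal E[u]+\lambda\|u\|^2_{L^2(X,m)}$ for $\lambda>0$. The operator $J$ has dense range and is closed from $(\mathcal D,\mathcal E_1^{1/2})$ to $L^2(X,\mu)$. Trace form: for $\lambda>0$ let $P_\lambda$ be the $\mathcal E_\lambda$-orthogonal projection in $(\mathcal D,\mathcal E_\lambda^{1/2})$ onto the $\mathcal E_\lambda$-orthogonal complement of $\ker J$; let $\check{\mathcal E}_\lambda$ be the closed positive densely defined form in $L^2(X,\mu)$ with $\operatorname{dom}\check{\mathcal E}_\lambda:=\operatorname{ran}J$, $\check{\mathcal E}_\lambda[Ju]:=\mathcal E_\lambda[P_\lambda u]$, and $\check H_\lambda$ the associated positive self-adjoint operator. The trace $\check{\mathcal E}$ of $\mathcal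 E$ with respect to $J$ is the closed form associated with the positive self-adjoint operator $\check H$ determined by $(\check H_\lambda+1)^{-1}\to(\check H+1)^{-1}$ strongly as $\lambda\downarrow0$. Equivalently, $\check{\mathcal E}$ is the closure of the regular part (largest closable minorant with the same domain) of the form $\check{\mathcal E}_0[Ju]:=\lim_{\lambda\downarrow0}\check{\mathcal E}_\lambda[Ju]$ on $\operatorname{ran}J$. The form $\check{\mathcal E}$ is a Dirichlet form. Since $\mu(X\setminus F)=0$, $L^2(X,\mu)$ is naturally identified with $L^2(F,\mu)$. A Dirichlet form in $L^2(F,\mu)$ with domain $\check{\mathcal D}$ is regular if $C_c(F)\cap\check{\mathcal D}$ is dense in $\check{\mathcal D}$ with respect to the form norm $(\check{\mathcal E}[\cdot]+\|\cdot\|^2_{L^2(F,\mu)})^{1/2}$ and dense in $C_c(F)$ with respect to the uniform norm. *)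

theory Defs
  imports "HOL-Analysis.Analysis"
begin

section \<open>Measures\<close>

definition radon_measure :: "'a::topological_space measure \<Rightarrow> bool" where
  "radon_measure M \<longleftrightarrow>
     sets M = sets borel \<and>
     (\<forall>K. compact K \<longrightarrow> emeasure M K < \<infinity>) \<and>
     (\<forall>A\<in>sets borel. emeasure M A = (SUP K\<in>{K. compact K \<and> K \<in> sets borel \<and> K \<subseteq> A}. emeasure M K))"

definition measure_support :: "'a::topological_space measure \<Rightarrow> 'a set" where
  "measure_support M = {x. \<forall>U. open U \<and> x \<in> U \<longrightarrow> emeasure M U > 0}"


section \<open>The space \<open>L\<^sup>2\<close> and symmetric forms\<close>

text \<open>
  Elements of \<open>L\<^sup>2\<close> are represented by measurable functions. Sets of functions that stand
  for sets of classes (such as form domains) are saturated with respect to almost everywhere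
  equality, and forms do not distinguish almost everywhere equal arguments.
  Values of a function outside the space of the measure are irrelevant.
\<close>

definition L2 :: "'a measure \<Rightarrow> ('a \<Rightarrow> real) set" where
  "L2 M = {f \<in> borel_measurable M. integrable M (\<lambda>x. (f x)\<^sup>2)}"

definition L2_inner :: "'a measure \<Rightarrow> ('a \<Rightarrow> real) \<Rightarrow> ('a \<Rightarrow> real) \<Rightarrow> real" where
  "L2_inner M f g = (\<integral>x. f x * g x \<partial>M)"

definition L2_norm :: "'a measure \<Rightarrow> ('a \<Rightarrow> real) \<Rightarrow> real" where
  "L2_norm M f = sqrt (L2_inner M f f)"

record 'a form =
  fdom :: "('a \<Rightarrow> real) set"
  fval :: "('a \<Rightarrow> real) \<Rightarrow> ('a \<Rightarrow> real) \<Rightarrow> real"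

definition positive_form :: "'a measure \<Rightarrow> 'a form \<Rightarrow> bool" where
  "positive_form M E \<longleftrightarrow>
     fdom E \<subseteq> L2 M \<and>
     (\<lambda>x. 0) \<in> fdom E \<and>
     (\<forall>u\<in>fdom E. \<forall>v\<in>fdom E. (\<lambda>x. u x + v x) \<in> fdom E) \<and>
     (\<forall>u\<in>fdom E. \<forall>c. (\<lambda>x. c * u x) \<in> fdom E) \<and>
     (\<forall>u\<in>fdom E. \<forall>v\<in>borel_measurable M. (AE x in M. u x = v x) \<longrightarrow> v \<in> fdom E) \<and>
     (\<forall>u\<in>fdom E. \<forall>u'\<in>fdom E. \<forall>v\<in>fdom E. (AE x in M. u x = u' x) \<longrightarrow> fval E u v = fval E u' v) \<and>
     (\<forall>u\<in>fdom E. \<forall>v\<in>fdom E. fval E u v = fval E v u) \<and>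
     (\<forall>u\<in>fdom E. \<forall>v\<in>fdom E. \<forall>w\<in>fdom E. fval E (\<lambda>x. u x + v x) w = fval E u w + fval E v w) \<and>
     (\<forall>u\<in>fdom E. \<forall>w\<in>fdom E. \<forall>c. fval E (\<lambda>x. c * u x) w = c * fval E u w) \<and>
     (\<forall>u\<in>fdom E. fval E u u \<ge> 0)"

definition form_norm :: "'a measure \<Rightarrow> 'a form \<Rightarrow> ('a \<Rightarrow> real) \<Rightarrow> real" where
  "form_norm M E u = sqrt (fval E u u + (L2_norm M u)\<^sup>2)"

definition closed_form :: "'a measure \<Rightarrow> 'a form \<Rightarrow> bool" where
  "closed_form M E \<longleftrightarrow>
     positive_form M E \<and>
     (\<forall>u :: nat \<Rightarrow> 'a \<Rightarrow> real.
        (\<forall>n. u n \<in> fdom E) \<and>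
        (\<forall>\<epsilon>>0. \<exists>N. \<forall>i\<ge>N. \<forall>j\<ge>N. form_norm M E (\<lambda>x. u i x - u j x) < \<epsilon>) \<longrightarrow>
        (\<exists>w\<in>fdom E. (\<lambda>n. form_norm M E (\<lambda>x. u n x - w x)) \<longlonglongrightarrow> 0))"

definition densely_defined_form :: "'a measure \<Rightarrow> 'a form \<Rightarrow> bool" where
  "densely_defined_form M E \<longleftrightarrow>
     (\<forall>f\<in>L2 M. \<forall>\<epsilon>>0. \<exists>u\<in>fdom E. L2_norm M (\<lambda>x. f x - u x) < \<epsilon>)"

definition dirichlet_form :: "'a measure \<Rightarrow> 'a form \<Rightarrow> bool" where
  "dirichlet_form M E \<longleftrightarrow>
     closed_form M E \<and> densely_defined_form M E \<and>
     (\<forall>u\<in>fdom E. (\<lambda>x. min (max (u x) 0) 1) \<in> fdom E \<and>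
        fval E (\<lambda>x. min (max (u x) 0) 1) (\<lambda>x. min (max (u x) 0) 1) \<le> fval E u u)"

text \<open>\<open>C\<^sub>c(S)\<close> for a subset \<open>S\<close> carrying the subspace topology.\<close>

definition Cc :: "'a::topological_space set \<Rightarrow> ('a \<Rightarrow> real) set" where
  "Cc S = {\<phi>. continuous_on S \<phi> \<and> (\<exists>K. compact K \<and> K \<subseteq> S \<and> (\<forall>x\<in>S - K. \<phi> x = 0))}"

text \<open>
  The underlying topological space of a form in \<open>L\<^sup>2(M)\<close> is the space of \<open>M\<close>: the whole type,
  or the subspace \<open>F\<close> if \<open>M\<close> has the form \<open>restrict_space \<mu> F\<close>.
\<close>

definition regular_dirichlet_form :: "'a::topological_space measure \<Rightarrow> 'a form \<Rightarrow> bool" where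
  "regular_dirichlet_form M E \<longleftrightarrow>
     dirichlet_form M E \<and>
     (\<forall>u\<in>fdom E. \<forall>\<epsilon>>0. \<exists>\<phi>\<in>Cc (space M) \<inter> fdom E. form_norm M E (\<lambda>x. u x - \<phi> x) < \<epsilon>) \<and>
     (\<forall>\<phi>\<in>Cc (space M). \<forall>\<epsilon>>0. \<exists>\<psi>\<in>Cc (space M) \<inter> fdom E. \<forall>x\<in>space M. \<bar>\<phi> x - \<psi> x\<bar> < \<epsilon>)"


section \<open>Capacity and quasi-continuity\<close>

definition shifted_form :: "'a measure \<Rightarrow> 'a form \<Rightarrow> real \<Rightarrow> 'a form" where
  "shifted_form M E lam = \<lparr>fdom = fdom E, fval = (\<lambda>u v. fval E u v + lam * L2_inner M u v)\<rparr>"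

definition capacity :: "'a::topological_space measure \<Rightarrow> 'a form \<Rightarrow> 'a set \<Rightarrow> ennreal" where
  "capacity m E A =
     (INF G\<in>{G. open G \<and> A \<subseteq> G}.
       INF u\<in>{u \<in> fdom E. AE x in m. x \<in> G \<longrightarrow> u x \<ge> 1}. ennreal (fval (shifted_form m E 1) u u))"

definition quasi_continuous :: "'a::topological_space measure \<Rightarrow> 'a form \<Rightarrow> ('a \<Rightarrow> real) \<Rightarrow> bool" where
  "quasi_continuous m E u \<longleftrightarrow>
     (\<forall>\<epsilon>>0. \<exists>G. open G \<and> capacity m E G < ennreal \<epsilon> \<and> continuous_on (- G) u)"

definition qc_dom :: "'a::topological_space measure \<Rightarrow> 'a form \<Rightarrow> ('a \<Rightarrow> real) set" where
  "qc_dom m E = {u \<in> fdom E. quasi_continuous m E u}"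


section \<open>The trace of a form\<close>

text \<open>
  The operator \<open>J u = u\<close> reinterprets a quasi-continuous function, representing an \<open>m\<close>-class, as
  a representative of a \<open>\<mu>\<close>-class. Hence \<open>ker J\<close> consists of the functions vanishing
  \<open>\<mu>\<close>-almost everywhere, and \<open>ran J\<close> is saturated under \<open>\<mu>\<close>-almost everywhere equality.
\<close>

definition dom_J :: "'a::topological_space measure \<Rightarrow> 'a form \<Rightarrow> 'a measure \<Rightarrow> ('a \<Rightarrow> real) set" where
  "dom_J m E mu = qc_dom m E \<inter> L2 mu"

definition ker_J :: "'a::topological_space measure \<Rightarrow> 'a form \<Rightarrow> 'a measure \<Rightarrow> ('a \<Rightarrow> real) set" where
  "ker_J m E mu = {u \<in> dom_J m E mu. AE x in mu. u x = 0}"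

definition ran_J :: "'a::topological_space measure \<Rightarrow> 'a form \<Rightarrow> 'a measure \<Rightarrow> ('a \<Rightarrow> real) set" where
  "ran_J m E mu = {v \<in> L2 mu. \<exists>u\<in>dom_J m E mu. AE x in mu. u x = v x}"

definition J_preimage ::
  "'a::topological_space measure \<Rightarrow> 'a form \<Rightarrow> 'a measure \<Rightarrow> ('a \<Rightarrow> real) \<Rightarrow> ('a \<Rightarrow> real)" where
  "J_preimage m E mu v = (SOME u. u \<in> dom_J m E mu \<and> (AE x in mu. u x = v x))"

definition ker_J_orth ::
  "'a::topological_space measure \<Rightarrow> 'a form \<Rightarrow> 'a measure \<Rightarrow> real \<Rightarrow> ('a \<Rightarrow> real) set" where
  "ker_J_orth m E mu lam =
     {u \<in> qc_dom m E. \<forall>w\<in>ker_J m E mu. fval (shifted_form m E lam) u w = 0}"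

text \<open>
  A representative of the orthogonal projection of \<open>u\<close> onto the orthogonal complement of \<open>ker J\<close>;
  it is unique as an \<open>m\<close>-class.
\<close>

definition proj_J ::
  "'a::topological_space measure \<Rightarrow> 'a form \<Rightarrow> 'a measure \<Rightarrow> real \<Rightarrow> ('a \<Rightarrow> real) \<Rightarrow> ('a \<Rightarrow> real)" where
  "proj_J m E mu lam u =
     (SOME p. p \<in> ker_J_orth m E mu lam \<and>
        (\<forall>w\<in>ker_J_orth m E mu lam. fval (shifted_form m E lam) (\<lambda>x. u x - p x) w = 0))"

text \<open>
  The value at \<open>(Ju, Ju')\<close> is \<open>E\<^sub>\<lambda>(P\<^sub>\<lambda> u, P\<^sub>\<lambda> u')\<close>, the polarised version of \<open>E\<^sub>\<lambda>[P\<^sub>\<lambda> u]\<close>. It does not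
  depend on the choice of preimages, as \<open>P\<^sub>\<lambda>\<close> vanishes on \<open>ker J\<close>.
\<close>

definition trace_form_approx ::
  "'a::topological_space measure \<Rightarrow> 'a form \<Rightarrow> 'a measure \<Rightarrow> real \<Rightarrow> 'a form" where
  "trace_form_approx m E mu lam =
     \<lparr>fdom = ran_J m E mu,
      fval = (\<lambda>v w. fval (shifted_form m E lam)
                (proj_J m E mu lam (J_preimage m E mu v))
                (proj_J m E mu lam (J_preimage m E mu w)))\<rparr>"

text \<open>
  The graph of the positive self-adjoint operator associated with a closed densely defined
  positive form, as in the first representation theorem.
\<close>

definition form_operator :: "'a measure \<Rightarrow> 'a form \<Rightarrow> (('a \<Rightarrow> real) \<times> ('a \<Rightarrow> real)) set" where
  "form_operator M E =
     {(u, g). u \<in> fdom E \<and> g \<in> L2 M \<and> (\<forall>v\<in>fdom E. fval E u v = L2_inner M g v)}"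

text \<open>A representative of \<open>(H + 1)\<^sup>-\<^sup>1 f\<close> for an operator given by its graph \<open>H\<close>.\<close>

definition resolvent1 ::
  "'a measure \<Rightarrow> (('a \<Rightarrow> real) \<times> ('a \<Rightarrow> real)) set \<Rightarrow> ('a \<Rightarrow> real) \<Rightarrow> ('a \<Rightarrow> real)" where
  "resolvent1 M H f = (SOME u. \<exists>g. (u, g) \<in> H \<and> (AE x in M. g x + u x = f x))"

text \<open>
  \<open>T\<close> is the trace of \<open>E\<close> with respect to \<open>J\<close>. A closed densely defined form is determined by its
  operator, and the operator by its resolvent, so \<open>T\<close> is unique up to values outside its domain.
\<close>

definition is_trace_form ::
  "'a::topological_space measure \<Rightarrow> 'a form \<Rightarrow> 'a measure \<Rightarrow> 'a form \<Rightarrow> bool" where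
  "is_trace_form m E mu T \<longleftrightarrow>
     closed_form mu T \<and> densely_defined_form mu T \<and>
     (\<forall>f\<in>L2 mu.
        ((\<lambda>lam. L2_norm mu (\<lambda>x.
             resolvent1 mu (form_operator mu (trace_form_approx m E mu lam)) f x
             - resolvent1 mu (form_operator mu T) f x)) \<longlongrightarrow> 0) (at_right 0))"

text \<open>
  A form in \<open>L\<^sup>2(\<mu>)\<close> considered in \<open>L\<^sup>2(F, \<mu>)\<close>, where \<open>\<mu>\<close> is concentrated on \<open>F\<close>: functions on \<open>F\<close>
  are identified with their extensions by zero.
\<close>

definition zero_ext :: "'a set \<Rightarrow> ('a \<Rightarrow> real) \<Rightarrow> ('a \<Rightarrow> real)" where
  "zero_ext F v = (\<lambda>x. if x \<in> F then v x else 0)"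

definition form_on :: "'a set \<Rightarrow> 'a form \<Rightarrow> 'a form" where
  "form_on F T =
     \<lparr>fdom = {v. zero_ext F v \<in> fdom T},
      fval = (\<lambda>v w. fval T (zero_ext F v) (zero_ext F w))\<rparr>"

end

theory Submission
  imports Defs
begin

text \<open>
  Write \<open>D\<^sub>J\<close> for the domain of \<open>J\<close>, that is, for the quasi-continuous elements of the domain of \<open>E\<close>
  that are square integrable with respect to \<open>\<mu>\<close>, and \<open>E\<^sub>\<lambda>\<close> for \<open>E + \<lambda> (\<cdot>, \<cdot>)\<^sub>m\<close>. The proof compares \<open>T\<close>
  with \<open>E\<close> on \<open>D\<^sub>J\<close>, transports the contraction property and a core from \<open>E\<close> to \<open>T\<close>, and then
  shows that continuous functions with compact support are dense already in the finer norm of \<open>E\<close>.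

  \<^bold>\<open>The resolvents of the approximating forms.\<close> A Cauchy sequence of quasi-continuous functions has a
  quasi-continuous limit, to which a subsequence converges outside sets of arbitrarily small capacity,
  hence \<open>\<mu>\<close>-almost everywhere (\<open>qc_complete\<close>). So \<open>D\<^sub>J\<close> is a Hilbert space for \<open>E\<^sub>\<lambda> + (\<cdot>, \<cdot>)\<^sub>\<mu>\<close>, and for
  \<open>f\<close> in \<open>L\<^sup>2(\<mu>)\<close> there is \<open>r\<close> in \<open>D\<^sub>J\<close> with \<open>E\<^sub>\<lambda>(r, w) + (r, w)\<^sub>\<mu> = (f, w)\<^sub>\<mu>\<close> for all \<open>w\<close> in \<open>D\<^sub>J\<close>. Taking \<open>w\<close> in
  \<open>ker J\<close> shows that \<open>r\<close> is orthogonal to \<open>ker J\<close>; therefore \<open>J r\<close> is the resolvent at \<open>f\<close> of the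
  approximating trace form (\<open>approx_resolvent\<close>), and the projections disappear from the argument.

  \<^bold>\<open>Passage to the limit.\<close> A closed form \<open>A\<close> with resolvent \<open>G = (H + 1)\<^sup>-\<^sup>1\<close> is recovered from \<open>G\<close> by the
  duality \<open>A[u] + \<parallel>u\<parallel>\<^sup>2 = sup\<^sub>f (2 (f, u) - (G f, f))\<close>, where the domain consists of those \<open>u\<close> for which
  the supremum is finite (\<open>dual_le_form1\<close>, \<open>dual_bound\<close>). The expression under the supremum
  is continuous in \<open>G\<close> and in \<open>u\<close>, so that inequalities between forms survive the limit \<open>\<lambda> \<down> 0\<close>. This gives
  \<open>T[u] \<le> E[u]\<close> on \<open>D\<^sub>J\<close> (\<open>DJ_T\<close>), the convergence \<open>r \<rightarrow> G f\<close> in the form norm of \<open>T\<close>, hence that \<open>D\<^sub>J\<close> is a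
  core of \<open>T\<close> (\<open>DJ_core\<close>), and, applied to truncations of \<open>r\<close>, that \<open>T\<close> is Markovian (\<open>T_Markov\<close>).

  \<^bold>\<open>Density.\<close> Let \<open>h\<close> in \<open>D\<^sub>J\<close> be orthogonal to all continuous functions with compact support in the domain of \<open>E\<close>,
  with respect to \<open>E\<^sub>1 + (\<cdot>, \<cdot>)\<^sub>\<mu>\<close>. If \<open>0 \<le> u \<le> \<eta>\<close> with such a continuous \<open>\<eta>\<close>, and \<open>p\<^sub>n \<rightarrow> u\<close> in the
  domain of \<open>E\<close> with continuous \<open>p\<^sub>n\<close>, then along a subsequence the functions \<open>min (p\<^sub>n\<^sup>+) \<eta>\<close> converge to \<open>u\<close>
  weakly, because \<open>\<eta>\<close> dominates them in \<open>L\<^sup>2(\<mu>)\<close>; so \<open>h\<close> is orthogonal to \<open>u\<close>. The same truncation with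
  \<open>u\<close> itself in the place of \<open>\<eta>\<close> reduces every \<open>u \<ge> 0\<close> to this case, and the positive and negative part of \<open>h\<close>
  show that \<open>h\<close> is null (\<open>orthogonal_VC\<close>). As \<open>T \<le> E\<close> on the core \<open>D\<^sub>J\<close>, the form part of
  regularity follows.

  \<^bold>\<open>The support.\<close> Functions in \<open>C\<^sub>c(F)\<close> extend to \<open>C\<^sub>c(X)\<close> by the theorem of Tietze (\<open>Cc_extension\<close>), which
  transfers the uniform density from \<open>E\<close>. Since \<open>\<mu>\<close> is concentrated on \<open>F\<close>, extension by zero
  carries all properties of \<open>T\<close> to \<open>L\<^sup>2(F, \<mu>)\<close>.
\<close>

section \<open>Positive semidefinite forms on spaces of functions\<close>

text \<open>
  Used three times below with different quadratic polynomials: for the inequality of Cauchy and Schwarz, for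
  minimising sequences, and to turn a bound that is inhomogeneous in \<open>f\<close> into a homogeneous one.
\<close>
lemma quadratic_nonneg_discriminant:
  fixes a b c :: real
  assumes "a \<ge> 0" and nn: "\<And>t. 0 \<le> a * t\<^sup>2 + 2 * b * t + c"
  shows "b\<^sup>2 \<le> a * c"
proof (cases "a = 0")
  case True
  have "b = 0"
  proof (rule ccontr)
    assume "b \<noteq> 0"
    then show False using nn[of "- (c + 1) / (2 * b)"] True by simp
  qed
  then show ?thesis using True by simp
next
  case False
  then have "a > 0" using assms by simp
  moreover have "0 \<le> a * (a * (- b / a)\<^sup>2 + 2 * b * (- b / a) + c)"
    using nn[of "- b / a"] \<open>a > 0\<close> by (intro mult_nonneg_nonneg) auto
  moreover have "a * (a * (- b / a)\<^sup>2 + 2 * b * (- b / a) + c) = a * c - b\<^sup>2"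
    using \<open>a > 0\<close> by (simp add: field_simps power2_eq_square)
  ultimately show ?thesis by simp
qed

text \<open>
  Spaces of functions that stand for classes are not types, and their forms vanish on null functions.
  The form is therefore only semidefinite and lives on a set of functions.
\<close>
locale semi_inner =
  fixes V :: "('a \<Rightarrow> real) set" and B :: "('a \<Rightarrow> real) \<Rightarrow> ('a \<Rightarrow> real) \<Rightarrow> real"
  assumes zero: "(\<lambda>x. 0) \<in> V"
    and add: "u \<in> V \<Longrightarrow> v \<in> V \<Longrightarrow> (\<lambda>x. u x + v x) \<in> V"
    and scale: "u \<in> V \<Longrightarrow> (\<lambda>x. c * u x) \<in> V"
    and sym: "u \<in> V \<Longrightarrow> v \<in> V \<Longrightarrow> B u v = B v u"
    and B_add: "u \<in> V \<Longrightarrow> v \<in> V \<Longrightarrow> w \<in> V \<Longrightarrow> B (\<lambda>x. u x + v x) w = B u w + B v w"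
    and B_scale: "u \<in> V \<Longrightarrow> w \<in> V \<Longrightarrow> B (\<lambda>x. c * u x) w = c * B u w"
    and nonneg: "u \<in> V \<Longrightarrow> 0 \<le> B u u"
begin

abbreviation nrm :: "('a \<Rightarrow> real) \<Rightarrow> real" where "nrm u \<equiv> sqrt (B u u)"

definition Cauchy_sequence :: "(nat \<Rightarrow> 'a \<Rightarrow> real) \<Rightarrow> bool" where
  "Cauchy_sequence v \<longleftrightarrow> (\<forall>e>0. \<exists>N. \<forall>i\<ge>N. \<forall>j\<ge>N. nrm (\<lambda>x. v i x - v j x) < e)"

lemma diff: "u \<in> V \<Longrightarrow> v \<in> V \<Longrightarrow> (\<lambda>x. u x - v x) \<in> V"
  using add[of u "\<lambda>x. (-1) * v x"] scale[of v "-1"] by simp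

lemma minus: "u \<in> V \<Longrightarrow> (\<lambda>x. - u x) \<in> V"
  using scale[of u "-1"] by simp

lemma sum_mem: "(\<And>k. k < (n::nat) \<Longrightarrow> u k \<in> V) \<Longrightarrow> (\<lambda>x. \<Sum>k<n. u k x) \<in> V"
  by (induction n) (auto intro: zero add)

lemma B_diff: "u \<in> V \<Longrightarrow> v \<in> V \<Longrightarrow> w \<in> V \<Longrightarrow> B (\<lambda>x. u x - v x) w = B u w - B v w"
  using B_add[of u "\<lambda>x. (-1) * v x" w] scale[of v "-1"] B_scale[of v w "-1"] by simp

lemma B_add_right: "u \<in> V \<Longrightarrow> v \<in> V \<Longrightarrow> w \<in> V \<Longrightarrow> B w (\<lambda>x. u x + v x) = B w u + B w v"
  using sym[OF _ add, of w u v] sym[of w u] sym[of w v] B_add[of u v w] by simp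

lemma B_diff_right: "u \<in> V \<Longrightarrow> v \<in> V \<Longrightarrow> w \<in> V \<Longrightarrow> B w (\<lambda>x. u x - v x) = B w u - B w v"
  using sym[OF _ diff, of w u v] sym[of w u] sym[of w v] B_diff[of u v w] by simp

lemma B_scale_right: "u \<in> V \<Longrightarrow> w \<in> V \<Longrightarrow> B w (\<lambda>x. c * u x) = c * B w u"
  using sym[OF _ scale, of w u c] sym[of w u] B_scale[of u w c] by simp

lemma B_add_add:
  "u \<in> V \<Longrightarrow> v \<in> V \<Longrightarrow> B (\<lambda>x. u x + v x) (\<lambda>x. u x + v x) = B u u + 2 * B u v + B v v"
  by (simp add: B_add B_add_right add sym)

lemma B_diff_diff:
  "u \<in> V \<Longrightarrow> v \<in> V \<Longrightarrow> B (\<lambda>x. u x - v x) (\<lambda>x. u x - v x) = B u u - 2 * B u v + B v v"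
  by (simp add: B_diff B_diff_right diff sym)

lemma B_scale_scale: "u \<in> V \<Longrightarrow> B (\<lambda>x. c * u x) (\<lambda>x. c * u x) = c\<^sup>2 * B u u"
  by (simp add: B_scale B_scale_right scale power2_eq_square)

lemma cauchy_schwarz:
  assumes "u \<in> V" "v \<in> V"
  shows "(B u v)\<^sup>2 \<le> B u u * B v v"
proof -
  have "0 \<le> B v v * t\<^sup>2 + 2 * B u v * t + B u u" for t
    using nonneg[OF add[OF assms(1) scale[OF assms(2), of t]]] assms
    by (simp add: B_add_add B_scale_scale scale B_scale_right algebra_simps)
  from quadratic_nonneg_discriminant[OF nonneg[OF assms(2)] this]
  show ?thesis by (simp add: mult.commute)
qed

lemma abs_B_le: "u \<in> V \<Longrightarrow> v \<in> V \<Longrightarrow> \<bar>B u v\<bar> \<le> nrm u * nrm v"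
  using cauchy_schwarz[of u v] by (metis real_sqrt_abs real_sqrt_le_iff real_sqrt_mult)

lemma nrm_scale: "u \<in> V \<Longrightarrow> nrm (\<lambda>x. c * u x) = \<bar>c\<bar> * nrm u"
  by (simp add: B_scale_scale real_sqrt_mult)

lemma nrm_add:
  assumes "u \<in> V" "v \<in> V"
  shows "nrm (\<lambda>x. u x + v x) \<le> nrm u + nrm v"
proof (rule real_le_lsqrt)
  have "B u v \<le> nrm u * nrm v" using abs_B_le[OF assms] by simp
  then show "B (\<lambda>x. u x + v x) (\<lambda>x. u x + v x) \<le> (nrm u + nrm v)\<^sup>2"
    using assms nonneg by (simp add: B_add_add power2_sum)
qed (use assms nonneg in auto)

lemma nrm_diff: "u \<in> V \<Longrightarrow> v \<in> V \<Longrightarrow> nrm (\<lambda>x. u x - v x) \<le> nrm u + nrm v"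
  using nrm_add[OF _ minus, of u v] nrm_scale[of v "-1"] by simp

lemma nrm_minus_commute: "u \<in> V \<Longrightarrow> v \<in> V \<Longrightarrow> nrm (\<lambda>x. u x - v x) = nrm (\<lambda>x. v x - u x)"
  by (simp add: B_diff_diff sym)

lemma nrm_triangle:
  assumes "u \<in> V" "v \<in> V" "w \<in> V"
  shows "nrm (\<lambda>x. u x - w x) \<le> nrm (\<lambda>x. u x - v x) + nrm (\<lambda>x. v x - w x)"
  using nrm_add[OF diff[OF assms(1,2)] diff[OF assms(2,3)]] by simp

lemma nrm_sum_le: "(\<And>k. u k \<in> V) \<Longrightarrow> nrm (\<lambda>x. \<Sum>k<(n::nat). u k x) \<le> (\<Sum>k<n. nrm (u k))"
proof (induction n)
  case 0
  then show ?case using B_scale[OF zero zero, of 0] by simp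
next
  case (Suc n)
  then show ?case using nrm_add[OF sum_mem[of n u] Suc.prems[of n]] by simp
qed

lemma tendsto_B:
  assumes "\<And>n. u n \<in> V" "w \<in> V" "v \<in> V" "(\<lambda>n. nrm (\<lambda>x. u n x - w x)) \<longlonglongrightarrow> 0"
  shows "(\<lambda>n. B (u n) v) \<longlonglongrightarrow> B w v"
proof -
  have "(\<lambda>n. nrm (\<lambda>x. u n x - w x) * nrm v) \<longlonglongrightarrow> 0"
    using tendsto_mult_left_zero[OF assms(4)] .
  then have "(\<lambda>n. B (u n) v - B w v) \<longlonglongrightarrow> 0"
    by (rule Lim_null_comparison[rotated])
      (use abs_B_le[OF diff[OF assms(1,2)] assms(3)] assms in \<open>auto simp: B_diff\<close>)
  then show ?thesis by (simp add: LIM_zero_iff)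
qed

lemma tendsto_nrm:
  assumes "\<And>n. u n \<in> V" "w \<in> V" "(\<lambda>n. nrm (\<lambda>x. u n x - w x)) \<longlonglongrightarrow> 0"
  shows "(\<lambda>n. nrm (u n)) \<longlonglongrightarrow> nrm w"
proof -
  have "\<bar>nrm (u n) - nrm w\<bar> \<le> nrm (\<lambda>x. u n x - w x)" for n
    using nrm_add[OF diff[OF assms(1)[of n] assms(2)] assms(2)]
      nrm_add[OF diff[OF assms(2) assms(1)[of n]] assms(1)[of n]]
      nrm_minus_commute[OF assms(1)[of n] assms(2)] by simp
  then have "(\<lambda>n. nrm (u n) - nrm w) \<longlonglongrightarrow> 0"
    by (intro Lim_null_comparison[OF _ assms(3)]) auto
  then show ?thesis by (simp add: LIM_zero_iff)
qed

lemma tendsto_B_same: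
  assumes "\<And>n. u n \<in> V" "w \<in> V" "(\<lambda>n. nrm (\<lambda>x. u n x - w x)) \<longlonglongrightarrow> 0"
  shows "(\<lambda>n. B (u n) (u n)) \<longlonglongrightarrow> B w w"
  using tendsto_power[OF tendsto_nrm[OF assms], of 2] assms nonneg by simp

lemma convergent_Cauchy_sequence:
  assumes "\<And>n. u n \<in> V" "w \<in> V" "(\<lambda>n. nrm (\<lambda>x. u n x - w x)) \<longlonglongrightarrow> 0"
  shows "Cauchy_sequence u"
  unfolding Cauchy_sequence_def
proof (intro allI impI)
  fix e :: real assume "e > 0"
  then obtain N where N: "\<And>n. n \<ge> N \<Longrightarrow> nrm (\<lambda>x. u n x - w x) < e / 2"
    using order_tendstoD(2)[OF assms(3), of "e/2"] by (auto simp: eventually_sequentially)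
  have "nrm (\<lambda>x. u i x - u j x) < e" if "i \<ge> N" "j \<ge> N" for i j
    using nrm_triangle[OF assms(1,2,1), of i j] N[OF that(1)] N[OF that(2)]
      nrm_minus_commute[OF assms(1,2), of j] by linarith
  then show "\<exists>N. \<forall>i\<ge>N. \<forall>j\<ge>N. nrm (\<lambda>x. u i x - u j x) < e" by blast
qed

text \<open>
  A minimising sequence \<open>v\<close> of \<open>B(u, u) - 2 l(u)\<close> is Cauchy by the parallelogram law, and it
  represents \<open>l\<close> in the limit, as perturbations of its members in any direction \<open>w\<close> nearly fail to decrease
  the functional. As a sequence takes the place of a limit, the result applies to dense subspaces and to the form
  induced by a resolvent on \<open>L\<^sup>2\<close>.
\<close>
theorem weak_riesz:
  assumes l_add: "\<And>u v. u \<in> V \<Longrightarrow> v \<in> V \<Longrightarrow> l (\<lambda>x. u x + v x) = l u + l v"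
    and l_scale: "\<And>u c. u \<in> V \<Longrightarrow> l (\<lambda>x. c * u x) = c * l u"
    and bound: "\<And>u. u \<in> V \<Longrightarrow> (l u)\<^sup>2 \<le> C * B u u"
  obtains v where "\<And>n. v n \<in> V" "Cauchy_sequence v" "\<And>w. w \<in> V \<Longrightarrow> (\<lambda>n. B (v n) w) \<longlonglongrightarrow> l w"
proof -
  define Q where "Q u = B u u - 2 * l u" for u
  define d where "d = Inf (Q ` V)"
  \<comment> \<open>The functional is bounded below, by the inequality between the geometric and the arithmetic mean.\<close>
  have bd: "- \<bar>C\<bar> \<le> Q u" if "u \<in> V" for u
  proof -
    have "(l u)\<^sup>2 \<le> \<bar>C\<bar> * B u u"
      using bound[OF that] mult_right_mono[OF abs_ge_self[of C] nonneg[OF that]] by linarith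
    also have "\<dots> \<le> ((\<bar>C\<bar> + B u u) / 2)\<^sup>2"
      using sum_power2_ge_zero[of "\<bar>C\<bar> - B u u" 0] by (simp add: power2_eq_square field_simps)
    finally have "l u \<le> (\<bar>C\<bar> + B u u) / 2"
      by (rule power2_le_imp_le) (use nonneg[OF that] in auto)
    then show ?thesis by (simp add: Q_def)
  qed
  then have bdd: "bdd_below (Q ` V)" by (auto simp: bdd_below_def)
  have d_le: "d \<le> Q u" if "u \<in> V" for u
    unfolding d_def using bdd that by (simp add: cInf_lower)
  have "\<exists>u\<in>V. Q u < d + 1 / real (Suc n)" for n
    using cInf_lessD[of "Q ` V" "d + 1 / real (Suc n)"] zero unfolding d_def by auto
  then obtain v where vV: "\<And>n. v n \<in> V" and vQ: "\<And>n. Q (v n) < d + 1 / real (Suc n)"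
    by metis
  have Q_step: "Q (\<lambda>x. u x + c * w x) = B w w * c\<^sup>2 + 2 * (B u w - l w) * c + Q u"
    if "u \<in> V" "w \<in> V" for u w c
    using that by (simp add: Q_def B_add_add B_scale_scale scale B_scale_right l_add l_scale algebra_simps)
  \<comment> \<open>The parallelogram law, with the midpoint as a competitor in the minimisation.\<close>
  have diffs: "B (\<lambda>x. v i x - v j x) (\<lambda>x. v i x - v j x) \<le> 2 * (1 / real (Suc i) + 1 / real (Suc j))" for i j
  proof -
    have "d \<le> Q (\<lambda>x. (1/2) * (v i x + v j x))"
      using d_le scale add vV by blast
    also have "\<dots> = (1/4) * (B (v i) (v i) + 2 * B (v i) (v j) + B (v j) (v j)) - (l (v i) + l (v j))"
      using scale[OF add[OF vV[of i] vV[of j]], of "1/2"] add[OF vV[of i] vV[of j]]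
        l_scale[of "\<lambda>x. v i x + v j x" "1/2"]
      by (simp only: Q_def B_scale_scale B_add_add vV l_add) (simp add: power2_eq_square field_simps)
    finally show ?thesis using vQ[of i, unfolded Q_def] vQ[of j, unfolded Q_def]
      unfolding B_diff_diff[OF vV vV] by (simp only: distrib_left)
  qed
  have "Cauchy_sequence v"
    unfolding Cauchy_sequence_def
  proof (intro allI impI)
    fix e :: real assume e: "e > 0"
    then obtain N where N: "1 / real (Suc N) < e\<^sup>2 / 4"
      using nat_approx_posE[of "e\<^sup>2/4"] by auto
    have "nrm (\<lambda>x. v i x - v j x) < e" if "i \<ge> N" "j \<ge> N" for i j
    proof (rule real_less_lsqrt[OF less_imp_le[OF e]])
      have "1 / real (Suc i) \<le> 1 / real (Suc N)" "1 / real (Suc j) \<le> 1 / real (Suc N)"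
        using that by (auto intro!: divide_left_mono)
      then show "B (\<lambda>x. v i x - v j x) (\<lambda>x. v i x - v j x) < e\<^sup>2"
        using order.trans[OF diffs[of i j] mult_left_mono[OF add_mono, of _ "1 / real (Suc N)" _ "1 / real (Suc N)" 2]] N
        by (simp del: of_nat_Suc)
    qed
    then show "\<exists>N. \<forall>i\<ge>N. \<forall>j\<ge>N. nrm (\<lambda>x. v i x - v j x) < e" by blast
  qed
  moreover have "(\<lambda>n. B (v n) w) \<longlonglongrightarrow> l w" if w: "w \<in> V" for w
  proof -
    \<comment> \<open>Nonnegativity in \<open>t\<close> of the gap at \<open>v n + t w\<close> bounds its linear coefficient.\<close>
    have sq: "(B (v n) w - l w)\<^sup>2 \<le> B w w * (1 / real (Suc n))" for n
    proof (rule quadratic_nonneg_discriminant[OF nonneg[OF w]])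
      fix t
      have "d \<le> Q (\<lambda>x. v n x + t * w x)" using d_le add scale vV w by blast
      also have "\<dots> = B w w * t\<^sup>2 + 2 * (B (v n) w - l w) * t + Q (v n)"
        by (rule Q_step[OF vV w])
      finally show "0 \<le> B w w * t\<^sup>2 + 2 * (B (v n) w - l w) * t + 1 / real (Suc n)"
        using vQ[of n] by linarith
    qed
    have "(\<lambda>n. B w w * (1 / real (Suc n))) \<longlonglongrightarrow> 0"
      using tendsto_mult_right_zero[OF lim_inverse_n', THEN LIMSEQ_Suc] by simp
    then have "(\<lambda>n. (B (v n) w - l w)\<^sup>2) \<longlonglongrightarrow> 0"
      by (rule Lim_null_comparison[rotated]) (use sq in auto)
    then have "(\<lambda>n. \<bar>B (v n) w - l w\<bar>) \<longlonglongrightarrow> 0"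
      using tendsto_real_sqrt[of "\<lambda>n. (B (v n) w - l w)\<^sup>2" 0] by simp
    then show ?thesis by (simp add: LIM_zero_iff tendsto_rabs_zero_iff)
  qed
  ultimately show ?thesis using that vV by blast
qed

corollary riesz:
  assumes "\<And>v. (\<And>n. v n \<in> V) \<Longrightarrow> Cauchy_sequence v \<Longrightarrow> \<exists>w\<in>V. (\<lambda>n. nrm (\<lambda>x. v n x - w x)) \<longlonglongrightarrow> 0"
    and "\<And>u v. u \<in> V \<Longrightarrow> v \<in> V \<Longrightarrow> l (\<lambda>x. u x + v x) = l u + l v"
    and "\<And>u c. u \<in> V \<Longrightarrow> l (\<lambda>x. c * u x) = c * l u"
    and "\<And>u. u \<in> V \<Longrightarrow> (l u)\<^sup>2 \<le> C * B u u"
  obtains w where "w \<in> V" "\<And>u. u \<in> V \<Longrightarrow> B w u = l u"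
proof -
  obtain v where v: "\<And>n. v n \<in> V" "Cauchy_sequence v" "\<And>w. w \<in> V \<Longrightarrow> (\<lambda>n. B (v n) w) \<longlonglongrightarrow> l w"
    using weak_riesz[OF assms(2-4)] by blast
  obtain w where w: "w \<in> V" "(\<lambda>n. nrm (\<lambda>x. v n x - w x)) \<longlonglongrightarrow> 0"
    using assms(1)[OF v(1,2)] by blast
  have "B w u = l u" if "u \<in> V" for u
    using LIMSEQ_unique[OF tendsto_B[OF v(1) w(1) that w(2)] v(3)[OF that]] .
  then show ?thesis using that w by blast
qed

end

section \<open>The space \<open>L\<^sup>2\<close>\<close>

lemma L2_D: "f \<in> L2 M \<Longrightarrow> f \<in> borel_measurable M" "f \<in> L2 M \<Longrightarrow> integrable M (\<lambda>x. (f x)\<^sup>2)"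
  by (auto simp: L2_def)

lemma L2_mult_integrable:
  assumes "f \<in> L2 M" "g \<in> L2 M"
  shows "integrable M (\<lambda>x. f x * g x)"
proof (rule Bochner_Integration.integrable_bound)
  show "integrable M (\<lambda>x. (f x)\<^sup>2 + (g x)\<^sup>2)" using assms by (auto simp: L2_def)
  show "(\<lambda>x. f x * g x) \<in> borel_measurable M" using assms by (auto simp: L2_def)
  have "\<bar>a * b\<bar> \<le> a\<^sup>2 + b\<^sup>2" for a b :: real
  proof -
    have "0 \<le> (\<bar>a\<bar> - \<bar>b\<bar>)\<^sup>2" by simp
    then have "2 * (\<bar>a\<bar> * \<bar>b\<bar>) \<le> a\<^sup>2 + b\<^sup>2" by (simp add: power2_diff)
    moreover have "0 \<le> \<bar>a\<bar> * \<bar>b\<bar>" by simp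
    ultimately show ?thesis unfolding abs_mult by linarith
  qed
  then show "AE x in M. norm (f x * g x) \<le> norm ((f x)\<^sup>2 + (g x)\<^sup>2)" by simp
qed

lemma L2_bound:
  assumes "g \<in> L2 M" "f \<in> borel_measurable M" "AE x in M. \<bar>f x\<bar> \<le> \<bar>g x\<bar>"
  shows "f \<in> L2 M"
proof -
  have "integrable M (\<lambda>x. (f x)\<^sup>2)"
  proof (rule Bochner_Integration.integrable_bound[OF L2_D(2)[OF assms(1)]])
    show "AE x in M. norm ((f x)\<^sup>2) \<le> norm ((g x)\<^sup>2)"
      using assms(3) by eventually_elim (simp add: abs_le_square_iff)
  qed (use assms(2) in measurable)
  then show ?thesis using assms(2) by (simp add: L2_def)
qed

lemma L2_zero: "(\<lambda>x. 0) \<in> L2 M"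
  by (simp add: L2_def)

lemma L2_add:
  assumes "f \<in> L2 M" "g \<in> L2 M"
  shows "(\<lambda>x. f x + g x) \<in> L2 M"
  using assms L2_mult_integrable[OF assms] by (auto simp: L2_def power2_sum mult.assoc)

lemma L2_scale: "f \<in> L2 M \<Longrightarrow> (\<lambda>x. c * f x) \<in> L2 M"
  by (auto simp: L2_def power_mult_distrib)

lemma semi_inner_L2: "semi_inner (L2 M) (L2_inner M)"
proof
  fix u v w :: "'a \<Rightarrow> real" assume uvw: "u \<in> L2 M" "v \<in> L2 M" "w \<in> L2 M"
  show "L2_inner M (\<lambda>x. u x + v x) w = L2_inner M u w + L2_inner M v w"
    using L2_mult_integrable[OF uvw(1,3)] L2_mult_integrable[OF uvw(2,3)]
    by (simp add: L2_inner_def distrib_right)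
qed (auto simp: L2_zero L2_add L2_scale L2_inner_def mult.commute mult.left_commute)

interpretation L2: semi_inner "L2 M" "L2_inner M" for M
  by (rule semi_inner_L2)

lemma L2_inner_self: "L2_inner M f f = (\<integral>x. (f x)\<^sup>2 \<partial>M)"
  by (simp add: L2_inner_def power2_eq_square)

lemma L2_norm_sq: "(L2_norm M f)\<^sup>2 = L2_inner M f f"
  by (simp add: L2_norm_def L2_inner_self)

lemma L2_norm_nonneg: "0 \<le> L2_norm M f"
  by (simp add: L2_norm_def L2_inner_self)

lemma L2_norm_le_iff: "0 \<le> c \<Longrightarrow> L2_norm M f \<le> c \<longleftrightarrow> L2_inner M f f \<le> c\<^sup>2"
  unfolding L2_norm_def by (metis real_le_lsqrt real_sqrt_le_iff real_sqrt_abs abs_of_nonneg)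

lemma L2_inner_cong_AE:
  assumes "AE x in M. f x = f' x" "AE x in M. g x = g' x"
    "f \<in> borel_measurable M" "f' \<in> borel_measurable M" "g \<in> borel_measurable M" "g' \<in> borel_measurable M"
  shows "L2_inner M f g = L2_inner M f' g'"
  unfolding L2_inner_def using assms by (intro integral_cong_AE) (auto elim: eventually_elim2)

lemma L2_inner_mono:
  assumes "g \<in> L2 M" "f \<in> borel_measurable M" "AE x in M. \<bar>f x\<bar> \<le> \<bar>g x\<bar>"
  shows "L2_inner M f f \<le> L2_inner M g g"
  unfolding L2_inner_self
  using assms(3) L2_D(2)[OF L2_bound[OF assms]] L2_D(2)[OF assms(1)]
  by (intro integral_mono_AE) (auto simp: abs_le_square_iff)

lemma L2_norm_mono:
  assumes "g \<in> L2 M" "f \<in> borel_measurable M" "AE x in M. \<bar>f x\<bar> \<le> \<bar>g x\<bar>"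
  shows "L2_norm M f \<le> L2_norm M g"
  using L2_inner_mono[OF assms] by (simp add: L2_norm_def)

lemma L2_cong_AE:
  assumes "f \<in> L2 M" "g \<in> borel_measurable M" "AE x in M. f x = g x"
  shows "g \<in> L2 M"
  by (rule L2_bound[OF assms(1,2)]) (use assms(3) in auto)

lemma L2_inner_self_eq_0:
  assumes "f \<in> L2 M" "L2_inner M f f = 0"
  shows "AE x in M. f x = 0"
  using assms integral_nonneg_eq_0_iff_AE[OF L2_D(2)[OF assms(1)]] by (simp add: L2_inner_self)

lemma L2_dominated_convergence:
  assumes "g \<in> L2 M" "\<And>n. u n \<in> borel_measurable M" "w \<in> borel_measurable M"
    and bound: "\<And>n. AE x in M. \<bar>u n x\<bar> \<le> \<bar>g x\<bar>"
    and lim: "AE x in M. (\<lambda>n. u n x) \<longlonglongrightarrow> w x"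
  shows "w \<in> L2 M" "(\<lambda>n. L2_norm M (\<lambda>x. u n x - w x)) \<longlonglongrightarrow> 0"
proof -
  have all: "AE x in M. \<forall>n. \<bar>u n x\<bar> \<le> \<bar>g x\<bar>"
    using bound by (simp add: AE_all_countable)
  have w: "AE x in M. \<bar>w x\<bar> \<le> \<bar>g x\<bar>"
    using all lim
  proof eventually_elim
    case (elim x)
    then show ?case using LIMSEQ_le_const2[OF tendsto_rabs] by blast
  qed
  show "w \<in> L2 M" by (rule L2_bound[OF assms(1,3) w])
  have "(\<lambda>n. \<integral>x. (u n x - w x)\<^sup>2 \<partial>M) \<longlonglongrightarrow> (\<integral>x. 0 \<partial>M)"
  proof (rule integral_dominated_convergence[where w = "\<lambda>x. 4 * (g x)\<^sup>2"])
    show "AE x in M. (\<lambda>n. (u n x - w x)\<^sup>2) \<longlonglongrightarrow> 0"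
      using lim by eventually_elim (auto intro!: tendsto_eq_intros)
    fix n
    show "AE x in M. norm ((u n x - w x)\<^sup>2) \<le> 4 * (g x)\<^sup>2"
      using bound[of n] w
    proof eventually_elim
      case (elim x)
      then have "\<bar>u n x - w x\<bar> \<le> \<bar>2 * g x\<bar>" by linarith
      then have "(u n x - w x)\<^sup>2 \<le> (2 * g x)\<^sup>2" by (simp only: abs_le_square_iff)
      then show ?case by (simp add: power_mult_distrib)
    qed
  qed (use assms L2_D in auto)
  then show "(\<lambda>n. L2_norm M (\<lambda>x. u n x - w x)) \<longlonglongrightarrow> 0"
    unfolding L2_norm_def L2_inner_self using tendsto_real_sqrt by fastforce
qed

lemma L2_AE_subsequence:
  assumes "\<And>n. u n \<in> L2 M" "w \<in> L2 M" "(\<lambda>n. L2_norm M (\<lambda>x. u n x - w x)) \<longlonglongrightarrow> 0"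
  obtains r where "strict_mono r" "AE x in M. (\<lambda>n. u (r n) x) \<longlonglongrightarrow> w x"
proof -
  have "(\<lambda>n. (L2_norm M (\<lambda>x. u n x - w x))\<^sup>2) \<longlonglongrightarrow> 0"
    using tendsto_power[OF assms(3), of 2] by simp
  then have lim: "(\<lambda>n. \<integral>x. norm ((u n x - w x)\<^sup>2) \<partial>M) \<longlonglongrightarrow> 0"
    by (simp add: L2_norm_sq L2_inner_self)
  obtain r :: "nat \<Rightarrow> nat" where r: "strict_mono r" "AE x in M. (\<lambda>n. (u (r n) x - w x)\<^sup>2) \<longlonglongrightarrow> 0"
    using tendsto_L1_AE_subseq[OF L2_D(2)[OF L2.diff[OF assms(1,2)]] lim] by blast
  from r(2) have "AE x in M. (\<lambda>n. u (r n) x) \<longlonglongrightarrow> w x"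
  proof eventually_elim
    case (elim x)
    then have "(\<lambda>n. \<bar>u (r n) x - w x\<bar>) \<longlonglongrightarrow> 0"
      using tendsto_real_sqrt by fastforce
    then show ?case by (simp add: LIM_zero_iff tendsto_rabs_zero_iff)
  qed
  then show ?thesis using that r(1) by blast
qed

text \<open>
  The bound is only required from some index on, so that it can be applied to the tails of a Cauchy sequence.
\<close>
lemma L2_Fatou:
  assumes "\<And>n. u n \<in> L2 M" "w \<in> borel_measurable M" "AE x in M. (\<lambda>n. u n x) \<longlonglongrightarrow> w x"
    and "\<And>n. n \<ge> N \<Longrightarrow> L2_norm M (u n) \<le> C"
  shows "w \<in> L2 M" "L2_norm M w \<le> C"
proof -
  have C: "0 \<le> C" using assms(4)[of N] L2_norm_nonneg[of M "u N"] by linarith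
  have "(\<integral>\<^sup>+ x. ennreal ((w x)\<^sup>2) \<partial>M) = (\<integral>\<^sup>+ x. liminf (\<lambda>n. ennreal ((u n x)\<^sup>2)) \<partial>M)"
  proof (rule nn_integral_cong_AE, use assms(3) in eventually_elim)
    case (elim x)
    then have "(\<lambda>n. ennreal ((u n x)\<^sup>2)) \<longlonglongrightarrow> ennreal ((w x)\<^sup>2)"
      by (intro tendsto_ennrealI tendsto_intros)
    from lim_imp_Liminf[OF trivial_limit_sequentially this] show ?case by simp
  qed
  also have "\<dots> \<le> liminf (\<lambda>n. \<integral>\<^sup>+ x. ennreal ((u n x)\<^sup>2) \<partial>M)"
    using L2_D(1)[OF assms(1)] by (intro nn_integral_liminf) measurable
  also have "\<dots> \<le> ennreal (C\<^sup>2)"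
  proof (rule Liminf_le)
    show "\<forall>\<^sub>F n in sequentially. (\<integral>\<^sup>+ x. ennreal ((u n x)\<^sup>2) \<partial>M) \<le> ennreal (C\<^sup>2)"
    proof (rule eventually_sequentiallyI)
      fix n assume "n \<ge> N"
      then have "L2_inner M (u n) (u n) \<le> C\<^sup>2"
        using assms(4) C L2_norm_le_iff by blast
      then show "(\<integral>\<^sup>+ x. ennreal ((u n x)\<^sup>2) \<partial>M) \<le> ennreal (C\<^sup>2)"
        using L2_D(2)[OF assms(1)[of n]]
        by (subst nn_integral_eq_integral) (auto simp: L2_inner_self intro: ennreal_leI)
    qed
  qed simp
  finally have le: "(\<integral>\<^sup>+ x. ennreal ((w x)\<^sup>2) \<partial>M) \<le> ennreal (C\<^sup>2)" .
  have int: "integrable M (\<lambda>x. (w x)\<^sup>2)"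
    using le assms(2) by (intro integrableI_bounded) (auto simp: less_top[symmetric] top_unique)
  then show "w \<in> L2 M" using assms(2) by (simp add: L2_def)
  have "(\<integral>x. (w x)\<^sup>2 \<partial>M) \<le> C\<^sup>2"
    using le by (subst (asm) nn_integral_eq_integral[OF int]) auto
  then show "L2_norm M w \<le> C"
    using C by (simp add: L2_norm_le_iff L2_inner_self)
qed

text \<open>
  The lemma of Fatou applied to \<open>u i - u (r n)\<close> as \<open>n\<close> tends to infinity. It replaces the completeness of
  \<open>L\<^sup>2\<close> where the almost everywhere limit is already known, namely as a quasi-continuous function.
\<close>
lemma L2_Cauchy_AE_limit:
  assumes u: "\<And>n. u n \<in> L2 M" and w: "w \<in> borel_measurable M"
    and r: "strict_mono r" "AE x in M. (\<lambda>n. u (r n) x) \<longlonglongrightarrow> w x"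
    and cau: "\<And>e. e > 0 \<Longrightarrow> \<exists>N. \<forall>i\<ge>N. \<forall>j\<ge>N. L2_norm M (\<lambda>x. u i x - u j x) < e"
  shows "w \<in> L2 M" "(\<lambda>n. L2_norm M (\<lambda>x. u n x - w x)) \<longlonglongrightarrow> 0"
proof -
  have key: "\<exists>N. \<forall>i\<ge>N. (\<lambda>x. u i x - w x) \<in> L2 M \<and> L2_norm M (\<lambda>x. u i x - w x) \<le> e" if "e > 0" for e
  proof -
    obtain N where N: "\<And>i j. i \<ge> N \<Longrightarrow> j \<ge> N \<Longrightarrow> L2_norm M (\<lambda>x. u i x - u j x) < e"
      using cau[of e] \<open>e > 0\<close> by blast
    have "(\<lambda>x. u i x - w x) \<in> L2 M \<and> L2_norm M (\<lambda>x. u i x - w x) \<le> e" if i: "i \<ge> N" for i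
    proof -
      have "AE x in M. (\<lambda>n. u i x - u (r n) x) \<longlonglongrightarrow> u i x - w x"
        using r(2) by eventually_elim (intro tendsto_intros)
      moreover have "L2_norm M (\<lambda>x. u i x - u (r n) x) \<le> e" if "n \<ge> N" for n
        using N[of i "r n"] i strict_mono_imp_increasing[OF r(1), of n] that by simp
      ultimately show ?thesis
        using L2_Fatou[of "\<lambda>n x. u i x - u (r n) x" M "\<lambda>x. u i x - w x" N e]
          L2.diff[OF u[of i] u] borel_measurable_diff[OF L2_D(1)[OF u[of i]] w] by simp
    qed
    then show ?thesis by blast
  qed
  obtain N where "(\<lambda>x. u N x - w x) \<in> L2 M" using key[of 1] by auto
  from L2.diff[OF u[of N] this] show "w \<in> L2 M" by simp
  show "(\<lambda>n. L2_norm M (\<lambda>x. u n x - w x)) \<longlonglongrightarrow> 0"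
  proof (rule LIMSEQ_I)
    fix e :: real assume "e > 0"
    then obtain N where "\<forall>i\<ge>N. L2_norm M (\<lambda>x. u i x - w x) \<le> e / 2" using key[of "e/2"] by auto
    then have "\<forall>i\<ge>N. norm (L2_norm M (\<lambda>x. u i x - w x) - 0) < e"
      using \<open>e > 0\<close> L2_norm_nonneg[of M] by fastforce
    then show "\<exists>N. \<forall>n\<ge>N. norm (L2_norm M (\<lambda>x. u n x - w x) - 0) < e" by blast
  qed
qed

section \<open>Closed forms and their resolvents\<close>

text \<open>
  The inner product whose norm is \<open>form_norm\<close>.
\<close>
definition form1 :: "'a measure \<Rightarrow> 'a form \<Rightarrow> ('a \<Rightarrow> real) \<Rightarrow> ('a \<Rightarrow> real) \<Rightarrow> real" where
  "form1 M A u v = fval A u v + L2_inner M u v"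

lemma form_norm_form1: "form_norm M A u = sqrt (form1 M A u u)"
  by (simp add: form_norm_def form1_def L2_norm_sq)

lemma semi_inner_fval: "positive_form M A \<Longrightarrow> semi_inner (fdom A) (fval A)"
  unfolding positive_form_def by unfold_locales blast+

lemma semi_inner_shifted:
  assumes "positive_form M A" "0 \<le> c"
  shows "semi_inner (fdom A) (fval (shifted_form M A c))"
proof -
  interpret F: semi_inner "fdom A" "fval A" by (rule semi_inner_fval[OF assms(1)])
  have L: "u \<in> L2 M" if "u \<in> fdom A" for u using assms(1) that by (auto simp: positive_form_def)
  show ?thesis
  proof
    fix u v assume "u \<in> fdom A" "v \<in> fdom A"
    then show "fval (shifted_form M A c) u v = fval (shifted_form M A c) v u"
      using F.sym[of u v] L2.sym[OF L L, of u v] by (simp add: shifted_form_def)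
  qed (simp_all add: shifted_form_def F.zero F.add F.scale F.B_add F.B_scale F.nonneg L2.B_add L2.B_scale
        L2.nonneg L assms(2) algebra_simps)
qed

lemma form1_eq_shifted: "form1 M A = fval (shifted_form M A 1)"
  by (intro ext) (simp add: form1_def shifted_form_def)

locale closed_form_space =
  fixes M :: "'a measure" and A :: "'a form"
  assumes closed: "closed_form M A"
begin

lemma positive: "positive_form M A"
  using closed by (simp add: closed_form_def)

sublocale fval: semi_inner "fdom A" "fval A"
  by (rule semi_inner_fval[OF positive])

sublocale semi_inner "fdom A" "form1 M A"
  unfolding form1_eq_shifted by (rule semi_inner_shifted[OF positive]) simp

lemma dom_L2: "u \<in> fdom A \<Longrightarrow> u \<in> L2 M"
  using positive by (auto simp: positive_form_def)

lemma dom_measurable: "u \<in> fdom A \<Longrightarrow> u \<in> borel_measurable M"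
  using dom_L2 L2_D(1) by blast

lemma dom_cong: "u \<in> fdom A \<Longrightarrow> v \<in> borel_measurable M \<Longrightarrow> AE x in M. u x = v x \<Longrightarrow> v \<in> fdom A"
  using positive unfolding positive_form_def by blast

lemma fval_cong_left:
  assumes "u \<in> fdom A" "u' \<in> fdom A" "v \<in> fdom A" "AE x in M. u x = u' x"
  shows "fval A u v = fval A u' v"
  using positive assms unfolding positive_form_def by blast

lemma fval_cong:
  assumes "u \<in> fdom A" "u' \<in> fdom A" "v \<in> fdom A" "v' \<in> fdom A"
    "AE x in M. u x = u' x" "AE x in M. v x = v' x"
  shows "fval A u v = fval A u' v'"
  using fval_cong_left[OF assms(1,2,3,5)] fval_cong_left[OF assms(3,4,2,6)]
    fval.sym[OF assms(2,3)] fval.sym[OF assms(2,4)] by simp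

lemma form1_cong:
  assumes "u \<in> fdom A" "u' \<in> fdom A" "v \<in> fdom A" "v' \<in> fdom A"
    "AE x in M. u x = u' x" "AE x in M. v x = v' x"
  shows "form1 M A u v = form1 M A u' v'"
  using fval_cong[OF assms] L2_inner_cong_AE[OF assms(5,6)] assms dom_measurable
  by (simp add: form1_def)

lemma L2_inner_le_form1: "u \<in> fdom A \<Longrightarrow> L2_inner M u u \<le> form1 M A u u"
  using fval.nonneg by (simp add: form1_def)

lemma L2_norm_le_nrm: "u \<in> fdom A \<Longrightarrow> L2_norm M u \<le> nrm u"
  using L2_inner_le_form1 by (simp add: L2_norm_def)

lemma complete:
  assumes "\<And>n. v n \<in> fdom A" "Cauchy_sequence v"
  shows "\<exists>w\<in>fdom A. (\<lambda>n. nrm (\<lambda>x. v n x - w x)) \<longlonglongrightarrow> 0"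
  using closed assms unfolding closed_form_def Cauchy_sequence_def form_norm_form1 by blast

lemma L2_tendsto:
  assumes "\<And>n. v n \<in> fdom A" "w \<in> fdom A" "(\<lambda>n. nrm (\<lambda>x. v n x - w x)) \<longlonglongrightarrow> 0"
  shows "(\<lambda>n. L2_norm M (\<lambda>x. v n x - w x)) \<longlonglongrightarrow> 0"
  by (rule Lim_null_comparison[OF _ assms(3)])
    (use L2_norm_le_nrm[OF diff[OF assms(1,2)]] L2_norm_nonneg[of M] in auto)

definition res :: "('a \<Rightarrow> real) \<Rightarrow> 'a \<Rightarrow> real" where
  "res f = resolvent1 M (form_operator M A) f"

text \<open>
  The equation \<open>A(u, v) + (u, v) = (f, v)\<close> has a solution by the representation theorem, so the choice in
  \<open>resolvent1\<close> is made from a nonempty set; and whatever is chosen solves this equation.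
\<close>
lemma res:
  assumes f: "f \<in> L2 M"
  shows "res f \<in> fdom A" and "v \<in> fdom A \<Longrightarrow> form1 M A (res f) v = L2_inner M f v"
proof -
  obtain u where u: "u \<in> fdom A" "\<And>v. v \<in> fdom A \<Longrightarrow> form1 M A u v = L2_inner M f v"
  proof (rule riesz[where l = "L2_inner M f" and C = "L2_inner M f f"])
    fix u assume "u \<in> fdom A"
    then show "(L2_inner M f u)\<^sup>2 \<le> L2_inner M f f * form1 M A u u"
      using L2.cauchy_schwarz[OF f dom_L2, of u] L2.nonneg[OF f] L2_inner_le_form1
      by (meson mult_left_mono order.trans)
  qed (auto simp: L2.B_add_right L2.B_scale_right f dom_L2 complete)
  have "(u, \<lambda>x. f x - u x) \<in> form_operator M A"
    unfolding form_operator_def using u dom_L2 L2.diff[OF f dom_L2[OF u(1)]] f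
    by (auto simp: form1_def L2.B_diff algebra_simps)
  then have "\<exists>u g. (u, g) \<in> form_operator M A \<and> (AE x in M. g x + u x = f x)"
    by (intro exI[of _ u] exI[of _ "\<lambda>x. f x - u x"]) auto
  from someI_ex[OF this] obtain g where g: "(res f, g) \<in> form_operator M A" "AE x in M. g x + res f x = f x"
    unfolding res_def resolvent1_def by blast
  show "res f \<in> fdom A" using g(1) by (simp add: form_operator_def)
  assume v: "v \<in> fdom A"
  have gL: "g \<in> L2 M" using g(1) by (simp add: form_operator_def)
  have "form1 M A (res f) v = L2_inner M (\<lambda>x. g x + res f x) v"
    using g(1) v dom_L2 gL by (auto simp: form1_def form_operator_def L2.B_add)
  also have "\<dots> = L2_inner M f v"
    using g gL f v dom_L2[of "res f"] dom_measurable[of v] L2_D(1)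
    by (intro L2_inner_cong_AE) (auto simp: form_operator_def intro!: borel_measurable_add)
  finally show "form1 M A (res f) v = L2_inner M f v" .
qed

lemma res_L2: "f \<in> L2 M \<Longrightarrow> res f \<in> L2 M"
  by (rule dom_L2[OF res(1)])

text \<open>
  The form \<open>(G f, g)\<close> of the resolvent \<open>G\<close>. By the resolvent equation it is the pullback of \<open>form1\<close> along
  \<open>G\<close>.
\<close>
definition resform :: "('a \<Rightarrow> real) \<Rightarrow> ('a \<Rightarrow> real) \<Rightarrow> real" where
  "resform f g = L2_inner M (res f) g"

lemma resform_eq: "f \<in> L2 M \<Longrightarrow> g \<in> L2 M \<Longrightarrow> resform f g = form1 M A (res f) (res g)"
  unfolding resform_def using res(2)[OF _ res(1), of g f] L2.sym[OF res_L2, of f g] sym[OF res(1) res(1), of f g]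
  by simp

sublocale resform: semi_inner "L2 M" resform
proof
  fix u v w :: "'a \<Rightarrow> real" and c assume *: "u \<in> L2 M" "v \<in> L2 M" "w \<in> L2 M"
  note eq = resform_eq res(2)[OF _ res(1)]
  show "resform u v = resform v u" using * by (simp add: resform_eq sym[OF res(1) res(1)])
  show "resform (\<lambda>x. u x + v x) w = resform u w + resform v w"
    using * by (simp add: eq L2_add L2.B_add res_L2)
  show "resform (\<lambda>x. c * u x) w = c * resform u w"
    using * by (simp add: eq L2_scale L2.B_scale res_L2)
  show "0 \<le> resform u u" using * nonneg[OF res(1)] by (simp add: resform_eq)
qed (auto simp: L2_zero L2_add L2_scale)

text \<open>
  This is \<open>form1[G f - u] \<ge> 0\<close>, expanded.
\<close>
lemma dual_le_form1:
  assumes "u \<in> fdom A" "f \<in> L2 M"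
  shows "2 * L2_inner M f u - resform f f \<le> form1 M A u u"
  using nonneg[OF diff[OF res(1)[OF assms(2)] assms(1)]] assms
  by (simp add: B_diff_diff res resform_eq)

text \<open>
  The converse half of the duality: a function \<open>u\<close> belongs to the form domain as soon as its dual expression is
  bounded. The bound makes \<open>f \<mapsto> (f, u)\<close> continuous for the form \<open>(G f, f)\<close>; the sequence representing it there is
  mapped by \<open>G\<close> to a Cauchy sequence of the form domain, whose limit is \<open>u\<close>. In particular, \<open>u\<close> is approximated by
  elements of the range of \<open>G\<close>.
\<close>
lemma dual_bound:
  assumes u: "u \<in> L2 M" and le: "\<And>f. f \<in> L2 M \<Longrightarrow> 2 * L2_inner M f u - resform f f \<le> C"
  shows "u \<in> fdom A" "form1 M A u u \<le> C"
    "\<exists>f. (\<forall>n. f n \<in> L2 M) \<and> (\<lambda>n. nrm (\<lambda>x. res (f n) x - u x)) \<longlonglongrightarrow> 0"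
proof -
  have bound: "(L2_inner M f u)\<^sup>2 \<le> C * resform f f" if f: "f \<in> L2 M" for f
  proof -
    have "0 \<le> resform f f * t\<^sup>2 + 2 * (- L2_inner M f u) * t + C" for t
      using le[OF L2_scale[OF f, of t]] f u
      by (simp add: L2.B_scale resform.B_scale_scale L2_scale algebra_simps)
    from quadratic_nonneg_discriminant[OF resform.nonneg[OF f] this]
    show ?thesis by (simp add: mult.commute)
  qed
  obtain f where f: "\<And>n. f n \<in> L2 M" "resform.Cauchy_sequence f"
    and lim: "\<And>g. g \<in> L2 M \<Longrightarrow> (\<lambda>n. resform (f n) g) \<longlonglongrightarrow> L2_inner M g u"
    using resform.weak_riesz[of "\<lambda>f. L2_inner M f u" C] u bound
    by (auto simp: L2.B_add L2.B_scale)
  have "form1 M A (\<lambda>x. res (f i) x - res (f j) x) (\<lambda>x. res (f i) x - res (f j) x)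
      = resform (\<lambda>x. f i x - f j x) (\<lambda>x. f i x - f j x)" for i j
    using f by (simp add: B_diff_diff res(1) resform.B_diff_diff resform_eq)
  then have "Cauchy_sequence (\<lambda>n. res (f n))"
    using f(2) unfolding Cauchy_sequence_def resform.Cauchy_sequence_def by simp
  then obtain w where w: "w \<in> fdom A" "(\<lambda>n. nrm (\<lambda>x. res (f n) x - w x)) \<longlonglongrightarrow> 0"
    using complete[of "\<lambda>n. res (f n)"] res(1)[OF f(1)] by blast
  have "L2_inner M g w = L2_inner M g u" if g: "g \<in> L2 M" for g
  proof (rule LIMSEQ_unique)
    have "(\<lambda>n. form1 M A (res (f n)) (res g)) \<longlonglongrightarrow> form1 M A w (res g)"
      by (rule tendsto_B[OF res(1)[OF f(1)] w(1) res(1)[OF g] w(2)])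
    then show "(\<lambda>n. resform (f n) g) \<longlonglongrightarrow> L2_inner M g w"
      using sym[OF w(1) res(1)[OF g]] res(2)[OF g w(1)] by (simp add: resform_eq f g)
  qed (rule lim[OF g])
  note eq = this
  have wuL: "(\<lambda>x. w x - u x) \<in> L2 M" using L2.diff dom_L2[OF w(1)] u by blast
  have "L2_inner M (\<lambda>x. w x - u x) (\<lambda>x. w x - u x) = 0"
    using eq[OF wuL] L2.B_diff_right[OF dom_L2[OF w(1)] u wuL] by simp
  then have wu: "AE x in M. w x = u x"
    using L2_inner_self_eq_0[OF wuL] by simp
  show udom: "u \<in> fdom A" by (rule dom_cong[OF w(1) L2_D(1)[OF u] wu])
  have "nrm (\<lambda>x. res (f n) x - w x) = nrm (\<lambda>x. res (f n) x - u x)" for n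
    using wu by (intro arg_cong[of _ _ sqrt] form1_cong) (auto simp: diff res(1) f w udom)
  with w(2) have conv: "(\<lambda>n. nrm (\<lambda>x. res (f n) x - u x)) \<longlonglongrightarrow> 0" by simp
  then show "\<exists>f. (\<forall>n. f n \<in> L2 M) \<and> (\<lambda>n. nrm (\<lambda>x. res (f n) x - u x)) \<longlonglongrightarrow> 0"
    using f(1) by blast
  have "(\<lambda>n. 2 * form1 M A (res (f n)) u - form1 M A (res (f n)) (res (f n))) \<longlonglongrightarrow> 2 * form1 M A u u - form1 M A u u"
    by (intro tendsto_intros tendsto_B tendsto_B_same res(1) f udom conv)
  then have "2 * form1 M A u u - form1 M A u u \<le> C"
    by (rule LIMSEQ_le_const2) (use le[OF f(1)] in \<open>auto simp: res(2) f udom resform_eq\<close>)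
  then show "form1 M A u u \<le> C" by simp
qed

lemma ran_res_dense:
  assumes "u \<in> fdom A"
  obtains f where "\<And>n. f n \<in> L2 M" "(\<lambda>n. nrm (\<lambda>x. res (f n) x - u x)) \<longlonglongrightarrow> 0"
  using dual_bound(3)[OF dom_L2[OF assms] dual_le_form1[OF assms]] by blast

text \<open>
  For fixed \<open>f\<close> the dual expression is continuous in \<open>L\<^sup>2\<close>, and a supremum of continuous functions is
  lower semicontinuous.
\<close>
lemma lower_semicontinuous:
  assumes "\<And>n. u n \<in> fdom A" "w \<in> L2 M" "(\<lambda>n. L2_norm M (\<lambda>x. u n x - w x)) \<longlonglongrightarrow> 0"
    and "\<And>n. form1 M A (u n) (u n) \<le> c n" "c \<longlonglongrightarrow> C"
  shows "w \<in> fdom A" "form1 M A w w \<le> C"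
proof -
  have le: "2 * L2_inner M f w - resform f f \<le> C" if f: "f \<in> L2 M" for f
  proof (rule LIMSEQ_le)
    have "(\<lambda>n. L2_inner M (u n) f) \<longlonglongrightarrow> L2_inner M w f"
      using assms(3) by (intro L2.tendsto_B dom_L2 assms f) (simp add: L2_norm_def)
    then have "(\<lambda>n. L2_inner M f (u n)) \<longlonglongrightarrow> L2_inner M f w"
      by (simp add: L2_inner_def mult.commute)
    then show "(\<lambda>n. 2 * L2_inner M f (u n) - resform f f) \<longlonglongrightarrow> 2 * L2_inner M f w - resform f f"
      by (intro tendsto_intros)
    show "\<exists>N. \<forall>n\<ge>N. 2 * L2_inner M f (u n) - resform f f \<le> c n"
      using dual_le_form1[OF assms(1) f] assms(4) by (meson order.trans)
  qed (rule assms(5))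
  show "w \<in> fdom A" by (rule dual_bound(1)[OF assms(2)]) (rule le)
  show "form1 M A w w \<le> C" by (rule dual_bound(2)[OF assms(2)]) (rule le)
qed

text \<open>
  Bounded sequences need to be tested only on the dense range of the resolvent, where the form is
  an \<open>L\<^sup>2\<close> inner product.
\<close>
lemma weak_convergence:
  assumes u: "\<And>n. u n \<in> fdom A" and w: "w \<in> fdom A"
    and L2lim: "(\<lambda>n. L2_norm M (\<lambda>x. u n x - w x)) \<longlonglongrightarrow> 0"
    and bd: "\<And>n. nrm (u n) \<le> K" and h: "h \<in> fdom A"
  shows "(\<lambda>n. form1 M A h (u n)) \<longlonglongrightarrow> form1 M A h w"
proof -
  define d where "d n = (\<lambda>x. u n x - w x)" for n
  have d: "d n \<in> fdom A" for n unfolding d_def by (rule diff[OF u w])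
  define K' where "K' = \<bar>K\<bar> + nrm w + 1"
  have K': "K' > 0" using real_sqrt_ge_zero[OF nonneg[OF w]] unfolding K'_def by linarith
  have KK: "(e / 2 / K') * K' = e / 2" for e using K' by simp
  have dK: "nrm (d n) \<le> K'" for n
    using nrm_diff[OF u[of n] w] bd[of n] unfolding d_def K'_def by linarith
  obtain f where f: "\<And>n. f n \<in> L2 M" "(\<lambda>n. nrm (\<lambda>x. res (f n) x - h x)) \<longlonglongrightarrow> 0"
    using ran_res_dense[OF h] by blast
  have "(\<lambda>n. form1 M A h (d n)) \<longlonglongrightarrow> 0"
  proof (rule LIMSEQ_I)
    fix e :: real assume e: "e > 0"
    obtain k where k: "nrm (\<lambda>x. res (f k) x - h x) < e / 2 / K'"
      using order_tendstoD(2)[OF f(2), of "e / 2 / K'"] e K' by (auto simp: eventually_sequentially)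
    have "(\<lambda>n. L2_inner M (u n) (f k)) \<longlonglongrightarrow> L2_inner M w (f k)"
      using L2lim by (intro L2.tendsto_B dom_L2 u w f) (simp add: L2_norm_def)
    from LIMSEQ_D[OF this, of "e/2"] e obtain N where
      N: "\<And>n. n \<ge> N \<Longrightarrow> \<bar>L2_inner M (u n) (f k) - L2_inner M w (f k)\<bar> < e / 2" by auto
    have "\<bar>form1 M A h (d n)\<bar> < e" if n: "n \<ge> N" for n
    proof -
      have "form1 M A h (d n) = form1 M A (res (f k)) (d n) - form1 M A (\<lambda>x. res (f k) x - h x) (d n)"
        using d h f by (simp add: B_diff res(1))
      moreover have "form1 M A (res (f k)) (d n) = L2_inner M (u n) (f k) - L2_inner M w (f k)"
        unfolding res(2)[OF f(1) d] unfolding d_def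
        using L2.B_diff_right[OF dom_L2[OF u[of n]] dom_L2[OF w] f(1)[of k]] by (simp add: L2_inner_def mult.commute)
      moreover have "\<bar>form1 M A (\<lambda>x. res (f k) x - h x) (d n)\<bar> \<le> (e / 2 / K') * K'"
        using order.trans[OF abs_B_le[OF diff[OF res(1)[OF f(1)] h] d, of k n]
          mult_mono[OF less_imp_le[OF k] dK[of n]]] e K' nonneg[OF d] by simp
      ultimately show ?thesis using N[OF n] unfolding KK by linarith
    qed
    then show "\<exists>N. \<forall>n\<ge>N. norm (form1 M A h (d n) - 0) < e" by auto
  qed
  moreover have "form1 M A h (d n) = form1 M A h (u n) - form1 M A h w" for n
    unfolding d_def by (rule B_diff_right[OF u w h])
  ultimately show ?thesis by (simp add: LIM_zero_iff)
qed

end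

section \<open>Contractions\<close>

locale dirichlet_form_space = closed_form_space +
  assumes unit_contraction: "u \<in> fdom A \<Longrightarrow> (\<lambda>x. min (max (u x) 0) 1) \<in> fdom A"
    "u \<in> fdom A \<Longrightarrow> fval A (\<lambda>x. min (max (u x) 0) 1) (\<lambda>x. min (max (u x) 0) 1) \<le> fval A u u"
begin

text \<open>
  The positive part is the limit of \<open>min (u\<^sup>+) n = n (u / n)\<^sup>#\<close> with the unit contraction \<open>\<^sup>#\<close>, and the form is
  lower semicontinuous.
\<close>
lemma positive_part:
  assumes u: "u \<in> fdom A"
  shows "(\<lambda>x. max (u x) 0) \<in> fdom A" "nrm (\<lambda>x. max (u x) 0) \<le> nrm u"
proof -
  define c where "c n = real (Suc n)" for n
  define v where "v n x = min (max (u x) 0) (c n)" for n x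
  have c: "c n > 0" for n by (simp add: c_def)
  have v_eq: "v n = (\<lambda>x. c n * min (max (1 / c n * u x) 0) 1)" for n
    using c[of n] by (auto simp: v_def min_def max_def field_simps)
  have v: "v n \<in> fdom A" for n
    unfolding v_eq by (intro scale unit_contraction(1) u)
  have fv: "fval A (v n) (v n) \<le> fval A u u" for n
  proof -
    have "fval A (v n) (v n) \<le> (c n)\<^sup>2 * fval A (\<lambda>x. 1 / c n * u x) (\<lambda>x. 1 / c n * u x)"
      unfolding v_eq using unit_contraction[OF scale[OF u, of "1 / c n"]]
      by (subst fval.B_scale_scale) (auto intro: mult_left_mono)
    also have "\<dots> = fval A u u"
      using c[of n] by (subst fval.B_scale_scale[OF u]) (simp add: power2_eq_square)
    finally show ?thesis .
  qed
  have um: "u \<in> borel_measurable M" by (rule dom_measurable[OF u])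
  have vu: "\<bar>v n x\<bar> \<le> \<bar>u x\<bar>" for n x using c[of n] by (auto simp: v_def)
  have le: "form1 M A (v n) (v n) \<le> form1 M A u u" for n
    using fv L2_inner_mono[OF dom_L2[OF u] dom_measurable[OF v]] vu
    unfolding form1_def by (intro add_mono) auto
  have "(\<lambda>n. v n x) \<longlonglongrightarrow> max (u x) 0" for x
  proof (rule tendsto_eventually)
    obtain N where "max (u x) 0 \<le> real N" using real_arch_simple by blast
    then show "\<forall>\<^sub>F n in sequentially. v n x = max (u x) 0"
      by (intro eventually_sequentiallyI[of N]) (simp add: v_def c_def)
  qed
  then have *: "(\<lambda>x. max (u x) 0) \<in> L2 M" "(\<lambda>n. L2_norm M (\<lambda>x. v n x - max (u x) 0)) \<longlonglongrightarrow> 0"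
    using L2_dominated_convergence[OF dom_L2[OF u], of v "\<lambda>x. max (u x) 0"] um vu dom_measurable[OF v]
    by auto
  show "(\<lambda>x. max (u x) 0) \<in> fdom A" "nrm (\<lambda>x. max (u x) 0) \<le> nrm u"
    using lower_semicontinuous[OF v * le tendsto_const] by simp_all
qed

text \<open>
  The constants come from \<open>min u v = u - (u - v)\<^sup>+\<close>.
\<close>
lemma minimum:
  assumes u: "u \<in> fdom A" and v: "v \<in> fdom A"
  shows "(\<lambda>x. min (u x) (v x)) \<in> fdom A" "nrm (\<lambda>x. min (u x) (v x)) \<le> 2 * nrm u + nrm v"
proof -
  have eq: "(\<lambda>x. min (u x) (v x)) = (\<lambda>x. u x - max (u x - v x) 0)" by (auto simp: min_def max_def)
  note p = positive_part[OF diff[OF u v]]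
  show "(\<lambda>x. min (u x) (v x)) \<in> fdom A" unfolding eq by (rule diff[OF u p(1)])
  show "nrm (\<lambda>x. min (u x) (v x)) \<le> 2 * nrm u + nrm v"
    unfolding eq using nrm_diff[OF u p(1)] p(2) nrm_diff[OF u v] by linarith
qed

end

lemma dirichlet_form_space_iff: "dirichlet_form M A \<Longrightarrow> dirichlet_form_space M A"
  by unfold_locales (auto simp: dirichlet_form_def)

section \<open>Capacity and quasi-continuity\<close>

text \<open>
  The hypotheses on the form and the measures, with regularity and the absence of charge on sets of zero
  capacity in unfolded form.
\<close>
locale regular_form = dirichlet_form_space m E
  for m :: "'a::metric_space measure" and E :: "'a form" +
  fixes mu :: "'a measure"
  assumes radon_m: "radon_measure m" and radon_mu: "radon_measure mu"
    and form_dense: "\<lbrakk>u \<in> fdom E; e > 0\<rbrakk> \<Longrightarrow> \<exists>p \<in> Cc UNIV \<inter> fdom E. nrm (\<lambda>x. u x - p x) < e"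
    and uniform_dense: "\<lbrakk>p \<in> Cc UNIV; e > 0\<rbrakk> \<Longrightarrow> \<exists>q \<in> Cc UNIV \<inter> fdom E. \<forall>x. \<bar>p x - q x\<bar> < e"
    and no_charge: "\<lbrakk>N \<in> sets borel; capacity m E N = 0\<rbrakk> \<Longrightarrow> emeasure mu N = 0"
begin

lemma sets_m [simp, measurable_cong]: "sets m = sets borel"
  using radon_m by (simp add: radon_measure_def)

lemma sets_mu [simp, measurable_cong]: "sets mu = sets borel"
  using radon_mu by (simp add: radon_measure_def)

lemma space_m [simp]: "space m = UNIV"
  using sets_eq_imp_space_eq[OF sets_m] by simp

lemma measurable_m_eq: "borel_measurable m = (borel_measurable borel :: ('a \<Rightarrow> real) set)"
  by (rule measurable_cong_sets) simp_all

lemma measurable_mu_eq: "borel_measurable mu = (borel_measurable borel :: ('a \<Rightarrow> real) set)"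
  by (rule measurable_cong_sets) simp_all

text \<open>
  Open sets with capacity below \<open>r\<^sup>2\<close>. The square root is taken because the witnessing functions can then simply be added: by the
  triangle inequality, the square root of the capacity is countably subadditive.
\<close>
definition small :: "real \<Rightarrow> 'a set \<Rightarrow> bool" where
  "small r G \<longleftrightarrow> open G \<and> (\<exists>e\<in>fdom E. (AE x in m. 0 \<le> e x) \<and> (AE x in m. x \<in> G \<longrightarrow> 1 \<le> e x) \<and> nrm e < r)"

lemma capacity_less_iff:
  assumes "r > 0"
  shows "capacity m E S < ennreal (r\<^sup>2) \<longleftrightarrow> (\<exists>G. S \<subseteq> G \<and> small r G)"
proof
  assume "capacity m E S < ennreal (r\<^sup>2)"
  then obtain G e where G: "open G" "S \<subseteq> G" and e: "e \<in> fdom E" "AE x in m. x \<in> G \<longrightarrow> e x \<ge> 1"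
    "ennreal (form1 m E e e) < ennreal (r\<^sup>2)"
    unfolding capacity_def INF_less_iff form1_eq_shifted by auto
  have "form1 m E e e < r\<^sup>2" using e(3) nonneg[OF e(1)] by (simp add: ennreal_less_iff)
  then have "nrm e < r" using assms by (intro real_less_lsqrt) auto
  moreover have "AE x in m. x \<in> G \<longrightarrow> max (e x) 0 \<ge> 1"
    using e(2) by eventually_elim auto
  moreover have "nrm (\<lambda>x. max (e x) 0) < r"
    using positive_part(2)[OF e(1)] \<open>nrm e < r\<close> by linarith
  moreover have "AE x in m. 0 \<le> max (e x) 0" by simp
  ultimately have "small r G" unfolding small_def
    using positive_part(1)[OF e(1)] G(1) by (intro conjI bexI[of _ "\<lambda>x. max (e x) 0"])
  then show "\<exists>G. S \<subseteq> G \<and> small r G" using G by blast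
next
  assume "\<exists>G. S \<subseteq> G \<and> small r G"
  then obtain G e where G: "open G" "S \<subseteq> G" and e: "e \<in> fdom E" "AE x in m. x \<in> G \<longrightarrow> e x \<ge> 1" "nrm e < r"
    unfolding small_def by blast
  have "form1 m E e e < r\<^sup>2"
    using e(3) nonneg[OF e(1)] by (metis real_sqrt_less_iff real_sqrt_abs abs_of_pos assms)
  then have "ennreal (form1 m E e e) < ennreal (r\<^sup>2)"
    using nonneg[OF e(1)] by (simp add: ennreal_less_iff)
  then show "capacity m E S < ennreal (r\<^sup>2)"
    unfolding capacity_def INF_less_iff form1_eq_shifted using G e by auto
qed

lemma small_open: "small r G \<Longrightarrow> open G"
  by (simp add: small_def)

lemma small_pos: "small r G \<Longrightarrow> r > 0"
  unfolding small_def using nonneg by (meson le_less_trans real_sqrt_ge_zero)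

lemma small_mono: "small r G \<Longrightarrow> r \<le> s \<Longrightarrow> small s G"
  unfolding small_def by (meson less_le_trans)

lemma small_Un:
  assumes "small r G" "small s H"
  shows "small (r + s) (G \<union> H)"
proof -
  obtain e f where e: "e \<in> fdom E" "AE x in m. 0 \<le> e x" "AE x in m. x \<in> G \<longrightarrow> 1 \<le> e x" "nrm e < r"
    and f: "f \<in> fdom E" "AE x in m. 0 \<le> f x" "AE x in m. x \<in> H \<longrightarrow> 1 \<le> f x" "nrm f < s"
    using assms unfolding small_def by blast
  have "AE x in m. x \<in> G \<union> H \<longrightarrow> 1 \<le> e x + f x"
    using e(2,3) f(2,3) by eventually_elim auto
  moreover have "AE x in m. 0 \<le> e x + f x"
    using e(2) f(2) by eventually_elim auto
  moreover have "nrm (\<lambda>x. e x + f x) < r + s"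
    using nrm_add[OF e(1) f(1)] e(4) f(4) by linarith
  ultimately show ?thesis
    using open_Un[OF small_open[OF assms(1)] small_open[OF assms(2)]] add[OF e(1) f(1)] unfolding small_def
    by (intro conjI bexI[of _ "\<lambda>x. e x + f x"])
qed

text \<open>
  The sum of the witnesses converges in the form norm, and it dominates each of them, since they are nonnegative.
\<close>
lemma small_UN:
  assumes sm: "\<And>k. small (r k) (G k)" and sum: "summable r" and lt: "suminf r < R"
  shows "small R (\<Union>k. G k)"
proof -
  have "\<exists>e. e \<in> fdom E \<and> (AE x in m. 0 \<le> e x) \<and> (AE x in m. x \<in> G k \<longrightarrow> 1 \<le> e x) \<and> nrm e < r k" for k
    using sm[of k] unfolding small_def Bex_def by (rule conjunct2)
  from choice[OF allI[OF this]] obtain e where e: "\<And>k. e k \<in> fdom E" "\<And>k. AE x in m. 0 \<le> e k x"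
      "\<And>k. AE x in m. x \<in> G k \<longrightarrow> 1 \<le> e k x" "\<And>k. nrm (e k) < r k"
    by fast
  define s where "s n x = (\<Sum>k<n. e k x)" for n :: nat and x
  have s: "s n \<in> fdom E" for n unfolding s_def by (rule sum_mem[OF e(1)])
  have nn: "0 \<le> nrm (e k)" for k using nonneg[OF e(1)] by simp
  have sum': "summable (\<lambda>k. nrm (e k))"
    by (rule summable_comparison_test'[OF sum, of 0]) (use e(4) nn in \<open>auto intro: less_imp_le\<close>)
  have ndiff: "nrm (\<lambda>x. s (n + k) x - s n x) \<le> (\<Sum>i<k. nrm (e (i + n)))" for n k
  proof -
    have "(\<lambda>x. s (n + k) x - s n x) = (\<lambda>x. \<Sum>i<k. e (i + n) x)"
      unfolding s_def by (induction k) (auto simp: fun_eq_iff add.commute)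
    then show ?thesis using nrm_sum_le[of "\<lambda>i. e (i + n)" k] e(1) by simp
  qed
  have "Cauchy_sequence s"
    unfolding Cauchy_sequence_def
  proof (intro allI impI)
    fix d :: real assume d: "d > 0"
    from suminf_exist_split[OF d sum'] obtain N where N: "\<And>n. n \<ge> N \<Longrightarrow> norm (\<Sum>i. nrm (e (i + n))) < d"
      by blast
    have le: "nrm (\<lambda>x. s (n + k) x - s n x) < d" if "n \<ge> N" for n k
    proof -
      have "(\<Sum>i<k. nrm (e (i + n))) \<le> (\<Sum>i. nrm (e (i + n)))"
        using nn sum' by (intro sum_le_suminf summable_ignore_initial_segment) auto
      then show ?thesis using ndiff[of n k] N[OF that] by (simp add: abs_less_iff)
    qed
    have "nrm (\<lambda>x. s i x - s j x) < d" if ij: "i \<ge> N" "j \<ge> N" for i j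
    proof (cases "i \<le> j")
      case True
      then show ?thesis using le[OF ij(1), of "j - i"] nrm_minus_commute[OF s s, of i j] by simp
    next
      case False
      then show ?thesis using le[OF ij(2), of "i - j"] by simp
    qed
    then show "\<exists>N. \<forall>i\<ge>N. \<forall>j\<ge>N. nrm (\<lambda>x. s i x - s j x) < d" by blast
  qed
  then obtain w where w: "w \<in> fdom E" "(\<lambda>n. nrm (\<lambda>x. s n x - w x)) \<longlonglongrightarrow> 0"
    using complete[of s] s by blast
  obtain q where q: "strict_mono q" "AE x in m. (\<lambda>n. s (q n) x) \<longlonglongrightarrow> w x"
    using L2_AE_subsequence[OF dom_L2[OF s] dom_L2[OF w(1)] L2_tendsto[OF s w]] by blast
  have ae: "AE x in m. \<forall>k. 0 \<le> e k x \<and> (x \<in> G k \<longrightarrow> 1 \<le> e k x)"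
    using e(2,3) by (auto simp: AE_all_countable AE_conj_iff)
  have wge: "AE x in m. \<forall>k. e k x \<le> w x \<and> 0 \<le> w x"
    using ae q(2)
  proof eventually_elim
    case (elim x)
    have "e k x \<le> w x" for k
    proof (rule LIMSEQ_le_const[OF elim(2)], intro exI[of _ "Suc k"] allI impI)
      fix n assume "Suc k \<le> n"
      then have "k < q n" using strict_mono_imp_increasing[OF q(1), of n] by simp
      then show "e k x \<le> s (q n) x"
        unfolding s_def using elim(1) by (intro member_le_sum) auto
    qed
    then show ?case using elim(1) by (meson order.trans)
  qed
  have "AE x in m. x \<in> (\<Union>k. G k) \<longrightarrow> 1 \<le> w x"
    using ae wge by eventually_elim (auto intro: order.trans)
  moreover have "AE x in m. 0 \<le> w x" using wge by eventually_elim auto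
  moreover have "nrm w \<le> suminf r"
  proof (rule LIMSEQ_le_const2[OF tendsto_nrm[OF s w]])
    have "nrm (s n) \<le> suminf r" for n
    proof -
      have "nrm (s n) \<le> (\<Sum>k<n. nrm (e k))" unfolding s_def by (rule nrm_sum_le[OF e(1)])
      also have "\<dots> \<le> (\<Sum>k<n. r k)" using e(4) by (intro sum_mono less_imp_le) auto
      also have "\<dots> \<le> suminf r" using sum small_pos[OF sm] by (intro sum_le_suminf) (auto intro: less_imp_le)
      finally show ?thesis .
    qed
    then show "\<exists>N. \<forall>n\<ge>N. nrm (s n) \<le> suminf r" by blast
  qed
  ultimately show ?thesis
    unfolding small_def using w(1) lt small_open[OF sm] by (auto intro: le_less_trans)
qed

text \<open>
  A sequence of small open sets around \<open>S\<close> intersects in a Borel set of capacity zero. It is null for \<open>m\<close> because the witnesses dominate its indicator function in \<open>L\<^sup>2(m)\<close>.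
\<close>
lemma small_cover_null:
  assumes "\<And>r. r > 0 \<Longrightarrow> \<exists>G. small r G \<and> S \<subseteq> G"
  shows "AE x in m. x \<notin> S" "AE x in mu. x \<notin> S"
proof -
  obtain G where G: "\<And>n. small (1 / real (Suc n)) (G n)" "\<And>n. S \<subseteq> G n"
    using assms[of "1 / real (Suc _)"] by (metis of_nat_0_less_iff zero_less_Suc zero_less_divide_1_iff)
  define N where "N = (\<Inter>n. G n)"
  have N: "N \<in> sets borel" unfolding N_def using small_open[OF G(1)] by auto
  have SN: "S \<subseteq> N" using G(2) by (auto simp: N_def)
  have "capacity m E N \<le> ennreal c" if "c > 0" for c
  proof -
    obtain n where "1 / real (Suc n) < sqrt c" by (rule nat_approx_posE[OF real_sqrt_gt_zero[OF \<open>c > 0\<close>]])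
    then have "small (sqrt c) (G n)" using small_mono[OF G(1)] by (simp add: less_imp_le)
    moreover have "N \<subseteq> G n" by (auto simp: N_def)
    ultimately show ?thesis using capacity_less_iff[of "sqrt c" N] that by (auto intro: less_imp_le)
  qed
  then have "capacity m E N = 0"
    by (metis ennreal_le_epsilon add_0 zero_le zero_less_one le_zero_eq)
  then have "N \<in> null_sets mu" using no_charge[OF N] N by (auto simp: null_sets_def)
  then show "AE x in mu. x \<notin> S" by (rule AE_I') (use SN in auto)
  have "emeasure m N \<le> ennreal c" if "c > 0" for c
  proof -
    obtain n where n: "1 / real (Suc n) < sqrt c" by (rule nat_approx_posE[OF real_sqrt_gt_zero[OF \<open>c > 0\<close>]])
    obtain e where e: "e \<in> fdom E" "AE x in m. x \<in> G n \<longrightarrow> 1 \<le> e x" "nrm e < 1 / real (Suc n)"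
      using G(1)[of n] unfolding small_def by blast
    have "nrm e < sqrt c" using e(3) n by linarith
    then have *: "L2_inner m e e \<le> c" using L2_inner_le_form1[OF e(1)] by simp
    have "emeasure m N = (\<integral>\<^sup>+x. indicator N x \<partial>m)" using N by simp
    also have "\<dots> \<le> (\<integral>\<^sup>+x. ennreal ((e x)\<^sup>2) \<partial>m)"
    proof (rule nn_integral_mono_AE, use e(2) in eventually_elim)
      case (elim x)
      then show ?case using one_le_power[of "e x" 2] by (auto simp: N_def indicator_def)
    qed
    also have "\<dots> = ennreal (L2_inner m e e)"
      using L2_D(2)[OF dom_L2[OF e(1)]] by (simp add: L2_inner_self nn_integral_eq_integral)
    also have "\<dots> \<le> ennreal c" using * by (rule ennreal_leI)
    finally show ?thesis .
  qed
  then have "emeasure m N = 0"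
    by (metis ennreal_le_epsilon add_0 zero_le zero_less_one le_zero_eq)
  then have "N \<in> null_sets m" using N by (auto simp: null_sets_def)
  then show "AE x in m. x \<notin> S" by (rule AE_I') (use SN in auto)
qed


lemma quasi_continuous_iff:
  "quasi_continuous m E u \<longleftrightarrow> (\<forall>r>0. \<exists>G. small r G \<and> continuous_on (- G) u)"
proof
  assume q: "quasi_continuous m E u"
  show "\<forall>r>0. \<exists>G. small r G \<and> continuous_on (- G) u"
  proof (intro allI impI)
    fix r :: real assume r: "r > 0"
    then have "r\<^sup>2 > 0" by simp
    with q obtain G where "open G" "capacity m E G < ennreal (r\<^sup>2)" "continuous_on (- G) u"
      unfolding quasi_continuous_def by blast
    then obtain H where "G \<subseteq> H" "small r H" "continuous_on (- H) u"
      using capacity_less_iff[OF r] by (meson Compl_subset_Compl_iff continuous_on_subset)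
    then show "\<exists>G. small r G \<and> continuous_on (- G) u" by blast
  qed
next
  assume q: "\<forall>r>0. \<exists>G. small r G \<and> continuous_on (- G) u"
  show "quasi_continuous m E u"
    unfolding quasi_continuous_def
  proof (intro allI impI)
    fix e :: real assume e: "e > 0"
    then obtain G where G: "small (sqrt e) G" "continuous_on (- G) u" using q by (meson real_sqrt_gt_zero)
    then have "capacity m E G < ennreal e"
      using capacity_less_iff[of "sqrt e" G] e by auto
    then show "\<exists>G. open G \<and> capacity m E G < ennreal e \<and> continuous_on (- G) u"
      using G small_open by blast
  qed
qed

text \<open>
  One lemma for all pointwise operations; unary ones are obtained by ignoring an argument.
\<close>
lemma quasi_continuous_compose:
  fixes f :: "real \<Rightarrow> real \<Rightarrow> real"
  assumes "quasi_continuous m E u" "quasi_continuous m E v"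
    and f: "continuous_on UNIV (\<lambda>p. f (fst p) (snd p))"
  shows "quasi_continuous m E (\<lambda>x. f (u x) (v x))"
  unfolding quasi_continuous_iff
proof (intro allI impI)
  fix r :: real assume "r > 0"
  then have r: "r / 2 > 0" by simp
  obtain G H where GH: "small (r/2) G" "continuous_on (- G) u" "small (r/2) H" "continuous_on (- H) v"
    using assms r unfolding quasi_continuous_iff by meson
  have "continuous_on (- (G \<union> H)) (\<lambda>x. (u x, v x))"
    using GH by (intro continuous_on_Pair) (auto elim: continuous_on_subset)
  from continuous_on_compose2[OF f this] have "continuous_on (- (G \<union> H)) (\<lambda>x. f (u x) (v x))" by simp
  then show "\<exists>G. small r G \<and> continuous_on (- G) (\<lambda>x. f (u x) (v x))"
    using small_Un[OF GH(1,3)] by auto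
qed

lemma small_empty: "r > 0 \<Longrightarrow> small r {}"
  unfolding small_def using zero B_scale[OF zero zero, of 0] by (auto intro!: bexI[of _ "\<lambda>x. 0"])

lemma continuous_quasi_continuous: "continuous_on UNIV u \<Longrightarrow> quasi_continuous m E u"
  unfolding quasi_continuous_iff using small_empty by (metis Compl_empty_eq)

lemma qc_dom_iff: "u \<in> qc_dom m E \<longleftrightarrow> u \<in> fdom E \<and> quasi_continuous m E u"
  by (simp add: qc_dom_def)

lemma qc_zero: "(\<lambda>x. 0) \<in> qc_dom m E"
  by (simp add: qc_dom_iff zero continuous_quasi_continuous)

lemma qc_add: "u \<in> qc_dom m E \<Longrightarrow> v \<in> qc_dom m E \<Longrightarrow> (\<lambda>x. u x + v x) \<in> qc_dom m E"
  unfolding qc_dom_iff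
  by (auto intro!: add quasi_continuous_compose[of u v "\<lambda>a b. a + b"] continuous_intros)

lemma qc_scale: "u \<in> qc_dom m E \<Longrightarrow> (\<lambda>x. c * u x) \<in> qc_dom m E"
  unfolding qc_dom_iff
  by (auto intro!: scale quasi_continuous_compose[of u u "\<lambda>a b. c * a"] continuous_intros)

lemma qc_diff: "u \<in> qc_dom m E \<Longrightarrow> v \<in> qc_dom m E \<Longrightarrow> (\<lambda>x. u x - v x) \<in> qc_dom m E"
  unfolding qc_dom_iff
  by (auto intro!: diff quasi_continuous_compose[of u v "\<lambda>a b. a - b"] continuous_intros)

lemma qc_max0: "u \<in> qc_dom m E \<Longrightarrow> (\<lambda>x. max (u x) 0) \<in> qc_dom m E"
  unfolding qc_dom_iff
  by (auto intro!: positive_part(1) quasi_continuous_compose[of u u "\<lambda>a b. max a 0"] continuous_intros)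

lemma qc_min: "u \<in> qc_dom m E \<Longrightarrow> v \<in> qc_dom m E \<Longrightarrow> (\<lambda>x. min (u x) (v x)) \<in> qc_dom m E"
  unfolding qc_dom_iff
  by (auto intro!: minimum(1) quasi_continuous_compose[of u v "\<lambda>a b. min a b"] continuous_intros)

lemma qc_unit: "u \<in> qc_dom m E \<Longrightarrow> (\<lambda>x. min (max (u x) 0) 1) \<in> qc_dom m E"
  unfolding qc_dom_iff
  by (auto intro!: unit_contraction(1) quasi_continuous_compose[of u u "\<lambda>a b. min (max a 0) 1"] continuous_intros)

lemma Cc_qc: "p \<in> Cc UNIV \<Longrightarrow> p \<in> fdom E \<Longrightarrow> p \<in> qc_dom m E"
  by (simp add: qc_dom_iff Cc_def continuous_quasi_continuous)

lemma qc_dom_dom: "u \<in> qc_dom m E \<Longrightarrow> u \<in> fdom E"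
  by (simp add: qc_dom_iff)

lemma qc_borel: "u \<in> qc_dom m E \<Longrightarrow> u \<in> borel_measurable borel"
  using dom_measurable[OF qc_dom_dom] measurable_m_eq by blast

text \<open>
  Off a small open set \<open>H\<close> the function is continuous, so the superlevel set together with \<open>H\<close> is open. The sum of
  \<open>(u / e)\<^sup>+\<close> and the witness for \<open>H\<close> is a witness for this union.
\<close>
lemma chebyshev_one_sided:
  assumes u: "u \<in> qc_dom m E" and e: "e > 0" and d: "d > 0"
  obtains G where "small (nrm u / e + d) G" "{x. e < u x} \<subseteq> G"
proof -
  obtain H where H: "small d H" "continuous_on (- H) u"
    using u d unfolding qc_dom_iff quasi_continuous_iff by blast
  obtain f where f: "f \<in> fdom E" "AE x in m. 0 \<le> f x" "AE x in m. x \<in> H \<longrightarrow> 1 \<le> f x" "nrm f < d"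
    using H(1) unfolding small_def by blast
  define G where "G = {x. e < u x} \<union> H"
  have "- G = - H \<inter> u -` {..e}" by (auto simp: G_def)
  moreover have "closed (- H \<inter> u -` {..e})"
    using H small_open[OF H(1)] by (intro continuous_closed_preimage) auto
  ultimately have "open G" by (metis open_closed)
  note p = positive_part[OF scale[OF qc_dom_dom[OF u], of "1 / e"]]
  let ?g = "\<lambda>x. max (1 / e * u x) 0 + f x"
  have "AE x in m. x \<in> G \<longrightarrow> 1 \<le> ?g x"
    using f(2,3)
  proof eventually_elim
    case (elim x)
    have "1 \<le> 1 / e * u x" if "e < u x" using that e by (simp add: field_simps)
    then show ?case using elim by (fastforce simp: G_def)
  qed
  moreover have "AE x in m. 0 \<le> ?g x" using f(2) by eventually_elim auto
  moreover have "nrm ?g < nrm u / e + d"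
  proof -
    have "nrm (\<lambda>x. 1 / e * u x) = nrm u / e"
      using nrm_scale[OF qc_dom_dom[OF u], of "1 / e"] e by simp
    then show ?thesis using nrm_add[OF p(1) f(1)] p(2) f(4) by linarith
  qed
  ultimately have "small (nrm u / e + d) G"
    unfolding small_def using \<open>open G\<close> add[OF p(1) f(1)] by (intro conjI bexI[of _ ?g])
  then show ?thesis using that unfolding G_def by blast
qed

lemma chebyshev:
  assumes u: "u \<in> qc_dom m E" and e: "e > 0" and d: "d > 0"
  obtains G where "small (2 * nrm u / e + d) G" "{x. e < \<bar>u x\<bar>} \<subseteq> G"
proof -
  have d2: "d / 2 > 0" using d by simp
  obtain G where G: "small (nrm u / e + d / 2) G" "{x. e < u x} \<subseteq> G"
    using chebyshev_one_sided[OF u e d2] by blast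
  obtain H where H: "small (nrm u / e + d / 2) H" "{x. e < - u x} \<subseteq> H"
    using chebyshev_one_sided[OF qc_scale[OF u, of "-1"] e d2] nrm_scale[OF qc_dom_dom[OF u], of "-1"] by auto
  have "small (2 * nrm u / e + d) (G \<union> H)"
    using small_Un[OF G(1) H(1)] small_mono[of _ "G \<union> H" "2 * nrm u / e + d"] by (simp add: add.assoc)
  moreover have "{x. e < \<bar>u x\<bar>} \<subseteq> G \<union> H" using G(2) H(2) by (auto simp: abs_if split: if_splits)
  ultimately show ?thesis using that by blast
qed

text \<open>
  By Chebyshev's inequality, the superlevel sets have capacity zero. Hence a quasi-continuous representative of an \<open>m\<close>-class is determined \<open>\<mu>\<close>-almost everywhere.
\<close>
lemma qc_eq_0_AE:
  assumes u: "u \<in> qc_dom m E" and "form1 m E u u = 0"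
  shows "AE x in mu. u x = 0"
proof -
  have "AE x in mu. x \<notin> {x. 1 / real (Suc n) < \<bar>u x\<bar>}" for n
  proof (rule small_cover_null(2))
    fix r :: real assume "r > 0"
    then show "\<exists>G. small r G \<and> {x. 1 / real (Suc n) < \<bar>u x\<bar>} \<subseteq> G"
      using chebyshev[OF u, of "1 / real (Suc n)" r] assms(2) by auto
  qed
  then have "AE x in mu. \<forall>n. \<not> 1 / real (Suc n) < \<bar>u x\<bar>" by (simp add: AE_all_countable)
  then show ?thesis
  proof eventually_elim
    case (elim x)
    show ?case
    proof (rule ccontr)
      assume "u x \<noteq> 0"
      then obtain n where "1 / real (Suc n) < \<bar>u x\<bar>" using nat_approx_posE[of "\<bar>u x\<bar>"] by auto
      then show False using elim by blast
    qed
  qed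
qed

end

section \<open>Limits of quasi-continuous functions\<close>

context regular_form begin

lemma Cauchy_fast_subsequence:
  assumes "Cauchy_sequence u"
  obtains r :: "nat \<Rightarrow> nat" where "strict_mono r"
    "\<And>k. nrm (\<lambda>x. u (r (Suc k)) x - u (r k) x) < (1/4) ^ k"
proof -
  have "\<exists>N. \<forall>i\<ge>N. \<forall>j\<ge>N. nrm (\<lambda>x. u i x - u j x) < (1/4) ^ k" for k :: nat
    using assms unfolding Cauchy_sequence_def by simp
  then obtain N where N: "\<And>k i j. i \<ge> N k \<Longrightarrow> j \<ge> N k \<Longrightarrow> nrm (\<lambda>x. u i x - u j x) < (1/4) ^ k"
    by metis
  define r where "r = rec_nat (N 0) (\<lambda>k x. max (Suc x) (N (Suc k)))"
  have r: "r (Suc k) = max (Suc (r k)) (N (Suc k))" "r 0 = N 0" for k by (simp_all add: r_def)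
  have mono: "strict_mono r" unfolding strict_mono_Suc_iff r by (simp add: less_max_iff_disj)
  have "r k \<ge> N k" for k by (cases k) (simp_all add: r)
  moreover have "r (Suc k) \<ge> r k" for k using r by simp
  ultimately have "nrm (\<lambda>x. u (r (Suc k)) x - u (r k) x) < (1/4) ^ k" for k
    using N by (meson order.trans)
  then show ?thesis using that mono by blast
qed

text \<open>
  Along a rapidly converging subsequence, Chebyshev's inequality makes the increments uniformly summable off
  an open set \<open>H n\<close> that is small for large \<open>n\<close>. There the limit is uniform, hence continuous. The exceptional sets for
  convergence are covered by all \<open>H n\<close>, and are therefore null for \<open>m\<close> and for \<open>\<mu>\<close>. The former identifies the
  pointwise limit with the limit in the form domain.
\<close>
lemma qc_complete:
  assumes u: "\<And>n. u n \<in> qc_dom m E" and cau: "Cauchy_sequence u"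
  obtains w r where "w \<in> qc_dom m E" "(\<lambda>n. nrm (\<lambda>x. u n x - w x)) \<longlonglongrightarrow> 0"
    "strict_mono r" "AE x in mu. (\<lambda>n. u (r n) x) \<longlonglongrightarrow> w x"
proof -
  obtain r :: "nat \<Rightarrow> nat" where r: "strict_mono r"
    "\<And>k. nrm (\<lambda>x. u (r (Suc k)) x - u (r k) x) < (1/4) ^ k"
    using Cauchy_fast_subsequence[OF cau] by blast
  define v where "v k = u (r k)" for k
  have v: "v k \<in> qc_dom m E" for k by (simp add: v_def u)
  \<comment> \<open>Chebyshev at height \<open>2\<^sup>-\<^sup>k\<close> contributes \<open>2 \<cdot> 4\<^sup>-\<^sup>k / 2\<^sup>-\<^sup>k + 2\<^sup>-\<^sup>k\<close> to the size, the discontinuities of \<open>v k\<close> another \<open>2\<^sup>-\<^sup>k\<close>.\<close>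
  have "\<exists>D. small (4 * (1/2) ^ k) D \<and> continuous_on (- D) (v k) \<and> {x. (1/2) ^ k < \<bar>v (Suc k) x - v k x\<bar>} \<subseteq> D" for k
  proof -
    have k: "(1/2::real) ^ k > 0" by simp
    obtain G where G: "small (2 * nrm (\<lambda>x. v (Suc k) x - v k x) / (1/2) ^ k + (1/2) ^ k) G"
        "{x. (1/2) ^ k < \<bar>v (Suc k) x - v k x\<bar>} \<subseteq> G"
      using chebyshev[OF qc_diff[OF v v] k k] by blast
    obtain H where H: "small ((1/2) ^ k) H" "continuous_on (- H) (v k)"
      using v[of k] k unfolding qc_dom_iff quasi_continuous_iff by blast
    have "2 * nrm (\<lambda>x. v (Suc k) x - v k x) / (1/2) ^ k \<le> 2 * (1/4) ^ k / (1/2) ^ k"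
      using r(2)[of k] unfolding v_def by (intro divide_right_mono mult_left_mono) auto
    also have "\<dots> = 2 * (1/2) ^ k" by (simp add: power_divide field_simps flip: power_mult_distrib)
    finally have "small (4 * (1/2) ^ k) (G \<union> H)"
      using small_mono[OF small_Un[OF G(1) H(1)]] by simp
    then show ?thesis using G(2) H(2) by (intro exI[of _ "G \<union> H"]) (auto elim: continuous_on_subset)
  qed
  then obtain D where D: "\<And>k. small (4 * (1/2) ^ k) (D k)" "\<And>k. continuous_on (- D k) (v k)"
    "\<And>k x. x \<notin> D k \<Longrightarrow> \<bar>v (Suc k) x - v k x\<bar> \<le> (1/2) ^ k"
    by (metis (mono_tags, lifting) mem_Collect_eq not_le subsetD)
  define H where "H n = (\<Union>k. D (k + n))" for n
  \<comment> \<open>The sizes add up to \<open>8 \<cdot> 2\<^sup>-\<^sup>n\<close>; the bound in \<open>small\<close> is strict.\<close>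
  have H: "small (9 * (1/2) ^ n) (H n)" for n
    unfolding H_def
  proof (rule small_UN)
    show "small (4 * (1/2) ^ (k + n)) (D (k + n))" for k by (rule D(1))
    have "(\<lambda>k. 4 * (1/2) ^ n * (1/2::real) ^ k) sums (4 * (1/2) ^ n * (1 / (1 - 1/2)))"
      by (intro sums_mult geometric_sums) simp
    then have s: "(\<lambda>k. 4 * (1/2::real) ^ (k + n)) sums (8 * (1/2) ^ n)"
      by (simp add: power_add mult.commute mult.left_commute)
    then show "summable (\<lambda>k. 4 * (1/2::real) ^ (k + n))" by (rule sums_summable)
    show "(\<Sum>k. 4 * (1/2::real) ^ (k + n)) < 9 * (1/2) ^ n" using sums_unique[OF s, symmetric] by simp
  qed
  define w where "w x = lim (\<lambda>k. v k x)" for x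
  have lim_cont: "(\<forall>x\<in>- H n. (\<lambda>k. v k x) \<longlonglongrightarrow> w x) \<and> continuous_on (- H n) w" for n
  proof -
    define g where "g x = (\<Sum>k. v (Suc k + n) x - v (k + n) x)" for x
    have ul: "uniform_limit (- H n) (\<lambda>k x. \<Sum>i<k. v (Suc i + n) x - v (i + n) x) g sequentially"
      unfolding g_def
    proof (rule Weierstrass_m_test)
      show "norm (v (Suc i + n) x - v (i + n) x) \<le> (1/2) ^ i" if "x \<in> - H n" for i x
      proof -
        have "\<bar>v (Suc (i + n)) x - v (i + n) x\<bar> \<le> (1/2) ^ (i + n)"
          using that by (intro D(3)) (auto simp: H_def)
        also have "\<dots> \<le> (1/2) ^ i" by (intro power_decreasing) auto
        finally show ?thesis by simp
      qed
    qed (simp add: summable_geometric)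
    have tel: "(\<Sum>i<k. v (Suc i + n) x - v (i + n) x) = v (k + n) x - v n x" for k x
      using sum_lessThan_telescope[of "\<lambda>i. v (i + n) x" k] by simp
    have lim: "(\<lambda>k. v k x) \<longlonglongrightarrow> v n x + g x" if "x \<in> - H n" for x
    proof -
      have "(\<lambda>k. v (k + n) x - v n x) \<longlonglongrightarrow> g x"
        using tendsto_uniform_limitI[OF ul that] by (simp only: tel)
      from tendsto_add[OF tendsto_const[of "v n x"] this]
      have "(\<lambda>k. v (k + n) x) \<longlonglongrightarrow> v n x + g x" by simp
      then show ?thesis by (rule LIMSEQ_offset)
    qed
    have w_eq: "w x = v n x + g x" if "x \<in> - H n" for x
      unfolding w_def using lim[OF that] by (rule limI)
    have vc: "continuous_on (- H n) (v (k + n))" for k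
      using D(2)[of "k + n"] by (rule continuous_on_subset) (auto simp: H_def)
    have "continuous_on (- H n) g"
      by (rule uniform_limit_theorem[OF _ ul])
        (use vc[of 0] vc in \<open>auto simp only: tel add_0 trivial_limit_sequentially intro!: continuous_on_diff always_eventually\<close>)
    then have "continuous_on (- H n) (\<lambda>x. v n x + g x)"
      using vc[of 0] by (intro continuous_on_add) simp_all
    then have "continuous_on (- H n) w"
      by (rule continuous_on_eq) (simp add: w_eq)
    then show ?thesis using lim w_eq by simp
  qed
  have exN: "\<exists>n. 9 * (1/2) ^ n \<le> s" if s: "s > 0" for s :: real
  proof -
    obtain n where "(1/2::real) ^ n < s / 9" using real_arch_pow_inv[of "s/9" "1/2"] s by auto
    then show ?thesis by (intro exI[of _ n]) simp
  qed
  have qcw: "quasi_continuous m E w"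
    unfolding quasi_continuous_iff
  proof (intro allI impI)
    fix s :: real assume "s > 0"
    then obtain n where "9 * (1/2) ^ n \<le> s" using exN by blast
    then have "small s (H n)" by (rule small_mono[OF H])
    then show "\<exists>G. small s G \<and> continuous_on (- G) w" using lim_cont by blast
  qed
  have cover: "\<exists>G. small s G \<and> {x. \<not> (\<lambda>k. v k x) \<longlonglongrightarrow> w x} \<subseteq> G" if s: "s > 0" for s
  proof -
    obtain n where "9 * (1/2) ^ n \<le> s" using exN[OF s] by blast
    then have "small s (H n)" by (rule small_mono[OF H])
    moreover have "{x. \<not> (\<lambda>k. v k x) \<longlonglongrightarrow> w x} \<subseteq> H n" using lim_cont[of n] by blast
    ultimately show ?thesis by blast
  qed
  have ae: "AE x in m. (\<lambda>k. v k x) \<longlonglongrightarrow> w x" "AE x in mu. (\<lambda>k. v k x) \<longlonglongrightarrow> w x"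
    using small_cover_null[OF cover] by simp_all
  have wmeas: "w \<in> borel_measurable m"
    unfolding w_def using v qc_borel by (intro borel_measurable_lim_metric) (simp add: measurable_m_eq)
  obtain w' where w': "w' \<in> fdom E" "(\<lambda>n. nrm (\<lambda>x. u n x - w' x)) \<longlonglongrightarrow> 0"
    using complete[OF qc_dom_dom[OF u] cau] by blast
  have "(\<lambda>n. nrm (\<lambda>x. v n x - w' x)) \<longlonglongrightarrow> 0"
    using LIMSEQ_subseq_LIMSEQ[OF w'(2) r(1)] by (simp add: v_def comp_def)
  from L2_tendsto[OF qc_dom_dom[OF v] w'(1) this]
  obtain q where q: "strict_mono q" "AE x in m. (\<lambda>n. v (q n) x) \<longlonglongrightarrow> w' x"
    using L2_AE_subsequence[of v, OF dom_L2[OF qc_dom_dom[OF v]] dom_L2[OF w'(1)]] by blast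
  have eq: "AE x in m. w' x = w x"
    using ae(1) q(2)
  proof eventually_elim
    case (elim x)
    show ?case
      using LIMSEQ_unique[OF elim(2) LIMSEQ_subseq_LIMSEQ[OF elim(1) q(1), unfolded comp_def]] .
  qed
  have w: "w \<in> fdom E" by (rule dom_cong[OF w'(1) wmeas eq])
  have "nrm (\<lambda>x. u n x - w' x) = nrm (\<lambda>x. u n x - w x)" for n
    using eq by (intro arg_cong[of _ _ sqrt] form1_cong) (auto simp: diff qc_dom_dom[OF u] w'(1) w)
  then have "(\<lambda>n. nrm (\<lambda>x. u n x - w x)) \<longlonglongrightarrow> 0" using w'(2) by simp
  then show ?thesis
    using that[of w r] w qcw r(1) ae(2) unfolding v_def qc_dom_iff by blast
qed

text \<open>
  The quasi-continuous limit provided by completeness agrees \<open>\<mu>\<close>-almost everywhere with the given one.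
\<close>
lemma qc_AE_subsequence:
  assumes u: "\<And>n. u n \<in> qc_dom m E" and w: "w \<in> qc_dom m E"
    and lim: "(\<lambda>n. nrm (\<lambda>x. u n x - w x)) \<longlonglongrightarrow> 0"
  obtains r where "strict_mono r" "AE x in mu. (\<lambda>n. u (r n) x) \<longlonglongrightarrow> w x"
proof -
  have cau: "Cauchy_sequence u"
    by (rule convergent_Cauchy_sequence[OF qc_dom_dom[OF u] qc_dom_dom[OF w] lim])
  obtain w' r where w': "w' \<in> qc_dom m E" "(\<lambda>n. nrm (\<lambda>x. u n x - w' x)) \<longlonglongrightarrow> 0"
    and r: "strict_mono r" "AE x in mu. (\<lambda>n. u (r n) x) \<longlonglongrightarrow> w' x"
    using qc_complete[OF u cau] by blast
  have lim0: "(\<lambda>n. nrm (\<lambda>x. u n x - w x) + nrm (\<lambda>x. u n x - w' x)) \<longlonglongrightarrow> 0"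
    using tendsto_add[OF lim w'(2)] by simp
  have le: "nrm (\<lambda>x. w x - w' x) \<le> nrm (\<lambda>x. u n x - w x) + nrm (\<lambda>x. u n x - w' x)" for n
    using nrm_triangle[OF qc_dom_dom[OF w] qc_dom_dom[OF u] qc_dom_dom[OF w'(1)], of n]
      nrm_minus_commute[OF qc_dom_dom[OF w] qc_dom_dom[OF u], of n] by simp
  have "nrm (\<lambda>x. w x - w' x) \<le> 0" by (rule LIMSEQ_le_const[OF lim0]) (use le in auto)
  then have "form1 m E (\<lambda>x. w x - w' x) (\<lambda>x. w x - w' x) = 0"
    using nonneg[OF diff[OF qc_dom_dom[OF w] qc_dom_dom[OF w'(1)]]] by simp
  then have "AE x in mu. w x - w' x = 0" by (rule qc_eq_0_AE[OF qc_diff[OF w w'(1)]])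
  with r(2) have "AE x in mu. (\<lambda>n. u (r n) x) \<longlonglongrightarrow> w x" by eventually_elim simp
  then show ?thesis using that r(1) by blast
qed

abbreviation DJ :: "('a \<Rightarrow> real) set" where "DJ \<equiv> dom_J m E mu"

lemma DJ_qc: "u \<in> DJ \<Longrightarrow> u \<in> qc_dom m E" by (simp add: dom_J_def)
lemma DJ_L2: "u \<in> DJ \<Longrightarrow> u \<in> L2 mu" by (simp add: dom_J_def)
lemma DJ_dom: "u \<in> DJ \<Longrightarrow> u \<in> fdom E" by (rule qc_dom_dom[OF DJ_qc])
lemma DJ_I: "u \<in> qc_dom m E \<Longrightarrow> u \<in> L2 mu \<Longrightarrow> u \<in> DJ" by (simp add: dom_J_def)

lemma DJ_zero: "(\<lambda>x. 0) \<in> DJ" by (simp add: DJ_I qc_zero L2_zero)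
lemma DJ_add: "u \<in> DJ \<Longrightarrow> v \<in> DJ \<Longrightarrow> (\<lambda>x. u x + v x) \<in> DJ"
  by (rule DJ_I[OF qc_add[OF DJ_qc DJ_qc] L2_add[OF DJ_L2 DJ_L2]])
lemma DJ_scale: "u \<in> DJ \<Longrightarrow> (\<lambda>x. c * u x) \<in> DJ"
  by (rule DJ_I[OF qc_scale[OF DJ_qc] L2_scale[OF DJ_L2]])
lemma DJ_diff: "u \<in> DJ \<Longrightarrow> v \<in> DJ \<Longrightarrow> (\<lambda>x. u x - v x) \<in> DJ"
  by (rule DJ_I[OF qc_diff[OF DJ_qc DJ_qc] L2.diff[OF DJ_L2 DJ_L2]])

lemma DJ_bound:
  assumes "v \<in> DJ" "u \<in> qc_dom m E" "\<And>x. \<bar>u x\<bar> \<le> \<bar>v x\<bar>"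
  shows "u \<in> DJ"
  by (rule DJ_I[OF assms(2) L2_bound[OF DJ_L2[OF assms(1)]]])
    (use assms in \<open>auto simp: measurable_mu_eq qc_borel\<close>)

lemma DJ_unit: "u \<in> DJ \<Longrightarrow> (\<lambda>x. min (max (u x) 0) 1) \<in> DJ"
  by (rule DJ_bound[OF _ qc_unit[OF DJ_qc]]) auto

lemma DJ_max0: "u \<in> DJ \<Longrightarrow> (\<lambda>x. max (u x) 0) \<in> DJ"
  by (rule DJ_bound[OF _ qc_max0[OF DJ_qc]]) auto

end

section \<open>The approximating trace forms\<close>

text \<open>
  The approximating trace form for a fixed \<open>\<lambda>\<close>.
\<close>
locale shifted_trace = regular_form +
  fixes lam :: real
  assumes lam: "lam > 0"
begin

abbreviation Elam :: "('a \<Rightarrow> real) \<Rightarrow> ('a \<Rightarrow> real) \<Rightarrow> real" where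
  "Elam \<equiv> fval (shifted_form m E lam)"

text \<open>
  The inner product of the Hilbert space on the domain of \<open>J\<close> in which the resolvent equation is solved.
\<close>
definition BJ :: "('a \<Rightarrow> real) \<Rightarrow> ('a \<Rightarrow> real) \<Rightarrow> real" where
  "BJ u v = Elam u v + L2_inner mu u v"

abbreviation KJ :: "('a \<Rightarrow> real) set" where "KJ \<equiv> ker_J m E mu"
abbreviation OJ :: "('a \<Rightarrow> real) set" where "OJ \<equiv> ker_J_orth m E mu lam"

lemma Elam_def: "Elam u v = fval E u v + lam * L2_inner m u v"
  by (simp add: shifted_form_def)

sublocale sh: semi_inner "fdom E" Elam
  by (rule semi_inner_shifted[OF positive]) (use lam in simp)

lemma Elam_lower:
  assumes "u \<in> fdom E" shows "min 1 lam * form1 m E u u \<le> Elam u u"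
proof -
  have "min 1 lam * fval E u u \<le> fval E u u" "min 1 lam * L2_inner m u u \<le> lam * L2_inner m u u"
    using mult_right_mono[of "min 1 lam" 1, OF _ fval.nonneg[OF assms]]
      mult_right_mono[of "min 1 lam" lam, OF _ L2.nonneg[OF dom_L2[OF assms]]] by simp_all
  then show ?thesis unfolding Elam_def form1_def distrib_left by linarith
qed

lemma Elam_upper:
  assumes "u \<in> fdom E" shows "Elam u u \<le> max 1 lam * form1 m E u u"
proof -
  have "fval E u u \<le> max 1 lam * fval E u u" "lam * L2_inner m u u \<le> max 1 lam * L2_inner m u u"
    using mult_right_mono[of 1 "max 1 lam", OF _ fval.nonneg[OF assms]]
      mult_right_mono[of lam "max 1 lam", OF _ L2.nonneg[OF dom_L2[OF assms]]] by simp_all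
  then show ?thesis unfolding Elam_def form1_def distrib_left by linarith
qed

sublocale J: semi_inner DJ BJ
proof
  fix u v w :: "'a \<Rightarrow> real" and c assume *: "u \<in> DJ" "v \<in> DJ" "w \<in> DJ"
  note d = *[THEN DJ_dom] and l = *[THEN DJ_L2]
  show "BJ u v = BJ v u" using sh.sym[OF d(1,2)] L2.sym[OF l(1,2)] by (simp add: BJ_def)
  show "BJ (\<lambda>x. u x + v x) w = BJ u w + BJ v w"
    using sh.B_add[OF d] L2.B_add[OF l] by (simp add: BJ_def)
  show "BJ (\<lambda>x. c * u x) w = c * BJ u w"
    using sh.B_scale[OF d(1,3)] L2.B_scale[OF l(1,3)] by (simp add: BJ_def distrib_left)
  show "0 \<le> BJ u u" using sh.nonneg[OF d(1)] L2.nonneg[OF l(1)] by (simp add: BJ_def)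
qed (auto intro: DJ_zero DJ_add DJ_scale)

lemma L2_norm_le_J: "u \<in> DJ \<Longrightarrow> L2_norm mu u \<le> J.nrm u"
  using sh.nonneg[OF DJ_dom] by (simp add: L2_norm_def BJ_def)

lemma nrm_le_J:
  assumes "u \<in> DJ" shows "nrm u \<le> J.nrm u / sqrt (min 1 lam)"
proof -
  have "min 1 lam * form1 m E u u \<le> BJ u u"
    using Elam_lower[OF DJ_dom[OF assms]] L2.nonneg[OF DJ_L2[OF assms]] unfolding BJ_def by linarith
  then have "sqrt (min 1 lam) * nrm u \<le> J.nrm u" by (simp flip: real_sqrt_mult)
  then show ?thesis using lam by (simp add: field_simps)
qed

text \<open>
  This is the closedness of the operator \<open>J\<close>.
\<close>
lemma J_complete:
  assumes v: "\<And>n. v n \<in> DJ" and cau: "J.Cauchy_sequence v"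
  shows "\<exists>w\<in>DJ. (\<lambda>n. J.nrm (\<lambda>x. v n x - w x)) \<longlonglongrightarrow> 0"
proof -
  define c where "c = sqrt (min 1 lam)"
  have c: "c > 0" using lam by (simp add: c_def)
  have "Cauchy_sequence v"
    unfolding Cauchy_sequence_def
  proof (intro allI impI)
    fix e :: real assume "e > 0"
    then have "e * c > 0" using c by simp
    then obtain N where N: "\<And>i j. i \<ge> N \<Longrightarrow> j \<ge> N \<Longrightarrow> J.nrm (\<lambda>x. v i x - v j x) < e * c"
      using cau unfolding J.Cauchy_sequence_def by meson
    have "nrm (\<lambda>x. v i x - v j x) < e" if "i \<ge> N" "j \<ge> N" for i j
    proof -
      have "J.nrm (\<lambda>x. v i x - v j x) / c < e" using N[OF that] c by (simp only: pos_divide_less_eq)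
      then show ?thesis using nrm_le_J[OF DJ_diff[OF v v], of i j] unfolding c_def by linarith
    qed
    then show "\<exists>N. \<forall>i\<ge>N. \<forall>j\<ge>N. nrm (\<lambda>x. v i x - v j x) < e" by blast
  qed
  then obtain w r where w: "w \<in> qc_dom m E" "(\<lambda>n. nrm (\<lambda>x. v n x - w x)) \<longlonglongrightarrow> 0"
    and r: "strict_mono r" "AE x in mu. (\<lambda>n. v (r n) x) \<longlonglongrightarrow> w x"
    using qc_complete[of v, OF DJ_qc[OF v]] by blast
  have L2cau: "\<exists>N. \<forall>i\<ge>N. \<forall>j\<ge>N. L2_norm mu (\<lambda>x. v i x - v j x) < e" if "e > 0" for e
    using cau that L2_norm_le_J[OF DJ_diff[OF v v]] unfolding J.Cauchy_sequence_def by (meson le_less_trans)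
  have wm: "w \<in> borel_measurable mu" by (simp add: measurable_mu_eq qc_borel[OF w(1)])
  note L = L2_Cauchy_AE_limit[OF DJ_L2[OF v] wm r L2cau]
  have wJ: "w \<in> DJ" by (rule DJ_I[OF w(1) L(1)])
  have "(\<lambda>n. sqrt (max 1 lam * (nrm (\<lambda>x. v n x - w x))\<^sup>2 + (L2_norm mu (\<lambda>x. v n x - w x))\<^sup>2)) \<longlonglongrightarrow> sqrt (max 1 lam * 0\<^sup>2 + 0\<^sup>2)"
    by (intro tendsto_intros w(2) L(2))
  then have lim: "(\<lambda>n. sqrt (max 1 lam * (nrm (\<lambda>x. v n x - w x))\<^sup>2 + (L2_norm mu (\<lambda>x. v n x - w x))\<^sup>2)) \<longlonglongrightarrow> 0"
    by simp
  have "(\<lambda>n. J.nrm (\<lambda>x. v n x - w x)) \<longlonglongrightarrow> 0"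
    by (rule Lim_null_comparison[OF _ lim], intro always_eventually allI)
      (use Elam_upper[OF diff[OF DJ_dom[OF v] DJ_dom[OF wJ]]] nonneg[OF diff[OF DJ_dom[OF v] DJ_dom[OF wJ]]]
        J.nonneg[OF DJ_diff[OF v wJ]] in \<open>simp add: L2_norm_sq BJ_def\<close>)
  then show ?thesis using wJ by blast
qed

lemma KJ_D: "k \<in> KJ \<Longrightarrow> k \<in> DJ" "k \<in> KJ \<Longrightarrow> AE x in mu. k x = 0"
  by (simp_all add: ker_J_def)

lemma L2_inner_AE_0:
  assumes "AE x in mu. k x = 0" "k \<in> borel_measurable mu" "f \<in> borel_measurable mu"
  shows "L2_inner mu k f = 0"
proof -
  have "L2_inner mu k f = (\<integral>x. 0 \<partial>mu)"
    unfolding L2_inner_def using assms by (intro integral_cong_AE) auto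
  then show ?thesis by simp
qed

lemma KJ_inner: "k \<in> KJ \<Longrightarrow> f \<in> L2 mu \<Longrightarrow> L2_inner mu k f = 0"
  by (rule L2_inner_AE_0) (auto dest: KJ_D DJ_L2 L2_D)

lemma BJ_KJ: "k \<in> KJ \<Longrightarrow> u \<in> DJ \<Longrightarrow> BJ k u = Elam k u"
  by (simp add: BJ_def KJ_inner DJ_L2)

lemma KJ_I: "k \<in> DJ \<Longrightarrow> AE x in mu. k x = 0 \<Longrightarrow> k \<in> KJ"
  by (simp add: ker_J_def)

sublocale K: semi_inner KJ Elam
proof
  fix u v w :: "'a \<Rightarrow> real" and c assume *: "u \<in> KJ" "v \<in> KJ" "w \<in> KJ"
  note d = *[THEN KJ_D(1), THEN DJ_dom] and a = *[THEN KJ_D(2)]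
  show "Elam u v = Elam v u" by (rule sh.sym[OF d(1,2)])
  show "Elam (\<lambda>x. u x + v x) w = Elam u w + Elam v w" by (rule sh.B_add[OF d])
  show "Elam (\<lambda>x. c * u x) w = c * Elam u w" by (rule sh.B_scale[OF d(1,3)])
  show "0 \<le> Elam u u" by (rule sh.nonneg[OF d(1)])
  show "(\<lambda>x. u x + v x) \<in> KJ"
    using eventually_elim2[OF a(1,2), of "\<lambda>x. u x + v x = 0"]
    by (intro KJ_I DJ_add *[THEN KJ_D(1)]) auto
  show "(\<lambda>x. c * u x) \<in> KJ"
    by (rule KJ_I[OF DJ_scale[OF KJ_D(1)[OF *(1)]]]) (use a(1) in \<open>eventually_elim, simp\<close>)
qed (simp add: KJ_I DJ_zero)

text \<open>
  On \<open>ker J\<close> both inner products agree, so it inherits completeness as a closed subspace.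
\<close>
lemma K_complete:
  assumes v: "\<And>n. v n \<in> KJ" and cau: "K.Cauchy_sequence v"
  shows "\<exists>w\<in>KJ. (\<lambda>n. K.nrm (\<lambda>x. v n x - w x)) \<longlonglongrightarrow> 0"
proof -
  note vJ = KJ_D(1)[OF v]
  have "J.Cauchy_sequence v"
    using cau BJ_KJ[OF K.diff[OF v v] DJ_diff[OF vJ vJ]]
    unfolding J.Cauchy_sequence_def K.Cauchy_sequence_def by simp
  then obtain w where w: "w \<in> DJ" "(\<lambda>n. J.nrm (\<lambda>x. v n x - w x)) \<longlonglongrightarrow> 0"
    using J_complete[of v, OF vJ] by blast
  have L: "(\<lambda>n. L2.nrm mu (\<lambda>x. v n x - w x)) \<longlonglongrightarrow> 0"
    by (rule Lim_null_comparison[OF _ w(2)])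
      (use L2_norm_le_J[OF DJ_diff[OF vJ w(1)]] L2.nonneg[OF L2.diff[OF DJ_L2[OF vJ] DJ_L2[OF w(1)]]]
        in \<open>simp add: L2_norm_def\<close>)
  have "(\<lambda>n. L2_inner mu (v n) w) \<longlonglongrightarrow> L2_inner mu w w"
    by (rule L2.tendsto_B[OF DJ_L2[OF vJ] DJ_L2[OF w(1)] DJ_L2[OF w(1)] L])
  then have "L2_inner mu w w = 0"
    using KJ_inner[OF v DJ_L2[OF w(1)]] by (simp add: LIMSEQ_const_iff)
  then have wK: "w \<in> KJ"
    using L2_inner_self_eq_0[OF DJ_L2[OF w(1)]] w(1) by (simp add: KJ_I)
  have "J.nrm (\<lambda>x. v n x - w x) = K.nrm (\<lambda>x. v n x - w x)" for n
    using BJ_KJ[OF K.diff[OF v wK] DJ_diff[OF vJ w(1)]] by simp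
  then show ?thesis using w(2) wK by auto
qed

lemma OJ_D: "p \<in> OJ \<Longrightarrow> p \<in> qc_dom m E" "p \<in> OJ \<Longrightarrow> k \<in> KJ \<Longrightarrow> Elam p k = 0"
  by (simp_all add: ker_J_orth_def)

lemma OJ_dom: "p \<in> OJ \<Longrightarrow> p \<in> fdom E"
  by (rule qc_dom_dom[OF OJ_D(1)])

lemma OJ_I: "p \<in> qc_dom m E \<Longrightarrow> (\<And>k. k \<in> KJ \<Longrightarrow> Elam p k = 0) \<Longrightarrow> p \<in> OJ"
  by (simp add: ker_J_orth_def)

lemma OJ_diff: "p \<in> OJ \<Longrightarrow> q \<in> OJ \<Longrightarrow> (\<lambda>x. p x - q x) \<in> OJ"
  by (rule OJ_I) (auto simp: qc_diff OJ_D sh.B_diff OJ_dom DJ_dom KJ_D(1))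

lemma Elam_eq_0_AE:
  assumes "u \<in> qc_dom m E" "Elam u u = 0" shows "AE x in mu. u x = 0"
proof (rule qc_eq_0_AE[OF assms(1)])
  have "min 1 lam * form1 m E u u \<le> 0" using Elam_lower[OF qc_dom_dom[OF assms(1)]] assms(2) by simp
  then have "form1 m E u u \<le> 0" using lam by (auto simp: mult_le_0_iff min_def split: if_splits)
  then show "form1 m E u u = 0" using nonneg[OF qc_dom_dom[OF assms(1)]] by simp
qed

text \<open>
  The component in \<open>ker J\<close> represents the functional \<open>E\<^sub>\<lambda>(u, \<cdot>)\<close> there, by completeness of \<open>ker J\<close>.
\<close>
lemma projection_exists:
  assumes u: "u \<in> DJ"
  obtains p where "p \<in> OJ" "p \<in> DJ" "AE x in mu. p x = u x" "\<And>w. w \<in> OJ \<Longrightarrow> Elam p w = Elam u w"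
proof -
  obtain q where q: "q \<in> KJ" "\<And>k. k \<in> KJ \<Longrightarrow> Elam q k = Elam u k"
  proof (rule K.riesz[where l = "Elam u" and C = "Elam u u"])
    show "\<exists>w\<in>KJ. (\<lambda>n. K.nrm (\<lambda>x. v n x - w x)) \<longlonglongrightarrow> 0"
      if "\<And>n. v n \<in> KJ" "K.Cauchy_sequence v" for v by (rule K_complete[OF that])
  next
    fix k k' c assume k: "k \<in> KJ"
    note d = DJ_dom[OF KJ_D(1)[OF k]]
    show "Elam u (\<lambda>x. c * k x) = c * Elam u k" by (rule sh.B_scale_right[OF d DJ_dom[OF u]])
    show "(Elam u k)\<^sup>2 \<le> Elam u u * Elam k k" by (rule sh.cauchy_schwarz[OF DJ_dom[OF u] d])
    assume "k' \<in> KJ"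
    then show "Elam u (\<lambda>x. k x + k' x) = Elam u k + Elam u k'"
      by (intro sh.B_add_right d DJ_dom[OF u] DJ_dom[OF KJ_D(1)])
  qed blast
  define p where "p x = u x - q x" for x
  note dq = KJ_D(1)[OF q(1)]
  have pJ: "p \<in> DJ" unfolding p_def by (rule DJ_diff[OF u dq])
  have "p \<in> OJ"
  proof (rule OJ_I[OF DJ_qc[OF pJ]])
    fix k assume k: "k \<in> KJ"
    show "Elam p k = 0"
      unfolding p_def using sh.B_diff[OF DJ_dom[OF u] DJ_dom[OF dq] DJ_dom[OF KJ_D(1)[OF k]]] q(2)[OF k] by simp
  qed
  moreover have "AE x in mu. p x = u x"
    using KJ_D(2)[OF q(1)] by eventually_elim (simp add: p_def)
  moreover have "Elam p w = Elam u w" if w: "w \<in> OJ" for w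
    unfolding p_def using sh.B_diff[OF DJ_dom[OF u] DJ_dom[OF dq] OJ_dom[OF w]] OJ_D(2)[OF w q(1)]
      sh.sym[OF OJ_dom[OF w] DJ_dom[OF dq]] by simp
  ultimately show ?thesis using that pJ by blast
qed

text \<open>
  The projection of \<open>u\<close> differs from \<open>u\<close> by an element of \<open>ker J\<close>. Since the chosen representative is determined up to
  functions of form norm zero, this holds for it as well, \<open>\<mu>\<close>-almost everywhere.
\<close>
lemma proj_J:
  assumes u: "u \<in> DJ"
  shows "proj_J m E mu lam u \<in> OJ" "proj_J m E mu lam u \<in> DJ" "AE x in mu. proj_J m E mu lam u x = u x"
    "\<And>w. w \<in> OJ \<Longrightarrow> Elam (proj_J m E mu lam u) w = Elam u w"
proof -
  let ?P = "proj_J m E mu lam u"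
  obtain p where p: "p \<in> OJ" "p \<in> DJ" "AE x in mu. p x = u x" "\<And>w. w \<in> OJ \<Longrightarrow> Elam p w = Elam u w"
    using projection_exists[OF u] by blast
  have "p \<in> OJ \<and> (\<forall>w\<in>OJ. Elam (\<lambda>x. u x - p x) w = 0)"
    using p by (auto simp: sh.B_diff DJ_dom[OF u] OJ_dom)
  from someI[of "\<lambda>p. p \<in> OJ \<and> (\<forall>w\<in>OJ. Elam (\<lambda>x. u x - p x) w = 0)", OF this]
  have P: "?P \<in> OJ" "\<And>w. w \<in> OJ \<Longrightarrow> Elam (\<lambda>x. u x - ?P x) w = 0"
    unfolding proj_J_def by blast+
  show "?P \<in> OJ" by (rule P(1))
  show eq: "Elam ?P w = Elam u w" if "w \<in> OJ" for w
    using P(2)[OF that] by (simp add: sh.B_diff DJ_dom[OF u] OJ_dom[OF P(1)] OJ_dom[OF that])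
  note dd = OJ_diff[OF P(1) p(1)]
  have "Elam (\<lambda>x. ?P x - p x) (\<lambda>x. ?P x - p x) = 0"
    using eq[OF dd] p(4)[OF dd] sh.B_diff[OF OJ_dom[OF P(1)] OJ_dom[OF p(1)] OJ_dom[OF dd]] by simp
  then have "AE x in mu. ?P x - p x = 0"
    by (rule Elam_eq_0_AE[OF OJ_D(1)[OF dd]])
  with p(3) show ae: "AE x in mu. ?P x = u x" by eventually_elim simp
  then show "?P \<in> DJ"
    using OJ_D(1)[OF P(1)] qc_borel
    by (intro DJ_I L2_cong_AE[OF DJ_L2[OF u]]) (auto simp: measurable_mu_eq elim: eventually_mono)
qed

lemma J_preimage:
  assumes "v \<in> ran_J m E mu"
  shows "J_preimage m E mu v \<in> DJ" "AE x in mu. J_preimage m E mu v x = v x"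
proof -
  have "\<exists>u. u \<in> DJ \<and> (AE x in mu. u x = v x)" using assms by (auto simp: ran_J_def)
  from someI_ex[OF this] show "J_preimage m E mu v \<in> DJ" "AE x in mu. J_preimage m E mu v x = v x"
    unfolding J_preimage_def by blast+
qed

abbreviation approx where "approx \<equiv> trace_form_approx m E mu lam"

lemma ran_J_I: "u \<in> DJ \<Longrightarrow> AE x in mu. u x = v x \<Longrightarrow> v \<in> borel_measurable mu \<Longrightarrow> v \<in> ran_J m E mu"
  using L2_cong_AE[OF DJ_L2] by (auto simp: ran_J_def)

lemma Elam_OJ_cong:
  assumes p: "p \<in> OJ" and "u \<in> DJ" "v \<in> DJ" "AE x in mu. u x = v x"
  shows "Elam p u = Elam p v"
proof -
  have "(\<lambda>x. u x - v x) \<in> KJ" by (rule KJ_I[OF DJ_diff[OF assms(2,3)]]) (use assms(4) in simp)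
  from OJ_D(2)[OF p this] show ?thesis
    by (simp add: sh.B_diff_right DJ_dom assms OJ_dom)
qed

text \<open>
  In one argument the projection can be dropped, because the other argument is orthogonal to \<open>ker J\<close>.
\<close>
lemma approx_value:
  assumes v: "v \<in> ran_J m E mu" and w: "w \<in> ran_J m E mu"
    and w': "w' \<in> DJ" "AE x in mu. w' x = w x"
  defines "p \<equiv> proj_J m E mu lam (J_preimage m E mu v)"
  shows "fval approx v w = Elam p w'"
proof -
  note Pv = J_preimage[OF v] and Pw = J_preimage[OF w]
  have p: "p \<in> OJ" unfolding p_def by (rule proj_J(1)[OF Pv(1)])
  have "fval approx v w = Elam p (proj_J m E mu lam (J_preimage m E mu w))"
    by (simp add: trace_form_approx_def p_def)
  also have "\<dots> = Elam p w'"
  proof (rule Elam_OJ_cong[OF p proj_J(2)[OF Pw(1)] w'(1)])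
    show "AE x in mu. proj_J m E mu lam (J_preimage m E mu w) x = w' x"
      using proj_J(3)[OF Pw(1)] Pw(2) w'(2) by eventually_elim simp
  qed
  finally show ?thesis .
qed

lemma resolvent_equation:
  assumes f: "f \<in> L2 mu"
  obtains R where "R \<in> DJ" "\<And>w. w \<in> DJ \<Longrightarrow> BJ R w = L2_inner mu f w"
proof (rule J.riesz[where l = "L2_inner mu f" and C = "L2_inner mu f f"])
  fix u assume u: "u \<in> DJ"
  have "(L2_inner mu f u)\<^sup>2 \<le> L2_inner mu f f * L2_inner mu u u"
    by (rule L2.cauchy_schwarz[OF f DJ_L2[OF u]])
  also have "\<dots> \<le> L2_inner mu f f * BJ u u"
    using sh.nonneg[OF DJ_dom[OF u]] by (intro mult_left_mono L2.nonneg[OF f]) (simp add: BJ_def)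
  finally show "(L2_inner mu f u)\<^sup>2 \<le> L2_inner mu f f * BJ u u" .
qed (auto simp: L2.B_add_right L2.B_scale_right f DJ_L2 J_complete)

text \<open>
  The solution \<open>R\<close> of the resolvent equation on the domain of \<open>J\<close> shows that the choice in \<open>resolvent1\<close> is possible.
  The function \<open>r\<close> is obtained from the chosen element by lifting it along \<open>J\<close> and projecting.
\<close>
lemma approx_resolvent:
  assumes f: "f \<in> L2 mu"
  obtains r where "r \<in> DJ" "AE x in mu. r x = resolvent1 mu (form_operator mu approx) f x"
    "resolvent1 mu (form_operator mu approx) f \<in> L2 mu"
    "\<And>w. w \<in> DJ \<Longrightarrow> BJ r w = L2_inner mu f w"
proof -
  have dom: "fdom approx = ran_J m E mu" by (simp add: trace_form_approx_def)
  obtain R where R: "R \<in> DJ" "\<And>w. w \<in> DJ \<Longrightarrow> BJ R w = L2_inner mu f w"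
    using resolvent_equation[OF f] by blast
  have RO: "R \<in> OJ"
  proof (rule OJ_I[OF DJ_qc[OF R(1)]])
    fix k assume k: "k \<in> KJ"
    show "Elam R k = 0"
      using R(2)[OF KJ_D(1)[OF k]] KJ_inner[OF k] f DJ_L2[OF R(1)] DJ_L2[OF KJ_D(1)[OF k]]
      by (simp add: BJ_def L2.sym[of _ _ k])
  qed
  have Rran: "R \<in> ran_J m E mu" by (rule ran_J_I[OF R(1)]) (use L2_D(1)[OF DJ_L2[OF R(1)]] in auto)
  have "fval approx R w = L2_inner mu (\<lambda>x. f x - R x) w" if w: "w \<in> ran_J m E mu" for w
  proof -
    note Pw = J_preimage[OF w] and PR = J_preimage[OF Rran]
    let ?w = "J_preimage m E mu w" and ?p = "proj_J m E mu lam (J_preimage m E mu R)"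
    have wL: "w \<in> L2 mu" using w by (simp add: ran_J_def)
    have "fval approx R w = Elam ?p (proj_J m E mu lam ?w)"
      by (simp add: trace_form_approx_def)
    also have "\<dots> = Elam (J_preimage m E mu R) (proj_J m E mu lam ?w)"
      by (rule proj_J(4)[OF PR(1) proj_J(1)[OF Pw(1)]])
    also have "\<dots> = Elam (proj_J m E mu lam ?w) (J_preimage m E mu R)"
      by (rule sh.sym[OF DJ_dom[OF PR(1)] DJ_dom[OF proj_J(2)[OF Pw(1)]]])
    also have "\<dots> = Elam (proj_J m E mu lam ?w) R"
      by (rule Elam_OJ_cong[OF proj_J(1)[OF Pw(1)] PR(1) R(1) PR(2)])
    also have "\<dots> = Elam R (proj_J m E mu lam ?w)"
      by (rule sh.sym[OF DJ_dom[OF proj_J(2)[OF Pw(1)]] DJ_dom[OF R(1)]])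
    also have "\<dots> = L2_inner mu (\<lambda>x. f x - R x) (proj_J m E mu lam ?w)"
      using R(2)[OF proj_J(2)[OF Pw(1)]] L2.B_diff[OF f DJ_L2[OF R(1)] DJ_L2[OF proj_J(2)[OF Pw(1)]]]
      by (simp add: BJ_def)
    also have "\<dots> = L2_inner mu (\<lambda>x. f x - R x) w"
    proof (rule L2_inner_cong_AE)
      show "AE x in mu. proj_J m E mu lam ?w x = w x"
        using proj_J(3)[OF Pw(1)] Pw(2) by eventually_elim simp
    qed (use L2_D(1)[OF L2.diff[OF f DJ_L2[OF R(1)]]] L2_D(1)[OF wL] L2_D(1)[OF DJ_L2[OF proj_J(2)[OF Pw(1)]]] in auto)
    finally show ?thesis .
  qed
  then have "(R, \<lambda>x. f x - R x) \<in> form_operator mu approx"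
    unfolding form_operator_def using L2.diff[OF f DJ_L2[OF R(1)]] Rran by (simp add: dom)
  then have "\<exists>u g. (u, g) \<in> form_operator mu approx \<and> (AE x in mu. g x + u x = f x)"
    by (intro exI[of _ R] exI[of _ "\<lambda>x. f x - R x"]) auto
  from someI_ex[OF this] obtain g where
    g: "(resolvent1 mu (form_operator mu approx) f, g) \<in> form_operator mu approx"
      "AE x in mu. g x + resolvent1 mu (form_operator mu approx) f x = f x"
    unfolding resolvent1_def by blast
  define u where "u = resolvent1 mu (form_operator mu approx) f"
  have "(u, g) \<in> form_operator mu approx" using g(1) by (simp only: u_def)
  then have u: "u \<in> ran_J m E mu" "g \<in> L2 mu" "\<And>w. w \<in> ran_J m E mu \<Longrightarrow> fval approx u w = L2_inner mu g w"
    by (auto simp: form_operator_def dom)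
  have uL: "u \<in> L2 mu" using u(1) by (simp add: ran_J_def)
  note Pu = J_preimage[OF u(1)]
  let ?r = "proj_J m E mu lam (J_preimage m E mu u)"
  note r = proj_J[OF Pu(1)]
  have ru: "AE x in mu. ?r x = u x" using r(3) Pu(2) by eventually_elim simp
  have "BJ ?r w = L2_inner mu f w" if w: "w \<in> DJ" for w
  proof -
    have wr: "w \<in> ran_J m E mu" by (rule ran_J_I[OF w]) (use L2_D(1)[OF DJ_L2[OF w]] in auto)
    have "Elam ?r w = L2_inner mu g w"
      using approx_value[OF u(1) wr w] u(3)[OF wr] by simp
    moreover have "L2_inner mu ?r w = L2_inner mu u w"
      using L2_D(1)[OF uL] L2_D(1)[OF DJ_L2[OF w]] L2_D(1)[OF DJ_L2[OF r(2)]]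
      by (intro L2_inner_cong_AE ru) auto
    moreover have "L2_inner mu f w = L2_inner mu (\<lambda>x. g x + u x) w"
      using g(2) L2_D(1)[OF uL] L2_D(1)[OF u(2)] L2_D(1)[OF f] L2_D(1)[OF DJ_L2[OF w]]
      by (intro L2_inner_cong_AE) (auto simp: u_def[symmetric])
    ultimately show ?thesis using L2.B_add[OF u(2) uL DJ_L2[OF w]] by (simp add: BJ_def)
  qed
  then show ?thesis using that r(2) ru uL unfolding u_def by blast
qed

end

section \<open>The trace form as a limit\<close>

text \<open>
  The trace form, given by the convergence of the resolvents.
\<close>
locale trace_limit = regular_form +
  fixes T :: "'a form"
  assumes closed_T: "closed_form mu T"
    and resolvent_limit: "f \<in> L2 mu \<Longrightarrow>
      ((\<lambda>lam. L2_norm mu (\<lambda>x. resolvent1 mu (form_operator mu (trace_form_approx m E mu lam)) f x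
         - resolvent1 mu (form_operator mu T) f x)) \<longlongrightarrow> 0) (at_right 0)"
begin

sublocale T: closed_form_space mu T
  by unfold_locales (rule closed_T)

text \<open>
  The limit \<open>\<lambda> \<down> 0\<close> is taken along this sequence.
\<close>
definition rate :: "nat \<Rightarrow> real" where "rate n = 1 / real (Suc n)"

lemma rate_pos: "rate n > 0" by (simp add: rate_def)

lemma rate_tendsto: "rate \<longlonglongrightarrow> 0"
  unfolding rate_def using LIMSEQ_Suc[OF lim_inverse_n'] by simp

lemma shifted_trace_rate: "shifted_trace m E mu (rate n)"
  by unfold_locales (rule rate_pos)

definition BR :: "nat \<Rightarrow> ('a \<Rightarrow> real) \<Rightarrow> ('a \<Rightarrow> real) \<Rightarrow> real" where
  "BR n u v = fval E u v + rate n * L2_inner m u v + L2_inner mu u v"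

lemma BR_eq: "shifted_trace.BJ m E mu (rate n) u v = BR n u v"
  using shifted_trace.BJ_def[OF shifted_trace_rate] by (simp add: BR_def shifted_form_def)

lemma approximants:
  assumes f: "f \<in> L2 mu"
  obtains r where "\<And>n. r n \<in> DJ" "\<And>n w. w \<in> DJ \<Longrightarrow> BR n (r n) w = L2_inner mu f w"
    "(\<lambda>n. L2_norm mu (\<lambda>x. r n x - T.res f x)) \<longlonglongrightarrow> 0"
proof -
  let ?R = "\<lambda>n. resolvent1 mu (form_operator mu (trace_form_approx m E mu (rate n))) f"
  have "\<exists>r. r \<in> DJ \<and> (AE x in mu. r x = ?R n x) \<and> ?R n \<in> L2 mu \<and> (\<forall>w\<in>DJ. BR n r w = L2_inner mu f w)" for n
  proof -
    obtain r where "r \<in> DJ" "AE x in mu. r x = ?R n x" "?R n \<in> L2 mu"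
      "\<And>w. w \<in> DJ \<Longrightarrow> BR n r w = L2_inner mu f w"
      by (rule shifted_trace.approx_resolvent[OF shifted_trace_rate f, of n, unfolded BR_eq]) (rule that)
    then show ?thesis by (intro exI[of _ r] conjI ballI)
  qed
  from choice[OF allI[OF this]] obtain r where r: "\<And>n. r n \<in> DJ" "\<And>n. AE x in mu. r n x = ?R n x"
    "\<And>n. ?R n \<in> L2 mu" "\<And>n w. w \<in> DJ \<Longrightarrow> BR n (r n) w = L2_inner mu f w"
    by fast
  have "filterlim rate (at_right 0) sequentially"
    unfolding filterlim_at using rate_tendsto rate_pos by (simp add: order_less_imp_not_eq2)
  from filterlim_compose[OF resolvent_limit[OF f] this]
  have "(\<lambda>n. L2_norm mu (\<lambda>x. ?R n x - T.res f x)) \<longlonglongrightarrow> 0" by (simp add: T.res_def)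
  moreover have "L2_norm mu (\<lambda>x. ?R n x - T.res f x) = L2_norm mu (\<lambda>x. r n x - T.res f x)" for n
    unfolding L2_norm_def
    using r(2)[of n] L2_D(1)[OF L2.diff[OF r(3) T.res_L2[OF f]]] L2_D(1)[OF L2.diff[OF DJ_L2[OF r(1)] T.res_L2[OF f]]]
    by (intro arg_cong[of _ _ sqrt] L2_inner_cong_AE) auto
  ultimately show ?thesis using that[OF r(1) r(4)] by simp
qed

lemma inner_limit:
  assumes "\<And>n. r n \<in> L2 mu" "w \<in> L2 mu" "f \<in> L2 mu" "(\<lambda>n. L2_norm mu (\<lambda>x. r n x - w x)) \<longlonglongrightarrow> 0"
  shows "(\<lambda>n. L2_inner mu f (r n)) \<longlonglongrightarrow> L2_inner mu f w"
  using L2.tendsto_B[OF assms(1-3)] assms(4) by (simp add: L2_norm_def L2_inner_def mult.commute)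

text \<open>
  The dual expression of the \<open>n\<close>-th resolvent at \<open>u\<close> is at most the \<open>n\<close>-th inner product of \<open>u\<close> with
  itself. Both sides converge, and the limit is a bound on the dual expression of \<open>T\<close>.
\<close>
lemma DJ_T:
  assumes u: "u \<in> DJ"
  shows "u \<in> fdom T" "form1 mu T u u \<le> fval E u u + L2_inner mu u u"
proof -
  have "2 * L2_inner mu f u - T.resform f f \<le> fval E u u + L2_inner mu u u" if f: "f \<in> L2 mu" for f
  proof -
    obtain r where r: "\<And>n. r n \<in> DJ" "\<And>n w. w \<in> DJ \<Longrightarrow> BR n (r n) w = L2_inner mu f w"
      "(\<lambda>n. L2_norm mu (\<lambda>x. r n x - T.res f x)) \<longlonglongrightarrow> 0"
      using approximants[OF f] by blast
    have le: "2 * L2_inner mu f u - L2_inner mu f (r n) \<le> fval E u u + rate n * L2_inner m u u + L2_inner mu u u" for n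
    proof -
      interpret S: shifted_trace m E mu "rate n" by (rule shifted_trace_rate)
      show ?thesis
        using S.J.nonneg[OF S.J.diff[OF r(1)[of n] u]] S.J.B_diff_diff[OF r(1)[of n] u] r(2)[OF u, of n]
          r(2)[OF r(1)[of n], of n]
        unfolding BR_eq by (simp add: BR_def)
    qed
    have "(\<lambda>n. 2 * L2_inner mu f u - L2_inner mu f (r n)) \<longlonglongrightarrow> 2 * L2_inner mu f u - L2_inner mu f (T.res f)"
      by (intro tendsto_intros inner_limit DJ_L2 r T.res_L2 f)
    moreover have "(\<lambda>n. fval E u u + rate n * L2_inner m u u + L2_inner mu u u) \<longlonglongrightarrow> fval E u u + 0 * L2_inner m u u + L2_inner mu u u"
      by (intro tendsto_intros rate_tendsto)
    ultimately have "2 * L2_inner mu f u - L2_inner mu f (T.res f) \<le> fval E u u + 0 * L2_inner m u u + L2_inner mu u u"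
      by (rule LIMSEQ_le) (use le in auto)
    then show ?thesis by (simp add: T.resform_def L2_inner_def mult.commute)
  qed
  from T.dual_bound(1,2)[OF DJ_L2[OF u] this]
  show "u \<in> fdom T" "form1 mu T u u \<le> fval E u u + L2_inner mu u u" by blast+
qed

text \<open>
  By the resolvent equations, \<open>T[r n - G f]\<close> with the \<open>L\<^sup>2\<close> part added is at most \<open>(f, G f) - (f, r n)\<close>, once \<open>T \<le> E\<close>
  has been used for \<open>r n\<close>. So convergence in \<open>L\<^sup>2(\<mu>)\<close> improves to convergence in the form norm.
\<close>
lemma res_approximation:
  assumes f: "f \<in> L2 mu"
  obtains r where "\<And>n. r n \<in> DJ" "(\<lambda>n. T.nrm (\<lambda>x. r n x - T.res f x)) \<longlonglongrightarrow> 0"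
    "(\<lambda>n. BR n (r n) (r n)) \<longlonglongrightarrow> form1 mu T (T.res f) (T.res f)"
    "(\<lambda>n. L2_norm mu (\<lambda>x. r n x - T.res f x)) \<longlonglongrightarrow> 0"
proof -
  obtain r where r: "\<And>n. r n \<in> DJ" "\<And>n w. w \<in> DJ \<Longrightarrow> BR n (r n) w = L2_inner mu f w"
    "(\<lambda>n. L2_norm mu (\<lambda>x. r n x - T.res f x)) \<longlonglongrightarrow> 0"
    using approximants[OF f] by blast
  have lim: "(\<lambda>n. L2_inner mu f (r n)) \<longlonglongrightarrow> L2_inner mu f (T.res f)"
    by (rule inner_limit[OF DJ_L2[OF r(1)] T.res_L2[OF f] f r(3)])
  have self: "form1 mu T (T.res f) (T.res f) = L2_inner mu f (T.res f)"
    by (rule T.res(2)[OF f T.res(1)[OF f]])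
  have rT: "r n \<in> fdom T" for n by (rule DJ_T(1)[OF r(1)])
  have le: "form1 mu T (\<lambda>x. r n x - T.res f x) (\<lambda>x. r n x - T.res f x)
      \<le> L2_inner mu f (T.res f) - L2_inner mu f (r n)" for n
  proof -
    have "0 \<le> rate n * L2_inner m (r n) (r n)"
      using rate_pos[of n] L2.nonneg[OF dom_L2[OF DJ_dom[OF r(1)]]] by (simp add: less_imp_le)
    then have "form1 mu T (r n) (r n) \<le> L2_inner mu f (r n)"
      using DJ_T(2)[OF r(1)[of n]] r(2)[OF r(1)[of n], of n] by (simp add: BR_def)
    then show ?thesis
      using T.B_diff_diff[OF rT T.res(1)[OF f], of n] T.res(2)[OF f rT, of n]
        T.sym[OF rT T.res(1)[OF f], of n] self by simp
  qed
  have "(\<lambda>n. sqrt (L2_inner mu f (T.res f) - L2_inner mu f (r n))) \<longlonglongrightarrow> sqrt (L2_inner mu f (T.res f) - L2_inner mu f (T.res f))"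
    by (intro tendsto_intros lim)
  then have lim0: "(\<lambda>n. sqrt (L2_inner mu f (T.res f) - L2_inner mu f (r n))) \<longlonglongrightarrow> 0" by simp
  have "(\<lambda>n. T.nrm (\<lambda>x. r n x - T.res f x)) \<longlonglongrightarrow> 0"
    by (rule Lim_null_comparison[OF _ lim0])
      (use le T.nonneg[OF T.diff[OF rT T.res(1)[OF f]]] in simp)
  moreover have "(\<lambda>n. BR n (r n) (r n)) \<longlonglongrightarrow> form1 mu T (T.res f) (T.res f)"
    using lim r(2)[OF r(1)] by (simp add: self)
  ultimately show ?thesis using that r(1,3) by blast
qed

lemma DJ_core:
  assumes u: "u \<in> fdom T" and e: "e > 0"
  shows "\<exists>v\<in>DJ. T.nrm (\<lambda>x. u x - v x) < e"
proof -
  have e2: "e / 2 > 0" using e by simp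
  obtain f where f: "\<And>n. f n \<in> L2 mu" "(\<lambda>n. T.nrm (\<lambda>x. T.res (f n) x - u x)) \<longlonglongrightarrow> 0"
    using T.ran_res_dense[OF u] by blast
  obtain k where k: "T.nrm (\<lambda>x. T.res (f k) x - u x) < e / 2"
    using order_tendstoD(2)[OF f(2) e2] by (auto simp: eventually_sequentially)
  obtain r where r: "\<And>n. r n \<in> DJ" "(\<lambda>n. T.nrm (\<lambda>x. r n x - T.res (f k) x)) \<longlonglongrightarrow> 0"
    by (rule res_approximation[OF f(1)[of k]]) (rule that)
  obtain n where n: "T.nrm (\<lambda>x. r n x - T.res (f k) x) < e / 2"
    using order_tendstoD(2)[OF r(2) e2] by (auto simp: eventually_sequentially)
  have "T.nrm (\<lambda>x. r n x - u x) < e"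
    using T.nrm_triangle[OF DJ_T(1)[OF r(1)] T.res(1)[OF f(1)] u, of n k] n k by linarith
  then have "T.nrm (\<lambda>x. u x - r n x) < e"
    using T.nrm_minus_commute[OF u DJ_T(1)[OF r(1)[of n]]] by linarith
  then show ?thesis by (rule bexI[OF _ r(1)[of n]])
qed

definition unit_cut :: "('a \<Rightarrow> real) \<Rightarrow> 'a \<Rightarrow> real" where
  "unit_cut u x = min (max (u x) 0) 1"

lemma unit_L2: "u \<in> L2 mu \<Longrightarrow> unit_cut u \<in> L2 mu"
  unfolding unit_cut_def by (rule L2_bound[of u]) (auto dest: L2_D(1))

lemma unit_tendsto:
  assumes "\<And>n. u n \<in> L2 mu" "w \<in> L2 mu" "(\<lambda>n. L2_norm mu (\<lambda>x. u n x - w x)) \<longlonglongrightarrow> 0"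
  shows "(\<lambda>n. L2_norm mu (\<lambda>x. unit_cut (u n) x - unit_cut w x)) \<longlonglongrightarrow> 0"
proof (rule Lim_null_comparison[OF _ assms(3)], intro always_eventually allI)
  fix n
  have "L2_norm mu (\<lambda>x. unit_cut (u n) x - unit_cut w x) \<le> L2_norm mu (\<lambda>x. u n x - w x)"
    using L2_D(1)[OF L2.diff[OF unit_L2[OF assms(1)] unit_L2[OF assms(2)]]]
    by (intro L2_norm_mono L2.diff assms) (auto simp: unit_cut_def)
  then show "norm (L2_norm mu (\<lambda>x. unit_cut (u n) x - unit_cut w x)) \<le> L2_norm mu (\<lambda>x. u n x - w x)"
    by (simp add: L2_norm_nonneg)
qed

text \<open>
  The \<open>L\<^sup>2\<close> part of the form norm of the truncations converges by itself, which is why semicontinuity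
  gives the inequality for \<open>T\<close> and not merely for the form norm.
\<close>
lemma unit_limit:
  assumes u: "\<And>n. u n \<in> fdom T" and w: "w \<in> fdom T"
    and lim: "(\<lambda>n. L2_norm mu (\<lambda>x. u n x - w x)) \<longlonglongrightarrow> 0"
    and un: "\<And>n. unit_cut (u n) \<in> fdom T" "\<And>n. fval T (unit_cut (u n)) (unit_cut (u n)) \<le> c n"
    and c: "c \<longlonglongrightarrow> fval T w w"
  shows "unit_cut w \<in> fdom T" "fval T (unit_cut w) (unit_cut w) \<le> fval T w w"
proof -
  note L = unit_L2[OF T.dom_L2[OF u]] unit_L2[OF T.dom_L2[OF w]]
  note ul = unit_tendsto[OF T.dom_L2[OF u] T.dom_L2[OF w] lim]
  have "(\<lambda>n. L2_inner mu (unit_cut (u n)) (unit_cut (u n))) \<longlonglongrightarrow> L2_inner mu (unit_cut w) (unit_cut w)"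
    using L2.tendsto_B_same[OF L] ul by (simp add: L2_norm_def)
  then have c': "(\<lambda>n. c n + L2_inner mu (unit_cut (u n)) (unit_cut (u n))) \<longlonglongrightarrow> fval T w w + L2_inner mu (unit_cut w) (unit_cut w)"
    by (intro tendsto_intros c)
  have le: "form1 mu T (unit_cut (u n)) (unit_cut (u n)) \<le> c n + L2_inner mu (unit_cut (u n)) (unit_cut (u n))" for n
    using un(2)[of n] by (simp add: form1_def)
  from T.lower_semicontinuous[OF un(1) L(2) ul le c']
  show "unit_cut w \<in> fdom T" "fval T (unit_cut w) (unit_cut w) \<le> fval T w w" by (simp_all add: form1_def)
qed

lemma T_fval_tendsto:
  assumes "\<And>n. u n \<in> fdom T" "w \<in> fdom T" "(\<lambda>n. T.nrm (\<lambda>x. u n x - w x)) \<longlonglongrightarrow> 0"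
  shows "(\<lambda>n. fval T (u n) (u n)) \<longlonglongrightarrow> fval T w w"
proof -
  have "(\<lambda>n. L2_inner mu (u n) (u n)) \<longlonglongrightarrow> L2_inner mu w w"
    using L2.tendsto_B_same[OF T.dom_L2[OF assms(1)] T.dom_L2[OF assms(2)]] T.L2_tendsto[OF assms]
    by (simp add: L2_norm_def)
  from tendsto_diff[OF T.tendsto_B_same[OF assms] this] show ?thesis by (simp add: form1_def)
qed

text \<open>
  Truncation decreases \<open>E[r n]\<close>, and \<open>E\<^sub>\<lambda>[r n]\<close> converges to \<open>T[G f]\<close>. For a general element \<open>u\<close> of the
  domain of \<open>T\<close>, there are approximations in the domain of \<open>J\<close>, but no such control of \<open>E\<close> along them.
\<close>
lemma unit_res:
  assumes f: "f \<in> L2 mu"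
  shows "unit_cut (T.res f) \<in> fdom T" "fval T (unit_cut (T.res f)) (unit_cut (T.res f)) \<le> fval T (T.res f) (T.res f)"
proof -
  obtain r where r: "\<And>n. r n \<in> DJ" "(\<lambda>n. T.nrm (\<lambda>x. r n x - T.res f x)) \<longlonglongrightarrow> 0"
    "(\<lambda>n. BR n (r n) (r n)) \<longlonglongrightarrow> form1 mu T (T.res f) (T.res f)"
    "(\<lambda>n. L2_norm mu (\<lambda>x. r n x - T.res f x)) \<longlonglongrightarrow> 0"
    using res_approximation[OF f] by blast
  note L = DJ_L2[OF r(1)] T.res_L2[OF f]
  have "(\<lambda>n. L2_inner mu (r n) (r n)) \<longlonglongrightarrow> L2_inner mu (T.res f) (T.res f)"
    using L2.tendsto_B_same[OF L] r(4) by (simp add: L2_norm_def)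
  from tendsto_diff[OF r(3) this]
  have c: "(\<lambda>n. BR n (r n) (r n) - L2_inner mu (r n) (r n)) \<longlonglongrightarrow> fval T (T.res f) (T.res f)"
    by (simp add: form1_def)
  have u: "unit_cut (r n) \<in> DJ" for n unfolding unit_cut_def by (rule DJ_unit[OF r(1)])
  have le: "fval T (unit_cut (r n)) (unit_cut (r n)) \<le> BR n (r n) (r n) - L2_inner mu (r n) (r n)" for n
  proof -
    have "fval T (unit_cut (r n)) (unit_cut (r n)) \<le> fval E (unit_cut (r n)) (unit_cut (r n))"
      using DJ_T(2)[OF u] by (simp add: form1_def)
    also have "\<dots> \<le> fval E (r n) (r n)"
      using unit_contraction(2)[OF DJ_dom[OF r(1)]] by (simp add: unit_cut_def[abs_def])
    also have "\<dots> \<le> fval E (r n) (r n) + rate n * L2_inner m (r n) (r n)"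
      using rate_pos[of n] L2.nonneg[OF dom_L2[OF DJ_dom[OF r(1)]]] by (simp add: less_imp_le)
    finally show ?thesis by (simp add: BR_def)
  qed
  from unit_limit[OF DJ_T(1)[OF r(1)] T.res(1)[OF f] r(4) DJ_T(1)[OF u] le c]
  show "unit_cut (T.res f) \<in> fdom T" "fval T (unit_cut (T.res f)) (unit_cut (T.res f)) \<le> fval T (T.res f) (T.res f)" .
qed

lemma T_Markov:
  assumes u: "u \<in> fdom T"
  shows "unit_cut u \<in> fdom T" "fval T (unit_cut u) (unit_cut u) \<le> fval T u u"
proof -
  obtain f where f: "\<And>n. f n \<in> L2 mu" "(\<lambda>n. T.nrm (\<lambda>x. T.res (f n) x - u x)) \<longlonglongrightarrow> 0"
    using T.ran_res_dense[OF u] by blast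
  note R = T.res(1)[OF f(1)]
  from unit_limit[OF R u T.L2_tendsto[OF R u f(2)] unit_res[OF f(1)] T_fval_tendsto[OF R u f(2)]]
  show "unit_cut u \<in> fdom T" "fval T (unit_cut u) (unit_cut u) \<le> fval T u u" .
qed

end

section \<open>Density of compactly supported continuous functions\<close>

lemma Cc_add: "p \<in> Cc UNIV \<Longrightarrow> q \<in> Cc UNIV \<Longrightarrow> (\<lambda>x. p x + q x) \<in> Cc UNIV"
proof -
  assume "p \<in> Cc UNIV" "q \<in> Cc UNIV"
  then obtain K L where "continuous_on UNIV p" "compact K" "\<forall>x\<in>UNIV - K. p x = 0"
    "continuous_on UNIV q" "compact L" "\<forall>x\<in>UNIV - L. q x = 0"
    unfolding Cc_def by blast
  then show ?thesis
    unfolding Cc_def by (auto intro!: continuous_on_add exI[of _ "K \<union> L"] compact_Un)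
qed

lemma Cc_compose:
  assumes "p \<in> Cc UNIV" "continuous_on UNIV q" "\<And>x. p x = 0 \<Longrightarrow> q x = 0"
  shows "q \<in> Cc UNIV"
  using assms unfolding Cc_def by blast

context regular_form begin

text \<open>
  The compactly supported continuous functions in the domain of the form; a core of \<open>E\<close> by regularity.
\<close>
abbreviation VC :: "('a \<Rightarrow> real) set" where "VC \<equiv> Cc UNIV \<inter> fdom E"

lemma Cc_L2_mu:
  assumes p: "p \<in> Cc UNIV" shows "p \<in> L2 mu"
proof -
  obtain K where K: "continuous_on UNIV p" "compact K" "\<And>x. x \<notin> K \<Longrightarrow> p x = 0"
    using p unfolding Cc_def by blast
  have "bounded (p ` K)"
    using K by (intro compact_imp_bounded compact_continuous_image) (auto elim: continuous_on_subset)
  then obtain c where c: "\<And>x. x \<in> K \<Longrightarrow> \<bar>p x\<bar> \<le> c" by (auto simp: bounded_iff)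
  have pm: "p \<in> borel_measurable mu"
    unfolding measurable_mu_eq using K(1) by (rule borel_measurable_continuous_onI)
  have Kb: "K \<in> sets mu" using compact_imp_closed[OF K(2)] by simp
  have "emeasure mu K < \<infinity>" using radon_mu K(2) unfolding radon_measure_def by blast
  then have "integrable mu (\<lambda>x. indicator K x * c\<^sup>2 :: real)"
    using Kb by (intro integrable_mult_left integrable_real_indicator)
  then have "integrable mu (\<lambda>x. (p x)\<^sup>2)"
  proof (rule Bochner_Integration.integrable_bound)
    have "(p x)\<^sup>2 \<le> indicator K x * c\<^sup>2" for x
    proof (cases "x \<in> K")
      case True
      then show ?thesis using c[OF True] power_mono[of "\<bar>p x\<bar>" c 2] by simp
    next
      case False
      then show ?thesis using K(3) by simp
    qed
    then show "AE x in mu. norm ((p x)\<^sup>2) \<le> norm (indicator K x * c\<^sup>2 :: real)" by simp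
  qed (use pm in measurable)
  then show ?thesis using pm by (simp add: L2_def)
qed

lemma VC_DJ: "p \<in> VC \<Longrightarrow> p \<in> DJ"
  by (auto intro: DJ_I Cc_qc Cc_L2_mu)

sublocale S: shifted_trace m E mu 1
  by unfold_locales simp

lemma BJ1: "S.BJ u v = form1 m E u v + L2_inner mu u v"
  by (simp add: S.BJ_def S.Elam_def form1_def)

text \<open>
  Approximate \<open>u\<close> by continuous \<open>p n\<close> in the norm of \<open>E\<close>. Their truncations between \<open>0\<close> and \<open>g\<close> still
  converge to \<open>u\<close>: boundedly in the form norm and strongly in \<open>L\<^sup>2(m)\<close>, thus weakly for \<open>E\<^sub>1\<close>; and in \<open>L\<^sup>2(\<mu>)\<close> along a
  subsequence by dominated convergence, as \<open>g\<close> is square integrable for \<open>\<mu>\<close>.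
\<close>
lemma truncation_limit:
  assumes h: "h \<in> DJ" and u: "u \<in> DJ" and g: "g \<in> DJ" and ug: "\<And>x. 0 \<le> u x" "\<And>x. u x \<le> g x"
    and zero: "\<And>p. p \<in> VC \<Longrightarrow> S.BJ h (\<lambda>x. min (max (p x) 0) (g x)) = 0"
  shows "S.BJ h u = 0"
proof -
  have "\<exists>p \<in> VC. nrm (\<lambda>x. u x - p x) < 1 / real (Suc n)" for n
    by (rule form_dense[OF DJ_dom[OF u]]) simp
  then have "\<forall>n. \<exists>p. p \<in> VC \<and> nrm (\<lambda>x. u x - p x) < 1 / real (Suc n)" by blast
  from choice[OF this] obtain p where p: "\<And>n. p n \<in> VC" "\<And>n. nrm (\<lambda>x. u x - p n x) < 1 / real (Suc n)"
    by blast
  have pd: "p n \<in> fdom E" for n using p(1) by blast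
  have pn: "nrm (\<lambda>x. p n x - u x) < 1 / real (Suc n)" for n
    using p(2)[of n] nrm_minus_commute[OF DJ_dom[OF u] pd] by simp
  have lim: "(\<lambda>n. nrm (\<lambda>x. p n x - u x)) \<longlonglongrightarrow> 0"
    by (rule Lim_null_comparison[OF _ LIMSEQ_Suc[OF lim_inverse_n']])
      (use pn nonneg[OF diff[OF pd DJ_dom[OF u]]] in \<open>auto simp: less_imp_le\<close>)
  obtain r where r: "strict_mono r" "AE x in mu. (\<lambda>n. p (r n) x) \<longlonglongrightarrow> u x"
    using qc_AE_subsequence[of p, OF DJ_qc[OF VC_DJ[OF p(1)]] DJ_qc[OF u] lim] by blast
  define q where "q n = (\<lambda>x. min (max (p (r n) x) 0) (g x))" for n
  have qJ: "q n \<in> DJ" for n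
    unfolding q_def using ug
    by (intro DJ_bound[OF g qc_min[OF qc_max0[OF DJ_qc[OF VC_DJ[OF p(1)]]] DJ_qc[OF g]]])
      (auto simp: min_def abs_if intro: order.trans)
  have qu: "\<bar>q n x - u x\<bar> \<le> \<bar>p (r n) x - u x\<bar>" for n x
    using ug[of x] by (auto simp: q_def min_def max_def)
  have "L2_norm m (\<lambda>x. q n x - u x) \<le> nrm (\<lambda>x. p (r n) x - u x)" for n
  proof -
    note d = diff[OF pd[of "r n"] DJ_dom[OF u]]
    have "L2_norm m (\<lambda>x. q n x - u x) \<le> L2_norm m (\<lambda>x. p (r n) x - u x)"
      using dom_L2[OF d] dom_measurable[OF diff[OF DJ_dom[OF qJ] DJ_dom[OF u]]] qu by (intro L2_norm_mono) auto
    then show ?thesis using L2_norm_le_nrm[OF d] by linarith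
  qed
  then have L2m: "(\<lambda>n. L2_norm m (\<lambda>x. q n x - u x)) \<longlonglongrightarrow> 0"
    by (intro Lim_null_comparison[OF _ LIMSEQ_subseq_LIMSEQ[OF lim r(1)]])
      (auto simp: L2_norm_nonneg comp_def)
  have nb: "nrm (q n) \<le> 2 * (nrm u + 1) + nrm g" for n
  proof -
    note pr = positive_part[OF pd[of "r n"]]
    have "nrm (p (r n)) \<le> nrm u + nrm (\<lambda>x. p (r n) x - u x)"
      using nrm_add[OF DJ_dom[OF u] diff[OF pd[of "r n"] DJ_dom[OF u]]] by simp
    moreover have "1 / real (Suc (r n)) \<le> 1" by simp
    ultimately have "nrm (p (r n)) \<le> nrm u + 1" using pn[of "r n"] by linarith
    with pr(2) have "nrm (\<lambda>x. max (p (r n) x) 0) \<le> nrm u + 1" by (rule order.trans)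
    then have "2 * nrm (\<lambda>x. max (p (r n) x) 0) \<le> 2 * (nrm u + 1)"
      by (rule mult_left_mono) simp
    then show ?thesis
      unfolding q_def by (rule order.trans[OF minimum(2)[OF pr(1) DJ_dom[OF g]] add_right_mono])
  qed
  have "AE x in mu. (\<lambda>n. q n x) \<longlonglongrightarrow> u x"
    using r(2)
  proof eventually_elim
    case (elim x)
    have "(\<lambda>n. min (max (p (r n) x) 0) (g x)) \<longlonglongrightarrow> min (max (u x) 0) (g x)"
      by (intro tendsto_intros elim)
    then show ?case using ug[of x] by (simp add: q_def max_def min_def)
  qed
  then have "(\<lambda>n. L2_norm mu (\<lambda>x. q n x - u x)) \<longlonglongrightarrow> 0"
  proof (intro L2_dominated_convergence(2)[OF DJ_L2[OF g]])
    show "AE x in mu. \<bar>q n x\<bar> \<le> \<bar>g x\<bar>" for n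
      using ug by (intro AE_I2) (auto simp: q_def min_def abs_if intro: order.trans)
  qed (use L2_D(1)[OF DJ_L2[OF qJ]] L2_D(1)[OF DJ_L2[OF u]] in auto)
  from L2.tendsto_B[OF DJ_L2[OF qJ] DJ_L2[OF u] DJ_L2[OF h]] this
  have "(\<lambda>n. L2_inner mu h (q n)) \<longlonglongrightarrow> L2_inner mu h u"
    by (simp add: L2_norm_def L2_inner_def mult.commute)
  from tendsto_add[OF weak_convergence[OF DJ_dom[OF qJ] DJ_dom[OF u] L2m nb DJ_dom[OF h]] this]
  have "(\<lambda>n. S.BJ h (q n)) \<longlonglongrightarrow> S.BJ h u" by (simp add: BJ1)
  moreover have "S.BJ h (q n) = 0" for n unfolding q_def by (rule zero[OF p(1)])
  ultimately show ?thesis by (simp add: LIMSEQ_const_iff)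
qed

lemma VC_min_max: 
  assumes "p \<in> VC" "g \<in> VC" shows "(\<lambda>x. min (max (p x) 0) (g x)) \<in> VC"
proof
  show "(\<lambda>x. min (max (p x) 0) (g x)) \<in> fdom E"
    using assms by (intro minimum(1) positive_part(1)) auto
  have "continuous_on UNIV p" "continuous_on UNIV g" using assms by (auto simp: Cc_def)
  then have c: "continuous_on UNIV (\<lambda>x. min (max (p x) 0) (g x))" by (intro continuous_intros)
  obtain K L where "compact K" "\<forall>x\<in>UNIV - K. p x = 0" "compact L" "\<forall>x\<in>UNIV - L. g x = 0"
    using assms unfolding Cc_def by blast
  then show "(\<lambda>x. min (max (p x) 0) (g x)) \<in> Cc UNIV"
    unfolding Cc_def using c by (auto intro!: exI[of _ "K \<union> L"] compact_Un)
qed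

text \<open>
  The truncation argument is used twice: first with an upper bound \<open>g\<close> that is itself continuous with compact
  support, and then with \<open>u\<close> as its own upper bound, where the truncations \<open>min (p\<^sup>+) u\<close> lie below the continuous
  function \<open>p\<^sup>+\<close> and are thus covered by the first case.
\<close>
lemma orthogonal_VC:
  assumes h: "h \<in> DJ" and orth: "\<And>p. p \<in> VC \<Longrightarrow> S.BJ h p = 0"
  shows "S.BJ h h = 0"
proof -
  have step1: "S.BJ h u = 0" if "u \<in> DJ" "g \<in> VC" "\<And>x. 0 \<le> u x" "\<And>x. u x \<le> g x" for u g
    by (rule truncation_limit[OF h that(1) VC_DJ[OF that(2)] that(3,4) orth[OF VC_min_max[OF _ that(2)]]])
  have pos: "S.BJ h u = 0" if u: "u \<in> DJ" and u0: "\<And>x. 0 \<le> u x" for u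
  proof (rule truncation_limit[OF h u u u0 order.refl])
    fix p assume p: "p \<in> VC"
    \<comment> \<open>The upper bound \<open>p\<^sup>+\<close> for the first case.\<close>
    have p0: "(\<lambda>x. max (p x) 0) \<in> VC"
      using p by (auto intro!: positive_part(1) Cc_compose[of p] continuous_intros simp: Cc_def)
    show "S.BJ h (\<lambda>x. min (max (p x) 0) (u x)) = 0"
    proof (rule step1[OF _ p0])
      show "(\<lambda>x. min (max (p x) 0) (u x)) \<in> DJ"
        using u0 by (intro DJ_bound[OF u qc_min[OF qc_max0[OF DJ_qc[OF VC_DJ[OF p]]] DJ_qc[OF u]]])
          (auto simp: min_def abs_if intro: order.trans)
    qed (use u0 in auto)
  qed
  have m: "(\<lambda>x. max (- h x) 0) \<in> DJ" using DJ_max0[OF DJ_scale[OF h, of "-1"]] by simp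
  have "h = (\<lambda>x. max (h x) 0 - max (- h x) 0)" by (auto simp: max_def)
  then have "S.BJ h h = S.BJ h (\<lambda>x. max (h x) 0 - max (- h x) 0)" by simp
  also have "\<dots> = 0"
    using pos[OF DJ_max0[OF h]] pos[OF m] by (simp add: S.J.B_diff_right[OF DJ_max0[OF h] m h])
  finally show ?thesis .
qed

sublocale VC: semi_inner VC S.BJ
proof
  fix u v :: "'a \<Rightarrow> real" and c assume u: "u \<in> VC"
  show "S.BJ (\<lambda>x. c * u x) v = c * S.BJ u v" if "v \<in> VC" using u that by (intro S.J.B_scale VC_DJ)
  show "(\<lambda>x. c * u x) \<in> VC"
    using u by (auto intro!: scale Cc_compose[of u] continuous_intros simp: Cc_def)
  show "0 \<le> S.BJ u u" using u by (intro S.J.nonneg VC_DJ)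
  assume v: "v \<in> VC"
  show "(\<lambda>x. u x + v x) \<in> VC" using u v by (auto intro: add Cc_add)
  show "S.BJ u v = S.BJ v u" using u v by (intro S.J.sym VC_DJ)
  show "S.BJ (\<lambda>x. u x + v x) w = S.BJ u w + S.BJ v w" if "w \<in> VC" for w
    using u v that by (intro S.J.B_add VC_DJ)
qed (auto simp: zero Cc_def intro!: exI[of _ "{}"])

text \<open>
  Project \<open>u\<close> onto the closure of the continuous functions; the difference is orthogonal to them.
\<close>
lemma VC_dense:
  assumes u: "u \<in> DJ" and e: "e > 0"
  shows "\<exists>p\<in>VC. S.J.nrm (\<lambda>x. u x - p x) < e"
proof -
  obtain v where v: "\<And>n. v n \<in> VC" "VC.Cauchy_sequence v"
    "\<And>w. w \<in> VC \<Longrightarrow> (\<lambda>n. S.BJ (v n) w) \<longlonglongrightarrow> S.BJ u w"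
  proof (rule VC.weak_riesz[where l = "S.BJ u" and C = "S.BJ u u"])
    fix a b c assume a: "a \<in> VC"
    show "S.BJ u (\<lambda>x. c * a x) = c * S.BJ u a" by (rule S.J.B_scale_right[OF VC_DJ[OF a] u])
    show "(S.BJ u a)\<^sup>2 \<le> S.BJ u u * S.BJ a a" by (rule S.J.cauchy_schwarz[OF u VC_DJ[OF a]])
    assume "b \<in> VC"
    then show "S.BJ u (\<lambda>x. a x + b x) = S.BJ u a + S.BJ u b"
      by (intro S.J.B_add_right VC_DJ a u)
  qed blast
  note vJ = VC_DJ[OF v(1)]
  have "S.J.Cauchy_sequence v" using v(2) unfolding VC.Cauchy_sequence_def S.J.Cauchy_sequence_def .
  then obtain p where p: "p \<in> DJ" "(\<lambda>n. S.J.nrm (\<lambda>x. v n x - p x)) \<longlonglongrightarrow> 0"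
    using S.J_complete[of v, OF vJ] by blast
  note hJ = DJ_diff[OF u p(1)]
  have "S.BJ (\<lambda>x. u x - p x) w = 0" if w: "w \<in> VC" for w
    using LIMSEQ_unique[OF S.J.tendsto_B[OF vJ p(1) VC_DJ[OF w] p(2)] v(3)[OF w]]
    by (simp add: S.J.B_diff[OF u p(1) VC_DJ[OF w]])
  from orthogonal_VC[OF hJ this] have h0: "S.J.nrm (\<lambda>x. u x - p x) = 0" by simp
  obtain n where n: "S.J.nrm (\<lambda>x. v n x - p x) < e"
    using order_tendstoD(2)[OF p(2) e] by (auto simp: eventually_sequentially)
  have "S.J.nrm (\<lambda>x. u x - v n x) < e"
    using S.J.nrm_triangle[OF u p(1) vJ[of n]] S.J.nrm_minus_commute[OF p(1) vJ[of n]] h0 n by linarith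
  then show ?thesis using v(1) by blast
qed

end

lemma (in trace_limit) VC_T_dense:
  assumes u: "u \<in> fdom T" and e: "e > 0"
  shows "\<exists>p\<in>VC. p \<in> fdom T \<and> T.nrm (\<lambda>x. u x - p x) < e"
proof -
  obtain v where v: "v \<in> DJ" "T.nrm (\<lambda>x. u x - v x) < e / 2" using DJ_core[OF u, of "e/2"] e by auto
  obtain p where p: "p \<in> VC" "S.J.nrm (\<lambda>x. v x - p x) < e / 2" using VC_dense[OF v(1), of "e/2"] e by auto
  note d = DJ_diff[OF v(1) VC_DJ[OF p(1)]]
  have "form1 mu T (\<lambda>x. v x - p x) (\<lambda>x. v x - p x) \<le> S.BJ (\<lambda>x. v x - p x) (\<lambda>x. v x - p x)"
    using DJ_T(2)[OF d] L2.nonneg[OF dom_L2[OF DJ_dom[OF d]]] by (simp add: BJ1 form1_def)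
  then have "T.nrm (\<lambda>x. v x - p x) \<le> S.J.nrm (\<lambda>x. v x - p x)" by simp
  then have "T.nrm (\<lambda>x. u x - p x) < e"
    using T.nrm_triangle[OF u DJ_T(1)[OF v(1)] DJ_T(1)[OF VC_DJ[OF p(1)]]] v(2) p(2) by linarith
  then show ?thesis using p(1) DJ_T(1)[OF VC_DJ[OF p(1)]] by blast
qed

section \<open>Restriction to the support\<close>

lemma closed_measure_support: "closed (measure_support M)"
proof -
  have "- measure_support M = \<Union>{U. open U \<and> emeasure M U = 0}"
    by (auto simp: measure_support_def zero_less_iff_neq_zero)
  then have "open (- measure_support M)" by auto
  then show ?thesis by (simp add: closed_def)
qed

text \<open>
  By inner regularity it suffices to consider compact subsets of the complement, and these are covered by
  finitely many open null sets.
\<close>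
lemma AE_measure_support:
  fixes M :: "'a::t2_space measure"
  assumes M: "radon_measure M"
  shows "AE x in M. x \<in> measure_support M"
proof -
  let ?N = "- measure_support M"
  have sets: "sets M = sets borel" and
    inner: "\<And>A. A \<in> sets borel \<Longrightarrow> emeasure M A = (SUP K\<in>{K. compact K \<and> K \<in> sets borel \<and> K \<subseteq> A}. emeasure M K)"
    using M by (auto simp: radon_measure_def)
  have N: "?N \<in> sets borel" using closed_measure_support[of M] by (simp add: open_Compl)
  have null: "emeasure M K = 0" if K: "compact K" "K \<subseteq> ?N" for K
  proof -
    have cover: "K \<subseteq> \<Union>{U. open U \<and> emeasure M U = 0}"
      using K(2) by (auto simp: measure_support_def zero_less_iff_neq_zero)
    obtain D where D: "D \<subseteq> {U. open U \<and> emeasure M U = 0}" "finite D" "K \<subseteq> \<Union>D"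
      by (rule compactE[OF K(1) cover]) (blast, rule that)
    have "\<Union>D \<in> null_sets M"
      using D(1,2) sets by (intro null_sets.finite_Union) (auto simp: null_sets_def)
    then have "K \<in> null_sets M" using D(3) compact_imp_closed[OF K(1)] sets by (auto intro: null_sets_subset)
    then show ?thesis by (simp add: null_sets_def)
  qed
  have "emeasure M ?N = 0"
    unfolding inner[OF N] by (auto intro!: antisym SUP_least simp: null)
  then have "?N \<in> null_sets M" using N sets by (auto simp: null_sets_def)
  then show ?thesis by (rule AE_I') auto
qed

text \<open>
  Extend by zero to the complement of a relatively compact neighbourhood of the support, and only then apply
  Tietze's theorem, to the union of both closed sets. In this way, the extension has compact support without a cutoff
  function.
\<close>
lemma Cc_extension:
  fixes F :: "'a::metric_space set"
  assumes lc: "locally_compact_space (euclidean :: 'a topology)" and F: "closed F" and p: "p \<in> Cc F"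
  obtains q where "q \<in> Cc UNIV" "\<And>x. x \<in> F \<Longrightarrow> q x = p x"
proof -
  obtain K where K: "continuous_on F p" "compact K" "K \<subseteq> F" "\<And>x. x \<in> F \<Longrightarrow> x \<notin> K \<Longrightarrow> p x = 0"
    using p unfolding Cc_def by blast
  obtain U C where U: "open U" "compact C" "K \<subseteq> U" "U \<subseteq> C"
  proof -
    have "\<exists>U C. open U \<and> compact C \<and> x \<in> U \<and> U \<subseteq> C" for x :: 'a
      using lc unfolding locally_compact_space_def by simp
    then obtain U C where UC: "\<And>x::'a. open (U x)" "\<And>x. compact (C x)" "\<And>x. x \<in> U x" "\<And>x. U x \<subseteq> C x"
      by metis
    obtain D where D: "D \<subseteq> K" "finite D" "K \<subseteq> (\<Union>x\<in>D. U x)"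
      by (rule compactE_image[OF K(2), of K U]) (use UC(1,3) that in auto)
    show thesis
    proof (rule that[of "\<Union>x\<in>D. U x" "\<Union>x\<in>D. C x"])
      show "open (\<Union>x\<in>D. U x)" using UC(1) by blast
      show "compact (\<Union>x\<in>D. C x)" using D(2) UC(2) by (intro compact_UN) auto
      show "(\<Union>x\<in>D. U x) \<subseteq> (\<Union>x\<in>D. C x)" using UC(4) by (intro UN_mono) auto
    qed (rule D(3))
  qed
  define f where "f x = (if x \<in> F then p x else 0)" for x
  have "continuous_on (F \<union> - U) f"
    unfolding f_def
  proof (rule continuous_on_cases[OF F])
    show "closed (- U)" using U(1) by (simp add: closed_Compl)
    show "\<forall>x. x \<in> F \<and> x \<notin> F \<or> x \<in> - U \<and> x \<in> F \<longrightarrow> p x = 0"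
      using K(4) U(3) by blast
  qed (use K(1) in auto)
  then have cf: "continuous_map (subtopology euclidean (F \<union> - U)) euclideanreal f" by simp
  have "normal_space (euclidean :: 'a topology)"
    by (rule metrizable_imp_normal_space[OF metrizable_space_euclidean])
  moreover have "closedin euclidean (F \<union> - U)" using F U(1) by (auto simp: closed_Compl)
  ultimately obtain g where g: "continuous_map euclidean euclideanreal g" "\<And>x. x \<in> F \<union> - U \<Longrightarrow> g x = f x"
    using normal_space_iff_Tietze cf by metis
  show thesis
  proof (rule that[of g])
    have "g x = 0" if "x \<notin> C" for x
      using that g(2)[of x] U(3,4) K(4)[of x] by (cases "x \<in> F") (auto simp: f_def)
    then show "g \<in> Cc UNIV" using g(1) U(2) by (auto simp: Cc_def)
    show "g x = p x" if "x \<in> F" for x using g(2)[of x] that by (simp add: f_def)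
  qed
qed

text \<open>
  A closed form in \<open>L\<^sup>2(\<mu>)\<close> with \<open>\<mu>\<close> concentrated on \<open>F\<close>, regarded as a form in \<open>L\<^sup>2(F, \<mu>)\<close>.
\<close>
locale restriction = closed_form_space mu T
  for mu :: "'a::topological_space measure" and T :: "'a form" +
  fixes F :: "'a set"
  assumes sets_mu: "sets mu = sets borel" and F_borel: "F \<in> sets borel" and F_full: "AE x in mu. x \<in> F"
begin

abbreviation "muF \<equiv> restrict_space mu F"
abbreviation "TF \<equiv> form_on F T"

lemma space_muF: "space muF = F"
  using sets_eq_imp_space_eq[OF sets_mu] by (simp add: space_restrict_space)

lemma F_sets: "F \<inter> space mu \<in> sets mu"
  using sets_eq_imp_space_eq[OF sets_mu] F_borel sets_mu by simp

lemma zero_ext_eq: "zero_ext F v = (\<lambda>x. indicator F x *\<^sub>R v x)"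
  by (auto simp: zero_ext_def indicator_def)

lemma measurable_muF: "v \<in> borel_measurable muF \<longleftrightarrow> zero_ext F v \<in> borel_measurable mu"
  unfolding zero_ext_eq by (rule borel_measurable_restrict_space_iff[OF F_sets])

lemma L2_muF: "v \<in> L2 muF \<longleftrightarrow> zero_ext F v \<in> L2 mu"
proof -
  have "(\<lambda>x. indicator F x *\<^sub>R (v x)\<^sup>2) = (\<lambda>x. (zero_ext F v x)\<^sup>2)"
    by (auto simp: zero_ext_def indicator_def)
  then show ?thesis by (simp add: L2_def measurable_muF integrable_restrict_space[OF F_sets])
qed

lemma L2_inner_muF: "L2_inner muF u v = L2_inner mu (zero_ext F u) (zero_ext F v)"
proof -
  have "(\<lambda>x. indicator F x *\<^sub>R (u x * v x)) = (\<lambda>x. zero_ext F u x * zero_ext F v x)"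
    by (auto simp: zero_ext_def indicator_def)
  then show ?thesis by (simp add: L2_inner_def integral_restrict_space[OF F_sets])
qed

lemma AE_muF: "(AE x in muF. P x) \<longleftrightarrow> (AE x in mu. x \<in> F \<longrightarrow> P x)"
  by (rule AE_restrict_space_iff[OF F_sets])

lemma zero_ext_AE: "AE x in mu. zero_ext F v x = v x"
  using F_full by eventually_elim (simp add: zero_ext_def)

lemma zero_ext_simps:
  "zero_ext F (\<lambda>x. u x + v x) = (\<lambda>x. zero_ext F u x + zero_ext F v x)"
  "zero_ext F (\<lambda>x. u x - v x) = (\<lambda>x. zero_ext F u x - zero_ext F v x)"
  "zero_ext F (\<lambda>x. c * u x) = (\<lambda>x. c * zero_ext F u x)"
  "zero_ext F (\<lambda>x. 0) = (\<lambda>x. 0)"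
  "zero_ext F (\<lambda>x. min (max (u x) 0) 1) = (\<lambda>x. min (max (zero_ext F u x) 0) 1)"
  by (auto simp: zero_ext_def)

lemma zero_ext_measurable:
  assumes "v \<in> borel_measurable mu" shows "zero_ext F v \<in> borel_measurable mu"
  unfolding zero_ext_def using assms F_borel by (intro measurable_If_set) (auto simp: sets_mu F_sets)

lemma zero_ext_dom:
  assumes "v \<in> fdom T" shows "zero_ext F v \<in> fdom T"
proof (rule dom_cong[OF assms zero_ext_measurable[OF dom_measurable[OF assms]]])
  show "AE x in mu. v x = zero_ext F v x" using zero_ext_AE[of v] by eventually_elim simp
qed

lemma form1_TF: "form1 muF TF u v = form1 mu T (zero_ext F u) (zero_ext F v)"
  by (simp add: form1_def form_on_def L2_inner_muF)

lemma form_norm_TF: "form_norm muF TF u = nrm (zero_ext F u)"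
  by (simp add: form_norm_form1 form1_TF)

lemma form_norm_diff:
  assumes "zero_ext F u \<in> fdom T" "v \<in> fdom T"
  shows "form_norm muF TF (\<lambda>x. u x - v x) = nrm (\<lambda>x. zero_ext F u x - v x)"
  unfolding form_norm_TF zero_ext_simps
  by (intro arg_cong[of _ _ sqrt] form1_cong diff zero_ext_dom assms)
    (use zero_ext_AE[of v] in \<open>auto elim: eventually_mono\<close>)

lemma positive_TF: "positive_form muF TF"
proof -
  have dom: "v \<in> fdom TF \<longleftrightarrow> zero_ext F v \<in> fdom T" for v by (simp add: form_on_def)
  have val: "fval TF u v = fval T (zero_ext F u) (zero_ext F v)" for u v by (simp add: form_on_def)
  have AE: "AE x in mu. zero_ext F u x = zero_ext F v x" if "AE x in muF. u x = v x" for u v :: "'a \<Rightarrow> real"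
    using that unfolding AE_muF by eventually_elim (simp add: zero_ext_def)
  show ?thesis
    unfolding positive_form_def
  proof (intro conjI ballI allI impI subsetI)
    fix v assume "v \<in> fdom TF"
    then show "v \<in> L2 muF" using dom_L2 by (simp add: dom L2_muF)
  next
    fix u v assume "u \<in> fdom TF" "v \<in> borel_measurable muF" "AE x in muF. u x = v x"
    then show "v \<in> fdom TF"
      using dom_cong[of "zero_ext F u" "zero_ext F v"] AE[of u v] by (simp add: dom measurable_muF)
  next
    fix u u' v assume "u \<in> fdom TF" "u' \<in> fdom TF" "v \<in> fdom TF" "AE x in muF. u x = u' x"
    then show "fval TF u v = fval TF u' v"
      using fval_cong_left[of "zero_ext F u" "zero_ext F u'" "zero_ext F v"] AE[of u u'] by (simp add: dom val)
  next
    fix u v assume "u \<in> fdom TF" "v \<in> fdom TF"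
    then show "fval TF u v = fval TF v u"
      using fval.sym[of "zero_ext F u" "zero_ext F v"] by (simp add: dom val)
  qed (simp_all add: dom val zero_ext_simps zero add scale fval.B_add fval.B_scale fval.nonneg)
qed

lemma closed_TF: "closed_form muF TF"
  unfolding closed_form_def
proof (intro conjI allI impI)
  fix u :: "nat \<Rightarrow> 'a \<Rightarrow> real"
  assume u: "(\<forall>n. u n \<in> fdom TF) \<and> (\<forall>\<epsilon>>0. \<exists>N. \<forall>i\<ge>N. \<forall>j\<ge>N. form_norm muF TF (\<lambda>x. u i x - u j x) < \<epsilon>)"
  have "Cauchy_sequence (\<lambda>n. zero_ext F (u n))"
    using u unfolding Cauchy_sequence_def form_norm_TF zero_ext_simps by blast
  then obtain w where w: "w \<in> fdom T" "(\<lambda>n. nrm (\<lambda>x. zero_ext F (u n) x - w x)) \<longlonglongrightarrow> 0"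
    using complete[of "\<lambda>n. zero_ext F (u n)"] u by (auto simp: form_on_def)
  have "form_norm muF TF (\<lambda>x. u n x - w x) = nrm (\<lambda>x. zero_ext F (u n) x - w x)" for n
    using u by (intro form_norm_diff w) (simp add: form_on_def)
  then show "\<exists>w\<in>fdom TF. (\<lambda>n. form_norm muF TF (\<lambda>x. u n x - w x)) \<longlonglongrightarrow> 0"
    using w zero_ext_dom by (intro bexI[of _ w]) (auto simp: form_on_def)
qed (rule positive_TF)

lemma dense_TF:
  assumes "densely_defined_form mu T" shows "densely_defined_form muF TF"
  unfolding densely_defined_form_def
proof (intro ballI allI impI)
  fix f and e :: real assume f: "f \<in> L2 muF" and e: "e > 0"
  then obtain u where u: "u \<in> fdom T" "L2_norm mu (\<lambda>x. zero_ext F f x - u x) < e"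
    using assms unfolding densely_defined_form_def L2_muF by blast
  have fL: "zero_ext F f \<in> L2 mu" using f by (simp add: L2_muF)
  have "L2_norm muF (\<lambda>x. f x - u x) = L2_norm mu (\<lambda>x. zero_ext F f x - u x)"
    unfolding L2_norm_def L2_inner_muF zero_ext_simps
    using zero_ext_AE[of u] L2_D(1)[OF L2.diff[OF fL dom_L2[OF u(1)]]]
      L2_D(1)[OF L2.diff[OF fL dom_L2[OF zero_ext_dom[OF u(1)]]]]
    by (intro arg_cong[of _ _ sqrt] L2_inner_cong_AE) (auto elim: eventually_mono)
  then show "\<exists>u\<in>fdom TF. L2_norm muF (\<lambda>x. f x - u x) < e"
    using u zero_ext_dom by (intro bexI[of _ u]) (auto simp: form_on_def)
qed

end

theorem proposition5p3:
  fixes m mu :: "'a::metric_space measure"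
    and E T :: "'a form"
  assumes "locally_compact_space (euclidean :: 'a topology)"
    and "separable_space (euclidean :: 'a topology)"
    and "radon_measure m"
    and "measure_support m = UNIV"
    and "radon_measure mu"
    and "regular_dirichlet_form m E"
    and "\<forall>A\<in>sets borel. capacity m E A = 0 \<longrightarrow> emeasure mu A = 0"
    and "is_trace_form m E mu T"
  shows "regular_dirichlet_form (restrict_space mu (measure_support mu))
           (form_on (measure_support mu) T)"
proof -
  let ?F = "measure_support mu"
  have sets_m: "sets m = sets borel" and sets_mu: "sets mu = sets borel"
    using assms(3,5) by (auto simp: radon_measure_def)
  have space_m: "space m = UNIV" using sets_eq_imp_space_eq[OF sets_m] by simp
  have dirichlet: "dirichlet_form m E" using assms(6) by (simp add: regular_dirichlet_form_def)
  interpret E: dirichlet_form_space m E by (rule dirichlet_form_space_iff[OF dirichlet])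
  interpret trace_limit m E mu T
  proof unfold_locales
    show "\<exists>p\<in>Cc UNIV \<inter> fdom E. E.nrm (\<lambda>x. u x - p x) < e" if "u \<in> fdom E" "e > 0" for u e
      using assms(6) that unfolding regular_dirichlet_form_def space_m form_norm_form1 by blast
    show "\<exists>q\<in>Cc UNIV \<inter> fdom E. \<forall>x. \<bar>p x - q x\<bar> < e" if "p \<in> Cc UNIV" "e > 0" for p e
      using assms(6) that unfolding regular_dirichlet_form_def space_m by blast
    show "emeasure mu N = 0" if "N \<in> sets borel" "capacity m E N = 0" for N
      using assms(7) that by blast
  qed (use assms(3,5,8) in \<open>auto simp: is_trace_form_def\<close>)
  have F: "closed ?F" by (rule closed_measure_support)
  interpret R: restriction mu T ?F
    by unfold_locales (use F AE_measure_support[OF assms(5)] sets_mu in auto)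
  have Cc_restrict: "p \<in> Cc ?F" if "p \<in> Cc UNIV" for p
    using that F unfolding Cc_def
    by (auto elim: continuous_on_subset intro!: exI[of _ "_ \<inter> ?F"] compact_Int_closed)
  have VC_TF: "p \<in> Cc ?F \<inter> fdom R.TF" if "p \<in> VC" for p
    using Cc_restrict[of p] R.zero_ext_dom[OF DJ_T(1)[OF VC_DJ[OF that]]] that by (simp add: form_on_def)
  show ?thesis
    unfolding regular_dirichlet_form_def dirichlet_form_def R.space_muF
  proof (intro conjI ballI allI impI)
    show "closed_form R.muF R.TF" by (rule R.closed_TF)
    show "densely_defined_form R.muF R.TF" by (rule R.dense_TF) (use assms(8) in \<open>simp add: is_trace_form_def\<close>)
  next
    fix u assume u: "u \<in> fdom R.TF"
    then have "zero_ext ?F u \<in> fdom T" by (simp add: form_on_def)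
    note M = T_Markov[OF this, unfolded unit_cut_def[abs_def]]
    show "(\<lambda>x. min (max (u x) 0) 1) \<in> fdom R.TF"
      using M(1) by (simp add: form_on_def R.zero_ext_simps)
    show "fval R.TF (\<lambda>x. min (max (u x) 0) 1) (\<lambda>x. min (max (u x) 0) 1) \<le> fval R.TF u u"
      using M(2) by (simp add: form_on_def R.zero_ext_simps)
  next
    fix u and e :: real assume u: "u \<in> fdom R.TF" and e: "e > 0"
    then have uT: "zero_ext ?F u \<in> fdom T" by (simp add: form_on_def)
    obtain p where p: "p \<in> VC" "p \<in> fdom T" "T.nrm (\<lambda>x. zero_ext ?F u x - p x) < e"
      using VC_T_dense[OF uT e] by blast
    then have "form_norm R.muF R.TF (\<lambda>x. u x - p x) < e"
      using R.form_norm_diff[OF uT p(2)] by simp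
    then show "\<exists>p\<in>Cc ?F \<inter> fdom R.TF. form_norm R.muF R.TF (\<lambda>x. u x - p x) < e"
      using VC_TF[OF p(1)] by blast
  next
    fix p and e :: real assume p: "p \<in> Cc ?F" and e: "e > 0"
    obtain q where q: "q \<in> Cc UNIV" "\<And>x. x \<in> ?F \<Longrightarrow> q x = p x"
      using Cc_extension[OF assms(1) F p] by blast
    obtain s where s: "s \<in> VC" "\<And>x. \<bar>q x - s x\<bar> < e"
      using uniform_dense[OF q(1) e] by blast
    then have "\<forall>x\<in>?F. \<bar>p x - s x\<bar> < e" using q(2) by metis
    then show "\<exists>s\<in>Cc ?F \<inter> fdom R.TF. \<forall>x\<in>?F. \<bar>p x - s x\<bar> < e"
      using VC_TF[OF s(1)] by blast
  qed
qed

end
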